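(* There exist a probability measure $\nu_{QSD}$ on $E$ and constants $C$ and $\alpha<1$ such that, for all probability measures $\mu$ on $E$ and all integers $n\ge 0$, $$\left\|\mathbb{P}_\mu(X_n\in\cdot\mid n<\tau_\partial)-\nu_{QSD}\right\|_{TV}\le C\alpha^n,$$ if and only if Condition (E) (defined in the context) is satisfied with a bounded function $\varphi_1$ and there exists an integer $n_4'>0$ such that $$\inf_{x\in E}\mathbb{P}_x(X_{n_4'}\in K\mid n_4'<\tau_\partial)>0.$$
   Context: Setting. $E$ is a measurable space, $\partial\notin E$, $I$ is $\mathbb{R}_+$ or $\frac1k\mathbb{Z}_+$ for some $k\in\mathbb{N}=\{1,2,\ldots\}$, and $(X_t)_{t\in I}$ is a time-homogeneous Markov process in $E\cup\{\partial\}$, with law $\mathbb{P}_x$ when started from $x$, and $\mathbb{P}_\mu=\int\mathbb{P}_x\,\mu(\mathrm dx)$. The point $\partial$ is absorbing: $X_t=\partial$ for all $t\ge\tau_\partial:=\inf\{t\in I:X_t=\partial\}$ almost surely. For $n\in\mathbb{Z}_+$, $P_nf(x)=\mathbb{E}_x(f(X_n)\mathbf{1}_{n<\tau_\partial})$. The conditional probabilities above are understood to be well defined, i.e. $\mathbb{P}_x(n<\tau_\partial)>0$ for all $x\in E$ and $n\in\mathbb{Z}_+$. $\|\cdot\|_{TV}$ is the total variation norm, $\|\mu_1-\mu_2\|_{TV}=\sup_{|f|\le1}|\mu_1(f)-\mu_2(f)|$. Condition (E). There exist a positive integer $n_1$, positive real constants $\theta_1,\theta_2,c_1,c_2,c_3$,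 two measurable functions $\varphi_1,\varphi_2:E\to\mathbb{R}_+$ and a probability measure $\nu$ on a measurable subset $K\subset E$ such that: - (E1) for all $x\in K$, $\mathbb{P}_x(X_{n_1}\in\cdot)\ge c_1\nu(\cdot\cap K)$. - (E2) $\theta_1<\theta_2$, $\inf_E\varphi_1\ge1$, $\sup_K\varphi_1<\infty$, $\inf_K\varphi_2>0$, $\sup_E\varphi_2\le1$, and for all $x\in E$, $P_1\varphi_1(x)\le\theta_1\varphi_1(x)+c_2\mathbf{1}_K(x)$ and $P_1\varphi_2(x)\ge\theta_2\varphi_2(x)$. - (E3) $\displaystyle\sup_{n\in\mathbb{Z}_+}\frac{\sup_{y\in K}\mathbb{P}_y(n<\tau_\partial)}{\inf_{y\in K}\mathbb{P}_y(n<\tau_\partial)}\le c_3$. - (E4) for all $x\in K$ there exists $n_4(x)$ such that $\mathbb{P}_x(X_n\in K)>0$ for all $n\ge n_4(x)$. The set $K$ in the last display of the claim is the set $K$ of Condition (E). The constant $\alpha$ is in $(0,1)$ and $C>0$. *)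

theory Defs
  imports "HOL-Probability.Probability"
begin

text \<open>
  The cemetery point is \<^term>\<open>None\<close> and a point \<open>x\<close> of \<open>E\<close> is represented by \<^term>\<open>Some x\<close>, so that
  the cemetery lies outside \<open>E\<close> by construction.
\<close>

definition with_cemetery :: "'a measure \<Rightarrow> 'a option measure" where
  "with_cemetery E =
     sigma (insert None (Some ` space E)) (insert {None} ((`) Some ` sets E))"

definition absorption_time :: "real set \<Rightarrow> (real \<Rightarrow> 'w \<Rightarrow> 'a option) \<Rightarrow> 'w \<Rightarrow> ereal" where
  "absorption_time I X \<omega> = (INF t\<in>{t\<in>I. X t \<omega> = None}. ereal t)"

definition past ::
  "'a measure \<Rightarrow> real set \<Rightarrow> 'w measure \<Rightarrow> (real \<Rightarrow> 'w \<Rightarrow> 'a option) \<Rightarrow> real \<Rightarrow> 'w measure" where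
  "past E I M X t =
     sigma (space M)
       {X s -` A \<inter> space M | s A. s \<in> I \<and> s \<le> t \<and> A \<in> sets (with_cemetery E)}"

text \<open>
  \<open>M\<close> only carries the sample space with its sigma-algebra; its measure is irrelevant. The initial
  condition says that \<open>X 0\<close> has law \<open>\<delta>\<^sub>x\<close>, because singletons of \<open>E\<close> need not be measurable.
  The assumption \<open>survival_sets\<close> is what makes the probability of survival up to time \<open>n\<close>
  meaningful: for \<open>I = [0,\<infinity>)\<close> it does not follow from the measurability of each \<open>X t\<close>.
\<close>

locale absorbed_markov_process =
  fixes E :: "'a measure" and I :: "real set" and M :: "'w measure"
    and X :: "real \<Rightarrow> 'w \<Rightarrow> 'a option" and P :: "'a option \<Rightarrow> 'w measure"
  assumes time_set: "I = {0..} \<or> (\<exists>k::nat. k \<ge> 1 \<and> I = range (\<lambda>m::nat. real m / real k))"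
    and kernel: "P \<in> with_cemetery E \<rightarrow>\<^sub>M prob_algebra M"
    and process: "\<And>t. t \<in> I \<Longrightarrow> X t \<in> M \<rightarrow>\<^sub>M with_cemetery E"
    and start: "\<And>x. x \<in> space (with_cemetery E) \<Longrightarrow>
      distr (P x) (with_cemetery E) (X 0) = return (with_cemetery E) x"
    and markov: "\<And>x s t A. x \<in> space (with_cemetery E) \<Longrightarrow> s \<in> I \<Longrightarrow> t \<in> I \<Longrightarrow>
      A \<in> sets (with_cemetery E) \<Longrightarrow>
      AE \<omega> in P x.
        real_cond_exp (P x) (past E I M X t) (indicator {\<omega> \<in> space M. X (t + s) \<omega> \<in> A}) \<omega>
          = measure (P (X t \<omega>)) {\<omega>' \<in> space M. X s \<omega>' \<in> A}"
    and absorbing: "\<And>x. x \<in> space (with_cemetery E) \<Longrightarrow>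
      AE \<omega> in P x. \<forall>t\<in>I. absorption_time I X \<omega> \<le> ereal t \<longrightarrow> X t \<omega> = None"
    and survival_sets: "\<And>n::nat. {\<omega> \<in> space M. ereal (real n) < absorption_time I X \<omega>} \<in> sets M"
    and survival_pos: "\<And>x (n::nat). x \<in> space E \<Longrightarrow>
      \<P>(\<omega> in P (Some x). ereal (real n) < absorption_time I X \<omega>) > 0"

definition law_from :: "('a option \<Rightarrow> 'w measure) \<Rightarrow> 'a measure \<Rightarrow> 'w measure" where
  "law_from P \<mu> = \<mu> \<bind> (\<lambda>x. P (Some x))"

text \<open>
  The law of \<open>X n\<close> under \<open>Q\<close> conditioned on survival up to time \<open>n\<close>, as a measure on \<open>E\<close>. On the
  survival event \<open>X n\<close> is different from \<^term>\<open>None\<close>, so the restriction makes \<^term>\<open>the\<close> harmless.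
\<close>

definition conditioned_law ::
  "'a measure \<Rightarrow> real set \<Rightarrow> (real \<Rightarrow> 'w \<Rightarrow> 'a option) \<Rightarrow> 'w measure \<Rightarrow> nat \<Rightarrow> 'a measure" where
  "conditioned_law E I X Q n =
     (let S = {\<omega> \<in> space Q. ereal (real n) < absorption_time I X \<omega>}
      in distr (restrict_space (uniform_measure Q S) S) E (\<lambda>\<omega>. the (X (real n) \<omega>)))"

context absorbed_markov_process
begin

lemma space_with_cemetery: "space (with_cemetery E) = insert None (Some ` space E)"
  unfolding with_cemetery_def
  by (rule space_measure_of) (use sets.sets_into_space in blast)

lemma image_Some_sets: "A \<in> sets E \<Longrightarrow> Some ` A \<in> sets (with_cemetery E)"
  unfolding with_cemetery_def
  by (subst sets_measure_of) (use sets.sets_into_space in \<open>blast+\<close>)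

lemma nat_in_time_set: "real n \<in> I"
  using time_set
proof
  assume "\<exists>k::nat. k \<ge> 1 \<and> I = range (\<lambda>m::nat. real m / real k)"
  then obtain k :: nat where "k \<ge> 1" "I = range (\<lambda>m::nat. real m / real k)" by blast
  moreover then have "real n = real (n * k) / real k" by simp
  ultimately show ?thesis by blast
qed simp

lemma measure_conditioned_law:
  assumes "prob_space Q" "sets Q = sets M" "A \<in> sets E"
  shows "measure (conditioned_law E I X Q n) A =
    \<P>(\<omega> in Q. X (real n) \<omega> \<in> Some ` A \<bar> ereal (real n) < absorption_time I X \<omega>)"
proof -
  interpret Q: prob_space Q by fact
  define S where "S = {\<omega> \<in> space Q. ereal (real n) < absorption_time I X \<omega>}"
  have sp: "space Q = space M" using assms(2) by (rule sets_eq_imp_space_eq)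
  have S: "S \<in> sets Q" using survival_sets[of n] assms(2) sp by (simp add: S_def)
  have Xn: "X (real n) \<in> Q \<rightarrow>\<^sub>M with_cemetery E"
    using process[OF nat_in_time_set[of n]] measurable_cong_sets[OF assms(2) refl] by blast
  have ne: "\<exists>x\<in>space E. X (real n) \<omega> = Some x" if "\<omega> \<in> S" for \<omega>
  proof -
    have "X (real n) \<omega> \<noteq> None"
    proof
      assume "X (real n) \<omega> = None"
      then have "absorption_time I X \<omega> \<le> ereal (real n)"
        unfolding absorption_time_def by (intro INF_lower) (simp add: nat_in_time_set)
      then show False using that leD by (fastforce simp: S_def)
    qed
    moreover have "X (real n) \<omega> \<in> space (with_cemetery E)"
      using measurable_space[OF Xn] that by (simp add: S_def)
    ultimately show ?thesis by (auto simp: space_with_cemetery)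
  qed
  have pre: "(\<lambda>\<omega>. the (X (real n) \<omega>)) -` B \<inter> S = {\<omega> \<in> space Q. X (real n) \<omega> \<in> Some ` B} \<inter> S" for B
    using ne by (force simp: S_def)
  have ev: "{\<omega> \<in> space Q. X (real n) \<omega> \<in> Some ` B} \<in> sets Q" if "B \<in> sets E" for B
    using measurable_sets[OF Xn image_Some_sets[OF that]] by (simp add: vimage_def Int_def conj_commute)
  let ?R = "restrict_space (uniform_measure Q S) S"
  have spR: "space ?R = S" using S by (simp add: space_restrict_space)
  have f: "(\<lambda>\<omega>. the (X (real n) \<omega>)) \<in> ?R \<rightarrow>\<^sub>M E"
  proof (rule measurableI)
    show "the (X (real n) \<omega>) \<in> space E" if "\<omega> \<in> space ?R" for \<omega> using ne that spR by force
    show "(\<lambda>\<omega>. the (X (real n) \<omega>)) -` B \<inter> space ?R \<in> sets ?R" if "B \<in> sets E" for B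
      unfolding spR pre sets_restrict_space sets_uniform_measure using ev[OF that] by blast
  qed
  have "measure (conditioned_law E I X Q n) A = measure (distr ?R E (\<lambda>\<omega>. the (X (real n) \<omega>))) A"
    by (simp add: conditioned_law_def S_def Let_def)
  also have "\<dots> = measure ?R ({\<omega> \<in> space Q. X (real n) \<omega> \<in> Some ` A} \<inter> S)"
    by (simp only: measure_distr[OF f assms(3)] spR pre)
  also have "\<dots> = measure (uniform_measure Q S) ({\<omega> \<in> space Q. X (real n) \<omega> \<in> Some ` A} \<inter> S)"
    by (rule measure_restrict_space) (use S in auto)
  also have "\<dots> = \<P>(\<omega> in Q. X (real n) \<omega> \<in> Some ` A \<bar> ereal (real n) < absorption_time I X \<omega>)"
  proof -
    have T: "{\<omega> \<in> space Q. X (real n) \<omega> \<in> Some ` A} \<inter> S \<in> sets Q" using ev[OF assms(3)] S by blast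
    have "measure (uniform_measure Q S) ({\<omega> \<in> space Q. X (real n) \<omega> \<in> Some ` A} \<inter> S)
       = measure Q (S \<inter> ({\<omega> \<in> space Q. X (real n) \<omega> \<in> Some ` A} \<inter> S)) / measure Q S"
    proof (cases "measure Q S = 0")
      case True
      then have "emeasure Q S = 0" by (simp add: Q.emeasure_eq_measure)
      then have "emeasure Q (S \<inter> ({\<omega> \<in> space Q. X (real n) \<omega> \<in> Some ` A} \<inter> S)) = 0"
        by (rule emeasure_eq_0[OF S]) blast
      then show ?thesis
        using True by (simp add: measure_def emeasure_uniform_measure[OF S T])
    next
      case False
      then show ?thesis
        by (intro measure_uniform_measure) (use T in \<open>auto simp: Q.emeasure_eq_measure\<close>)
    qed
    also have "S \<inter> ({\<omega> \<in> space Q. X (real n) \<omega> \<in> Some ` A} \<inter> S) =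
       {\<omega> \<in> space Q. X (real n) \<omega> \<in> Some ` A \<and> ereal (real n) < absorption_time I X \<omega>}"
      by (auto simp: S_def)
    finally show ?thesis by (simp add: cond_prob_def S_def)
  qed
  finally show ?thesis .
qed

end

text \<open>For finite measures on \<open>E\<close> the set under the supremum is bounded.\<close>

definition tv_dist :: "'a measure \<Rightarrow> 'a measure \<Rightarrow> 'a measure \<Rightarrow> real" where
  "tv_dist E \<mu>\<^sub>1 \<mu>\<^sub>2 =
     (SUP f\<in>{f \<in> borel_measurable E. \<forall>x\<in>space E. \<bar>f x\<bar> \<le> (1::real)}.
        \<bar>(\<integral>x. f x \<partial>\<mu>\<^sub>1) - (\<integral>x. f x \<partial>\<mu>\<^sub>2)\<bar>)"

text \<open>
  The sub-Markov semigroup acting on nonnegative functions. The value may be infinite, hence the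
  nonnegative integral (a Bochner integral would be 0 when \<open>f\<close> is not integrable).
\<close>

definition semigroup_op ::
  "real set \<Rightarrow> (real \<Rightarrow> 'w \<Rightarrow> 'a option) \<Rightarrow> ('a option \<Rightarrow> 'w measure) \<Rightarrow> nat \<Rightarrow> ('a \<Rightarrow> real) \<Rightarrow> 'a \<Rightarrow> ennreal"
where
  "semigroup_op I X P n f x =
     (\<integral>\<^sup>+\<omega>. ennreal (f (the (X (real n) \<omega>)))
         * indicator {\<omega>. ereal (real n) < absorption_time I X \<omega>} \<omega> \<partial>P (Some x))"

text \<open>
  In the third part the quotient is taken in the extended nonnegative reals, so that it is infinite
  when the infimum vanishes.
\<close>

definition condition_E ::
  "'a measure \<Rightarrow> real set \<Rightarrow> (real \<Rightarrow> 'w \<Rightarrow> 'a option) \<Rightarrow> ('a option \<Rightarrow> 'w measure) \<Rightarrow>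
   nat \<Rightarrow> real \<Rightarrow> real \<Rightarrow> real \<Rightarrow> real \<Rightarrow> real \<Rightarrow> ('a \<Rightarrow> real) \<Rightarrow> ('a \<Rightarrow> real) \<Rightarrow> 'a set \<Rightarrow> 'a measure \<Rightarrow> bool"
where
  "condition_E E I X P n\<^sub>1 \<theta>\<^sub>1 \<theta>\<^sub>2 c\<^sub>1 c\<^sub>2 c\<^sub>3 \<phi>\<^sub>1 \<phi>\<^sub>2 K \<nu> \<longleftrightarrow>
     n\<^sub>1 > 0 \<and> \<theta>\<^sub>1 > 0 \<and> \<theta>\<^sub>2 > 0 \<and> c\<^sub>1 > 0 \<and> c\<^sub>2 > 0 \<and> c\<^sub>3 > 0 \<and>
     \<phi>\<^sub>1 \<in> borel_measurable E \<and> (\<forall>x\<in>space E. 0 \<le> \<phi>\<^sub>1 x) \<and>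
     \<phi>\<^sub>2 \<in> borel_measurable E \<and> (\<forall>x\<in>space E. 0 \<le> \<phi>\<^sub>2 x) \<and>
     K \<in> sets E \<and> \<nu> \<in> space (prob_algebra (restrict_space E K)) \<and>
     \<comment> \<open>E1\<close>
     (\<forall>x\<in>K. \<forall>A\<in>sets E.
        \<P>(\<omega> in P (Some x). X (real n\<^sub>1) \<omega> \<in> Some ` A) \<ge> c\<^sub>1 * measure \<nu> (A \<inter> K)) \<and>
     \<comment> \<open>E2\<close>
     \<theta>\<^sub>1 < \<theta>\<^sub>2 \<and>
     (\<forall>x\<in>space E. 1 \<le> \<phi>\<^sub>1 x) \<and> bdd_above (\<phi>\<^sub>1 ` K) \<and>
     (INF x\<in>K. \<phi>\<^sub>2 x) > 0 \<and> (\<forall>x\<in>space E. \<phi>\<^sub>2 x \<le> 1) \<and>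
     (\<forall>x\<in>space E. semigroup_op I X P 1 \<phi>\<^sub>1 x \<le> ennreal (\<theta>\<^sub>1 * \<phi>\<^sub>1 x + c\<^sub>2 * indicator K x)) \<and>
     (\<forall>x\<in>space E. semigroup_op I X P 1 \<phi>\<^sub>2 x \<ge> ennreal (\<theta>\<^sub>2 * \<phi>\<^sub>2 x)) \<and>
     \<comment> \<open>E3\<close>
     (SUP n::nat.
        (SUP y\<in>K. ennreal \<P>(\<omega> in P (Some y). ereal (real n) < absorption_time I X \<omega>)) /
        (INF y\<in>K. ennreal \<P>(\<omega> in P (Some y). ereal (real n) < absorption_time I X \<omega>)))
       \<le> ennreal c\<^sub>3 \<and>
     \<comment> \<open>E4\<close>
     (\<forall>x\<in>K. \<exists>n\<^sub>4::nat. \<forall>n\<ge>n\<^sub>4. \<P>(\<omega> in P (Some x). X (real n) \<omega> \<in> Some ` K) > 0)"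

end

theory Submission
  imports Defs
begin

text \<open>
  Write \<open>Q\<^sub>n(x, \<cdot>)\<close> for the law of \<open>X\<^sub>n\<close> on \<open>E\<close> under \<open>\<P>\<^sub>x\<close> and \<open>S\<^sub>n(x) = Q\<^sub>n(x, E)\<close> for the survival
  probability, so that the conditioned law from \<open>x\<close> at time \<open>n\<close> is \<open>Q\<^sub>n(x, \<cdot>) / S\<^sub>n(x)\<close>. All of the
  proof happens at the level of this semigroup of substochastic kernels (locale \<open>killed_semigroup\<close>);
  the Markov property and absorption serve only to show that \<open>Q\<close> is one.

  From the drift conditions to convergence. Uniform return to \<open>K\<close> followed by the minorization on \<open>K\<close>
  makes the conditioned law at some time \<open>l\<close> charge a fixed \<open>\<nu>\<close>, uniformly in the starting point.
  The function \<open>\<phi>\<^sub>1\<close> decreases off \<open>K\<close> at a rate below the one that \<open>\<phi>\<^sub>2\<close> guarantees for survival from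
  \<open>K\<close>; since \<open>\<phi>\<^sub>1\<close> is bounded, no point of \<open>E\<close> survives much better than those of \<open>K\<close>
  (\<open>survival_comparison\<close>). Minorization and comparison together are a Doeblin condition for the Markov
  chain conditioned to survive up to a terminal time, so the ratios \<open>Q\<^sub>n(x, A) / S\<^sub>n(x)\<close> oscillate in
  \<open>x\<close> by a geometrically small amount (\<open>oscillation_contraction\<close>). The conditioned laws are then
  uniformly Cauchy, and their limit is the quasi-stationary distribution.

  From convergence to the drift conditions. Let \<open>\<nu>\<close> be the limit. It is quasi-stationary, with
  \<open>\<nu>(S\<^sub>n) = \<theta>\<^sup>n\<close>, and \<open>S\<^sub>n \<le> B \<theta>\<^sup>n\<close> everywhere. The relative error
  of the approximation of \<open>S\<^bsub>n+m\<^esub>\<close> by \<open>S\<^sub>n \<theta>\<^sup>m\<close> is therefore uniformly small for large \<open>n\<close>. Take \<open>K\<close> to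
  be the set where \<open>S\<^sub>N\<close> is at least \<open>(\<theta>/2)\<^sup>N\<close> for a large \<open>N\<close>. Then survival from \<open>K\<close> is of order exactly
  \<open>\<theta>\<^sup>n\<close>, which gives the comparison within \<open>K\<close>, and sums of the form \<open>\<Sum>\<^sub>k r\<^sup>-\<^sup>k Q\<^sub>k(\<cdot>, A)\<close> with \<open>A = E\<close>
  and \<open>A = K\<close> are the two Lyapunov functions (\<open>discounted_occupation_step\<close>). The delicate part is the
  minorization by a single measure, on a measurable space without any countability: the minorant is the
  infimum of the measures \<open>Q\<^bsub>2n\<^esub>(x, \<cdot>)\<close> over \<open>x \<in> K\<close> in the lattice of measures (\<open>infimum_measure\<close>), and
  its mass is bounded below by a computation on finite partitions (\<open>partition_mass_lower_bound\<close>).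
\<close>

section \<open>Finite measures: limits, infima and integrals of bounded functions\<close>

lemma integrable_bounded:
  fixes f :: "'a \<Rightarrow> real"
  assumes "finite_measure m" "sets m = sets E" "f \<in> borel_measurable E"
    and "\<And>x. x \<in> space E \<Longrightarrow> \<bar>f x\<bar> \<le> b"
  shows "integrable m f"
proof -
  interpret finite_measure m by fact
  have "space m = space E" by (rule sets_eq_imp_space_eq) fact
  moreover have "f \<in> borel_measurable m"
    using assms(3) measurable_cong_sets[OF assms(2) refl] by blast
  ultimately show ?thesis
    using assms(4) by (intro integrable_const_bound[where B = b]) (auto simp: real_norm_def)
qed

text \<open>
  The two measures constructed below, a limit and an infimum of a family, are obtained as finitely
  additive set functions that inherit continuity at the empty set from the members of the family.
\<close>

lemma charge_continuous_at_empty_is_measure: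
  fixes L :: "'a set \<Rightarrow> real"
  assumes nonneg: "\<And>A. A \<in> sets E \<Longrightarrow> 0 \<le> L A"
    and additive: "\<And>A B. A \<in> sets E \<Longrightarrow> B \<in> sets E \<Longrightarrow> A \<inter> B = {} \<Longrightarrow> L (A \<union> B) = L A + L B"
    and continuous: "\<And>A :: nat \<Rightarrow> 'a set. range A \<subseteq> sets E \<Longrightarrow> decseq A \<Longrightarrow> (\<Inter>i. A i) = {} \<Longrightarrow>
      (\<lambda>i. L (A i)) \<longlonglongrightarrow> 0"
  shows "\<exists>N. sets N = sets E \<and> finite_measure N \<and> (\<forall>A\<in>sets E. measure N A = L A)"
proof -
  define \<mu> where "\<mu> = (\<lambda>A. ennreal (L A))"
  have "L {} = 0" using additive[of "{}" "{}"] by simp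
  then have pos: "positive (sets E) \<mu>" by (simp add: positive_def \<mu>_def)
  have add: "additive (sets E) \<mu>"
    by (auto simp: additive_def \<mu>_def additive nonneg)
  have cont: "(\<lambda>i. \<mu> (A i)) \<longlonglongrightarrow> 0"
    if "range A \<subseteq> sets E" "decseq A" "(\<Inter>i. A i) = {}" for A :: "nat \<Rightarrow> 'a set"
    using tendsto_ennrealI[OF continuous[OF that]] by (simp add: \<mu>_def)
  have ca: "countably_additive (sets E) \<mu>"
    by (rule sets.empty_continuous_imp_countably_additive[OF pos add _ cont]) (auto simp: \<mu>_def)
  define N where "N = measure_of (space E) (sets E) \<mu>"
  have em: "emeasure N A = \<mu> A" if "A \<in> sets E" for A
    unfolding N_def by (rule emeasure_measure_of_sigma[OF sets.sigma_algebra_axioms pos ca that])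
  have sN: "sets N = sets E" "space N = space E" by (simp_all add: N_def)
  have "finite_measure N"
    by (rule finite_measureI) (simp add: sN em \<mu>_def)
  moreover have "measure N A = L A" if "A \<in> sets E" for A
    using em[OF that] nonneg[OF that] by (simp add: measure_def \<mu>_def)
  ultimately show ?thesis using sN by blast
qed

lemma finite_measure_decseq_empty:
  assumes "finite_measure m" "range A \<subseteq> sets m" "decseq A" "(\<Inter>i. A i) = {}"
  shows "(\<lambda>i. measure m (A i)) \<longlonglongrightarrow> 0"
  using finite_measure.finite_Lim_measure_decseq[OF assms(1-3)] assms(4) by simp

text \<open>
  Uniformity over the sets is what carries continuity at the empty set over to the limit: a single
  member of the sequence controls the limit on a whole decreasing sequence of sets.
\<close>

lemma uniform_setwise_limit_is_prob:
  fixes u :: "nat \<Rightarrow> 'a measure" and d :: "nat \<Rightarrow> real"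
  assumes u: "\<And>n. u n \<in> space (prob_algebra E)"
    and cauchy: "\<And>n k A. A \<in> sets E \<Longrightarrow> \<bar>measure (u n) A - measure (u (n + k)) A\<bar> \<le> d n"
    and d: "d \<longlonglongrightarrow> 0"
  shows "\<exists>\<nu>\<in>space (prob_algebra E). \<forall>A\<in>sets E. \<forall>n. \<bar>measure (u n) A - measure \<nu> A\<bar> \<le> d n"
proof -
  have setsu: "sets (u n) = sets E" and pu: "prob_space (u n)" for n
    using u[of n] by (auto simp: space_prob_algebra)
  define L where "L = (\<lambda>A. lim (\<lambda>n. measure (u n) A))"
  have conv: "(\<lambda>n. measure (u n) A) \<longlonglongrightarrow> L A" if A: "A \<in> sets E" for A
  proof -
    have "Cauchy (\<lambda>n. measure (u n) A)"
    proof (rule CauchyI')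
      fix e :: real assume "0 < e"
      then obtain N where N: "\<And>n. n \<ge> N \<Longrightarrow> \<bar>d n\<bar> < e"
        using LIMSEQ_D[OF d, of e] by auto
      show "\<exists>M. \<forall>m\<ge>M. \<forall>n>m. dist (measure (u m) A) (measure (u n) A) < e"
      proof (intro exI allI impI)
        fix m n assume "N \<le> m" "m < n"
        then have "\<bar>d m\<bar> < e" by (intro N)
        moreover have "\<bar>measure (u m) A - measure (u (m + (n - m))) A\<bar> \<le> d m" by (rule cauchy[OF A])
        ultimately show "dist (measure (u m) A) (measure (u n) A) < e"
          using \<open>m < n\<close> by (simp add: dist_real_def)
      qed
    qed
    then show ?thesis unfolding L_def by (intro convergent_LIMSEQ_iff[THEN iffD1] Cauchy_convergent)
  qed
  have close: "\<bar>measure (u n) A - L A\<bar> \<le> d n" if A: "A \<in> sets E" for n A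
  proof (rule LIMSEQ_le_const2)
    show "(\<lambda>k. \<bar>measure (u n) A - measure (u (k + n)) A\<bar>) \<longlonglongrightarrow> \<bar>measure (u n) A - L A\<bar>"
      by (intro tendsto_intros LIMSEQ_ignore_initial_segment conv[OF A])
    show "\<exists>N. \<forall>k\<ge>N. \<bar>measure (u n) A - measure (u (k + n)) A\<bar> \<le> d n"
      using cauchy[OF A, of n] by (auto simp: add.commute)
  qed
  have "\<exists>N. sets N = sets E \<and> finite_measure N \<and> (\<forall>A\<in>sets E. measure N A = L A)"
  proof (rule charge_continuous_at_empty_is_measure)
    show nonneg: "0 \<le> L A" if "A \<in> sets E" for A
      by (rule LIMSEQ_le_const[OF conv[OF that]]) simp
    show "L (A \<union> B) = L A + L B" if "A \<in> sets E" "B \<in> sets E" "A \<inter> B = {}" for A B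
    proof (rule LIMSEQ_unique)
      show "(\<lambda>n. measure (u n) (A \<union> B)) \<longlonglongrightarrow> L (A \<union> B)" using that by (intro conv) auto
      have "measure (u n) (A \<union> B) = measure (u n) A + measure (u n) B" for n
        using that by (intro finite_measure.finite_measure_Union prob_space.finite_measure pu)
          (auto simp: setsu)
      then show "(\<lambda>n. measure (u n) (A \<union> B)) \<longlonglongrightarrow> L A + L B"
        using tendsto_add[OF conv[OF that(1)] conv[OF that(2)]] by simp
    qed
    fix A :: "nat \<Rightarrow> 'a set"
    assume A: "range A \<subseteq> sets E" "decseq A" "(\<Inter>i. A i) = {}"
    show "(\<lambda>i. L (A i)) \<longlonglongrightarrow> 0"
    proof (rule LIMSEQ_I)
      fix e :: real assume "0 < e"
      then obtain n where n: "\<bar>d n\<bar> < e / 2" using LIMSEQ_D[OF d, of "e / 2"] by auto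
      have lim: "(\<lambda>i. measure (u n) (A i)) \<longlonglongrightarrow> 0"
        using A by (intro finite_measure_decseq_empty prob_space.finite_measure pu)
          (auto simp: setsu)
      obtain N where N: "\<And>i. i \<ge> N \<Longrightarrow> \<bar>measure (u n) (A i)\<bar> < e / 2"
        using LIMSEQ_D[OF lim, of "e / 2"] \<open>0 < e\<close> by (auto simp: real_norm_def)
      show "\<exists>no. \<forall>i\<ge>no. norm (L (A i) - 0) < e"
      proof (intro exI allI impI)
        fix i assume "N \<le> i"
        moreover have "A i \<in> sets E" using A(1) by auto
        ultimately show "norm (L (A i) - 0) < e"
          using N[of i] n close[of "A i" n] nonneg[of "A i"] by (simp add: real_norm_def)
      qed
    qed
  qed
  then obtain \<nu> where \<nu>: "sets \<nu> = sets E" "finite_measure \<nu>" "\<And>A. A \<in> sets E \<Longrightarrow> measure \<nu> A = L A"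
    by blast
  have sp: "space \<nu> = space E" by (rule sets_eq_imp_space_eq) fact
  have "measure (u n) (space E) = 1" for n
    using prob_space.prob_space[OF pu[of n]] sets_eq_imp_space_eq[OF setsu[of n]] by simp
  then have "L (space E) = 1" using conv[of "space E"] by (simp add: LIMSEQ_const_iff)
  then have "emeasure \<nu> (space \<nu>) = 1"
    using \<nu>(2) \<nu>(3)[of "space E"] by (simp add: sp finite_measure.emeasure_eq_measure)
  then have "\<nu> \<in> space (prob_algebra E)"
    by (auto simp: space_prob_algebra \<nu>(1) intro: prob_spaceI)
  then show ?thesis using close \<nu>(3) by (intro bexI[of _ \<nu>]) auto
qed

text \<open>
  A measurable map \<open>j\<close> with finitely many values selects which member of the family \<open>m\<close> to use at
  each point; \<open>glued_mass E m j\<close> is the resulting measure.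
\<close>

definition glued_mass :: "'b measure \<Rightarrow> ('i \<Rightarrow> 'b measure) \<Rightarrow> ('b \<Rightarrow> 'i) \<Rightarrow> 'b set \<Rightarrow> real" where
  "glued_mass E m j A = (\<Sum>i\<in>j ` space E. measure (m i) (A \<inter> j -` {i} \<inter> space E))"

lemma glued_mass_superset:
  assumes "finite J" "j ` space E \<subseteq> J"
  shows "glued_mass E m j A = (\<Sum>i\<in>J. measure (m i) (A \<inter> j -` {i} \<inter> space E))"
  unfolding glued_mass_def
proof (rule sum.mono_neutral_left[OF assms], rule ballI)
  fix i assume "i \<in> J - j ` space E"
  then have "A \<inter> j -` {i} \<inter> space E = {}" by auto
  then show "measure (m i) (A \<inter> j -` {i} \<inter> space E) = 0" by simp
qed

text \<open>
  The infimum of the family in the lattice of measures: a measure lies below all members if and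
  only if it lies below every measure glued from finitely many of them along a measurable
  partition, and the infimum of the glued masses is additive because gluing on disjoint sets can be
  done independently. The gain over a direct construction of a common minorant is that its total
  mass is bounded below as soon as all finite gluings are.
\<close>

lemma infimum_measure:
  fixes m :: "'i \<Rightarrow> 'b measure" and c :: real
  assumes T: "T \<noteq> {}"
    and m: "\<And>i. i \<in> T \<Longrightarrow> finite_measure (m i)" "\<And>i. i \<in> T \<Longrightarrow> sets (m i) = sets E"
    and glued: "\<And>j. simple_function E j \<Longrightarrow> j ` space E \<subseteq> T \<Longrightarrow> c \<le> glued_mass E m j (space E)"
  shows "\<exists>\<kappa>. sets \<kappa> = sets E \<and> finite_measure \<kappa> \<and> c \<le> measure \<kappa> (space E) \<and>
    (\<forall>i\<in>T. \<forall>A\<in>sets E. measure \<kappa> A \<le> measure (m i) A)"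
proof -
  define J where "J = {j. simple_function E j \<and> j ` space E \<subseteq> T}"
  define L where "L = (\<lambda>A. INF j\<in>J. glued_mass E m j A)"
  have const: "(\<lambda>_. i) \<in> J" if "i \<in> T" for i using that by (auto simp: J_def)
  have J: "J \<noteq> {}" using T const by auto
  have gm_nonneg: "0 \<le> glued_mass E m j A" for j A
    by (simp add: glued_mass_def sum_nonneg)
  have bdd: "bdd_below ((\<lambda>j. glued_mass E m j A) ` J)" for A
    by (rule bdd_belowI[where m = 0]) (use gm_nonneg in auto)
  have L_le: "L A \<le> glued_mass E m j A" if "j \<in> J" for j A
    unfolding L_def by (rule cINF_lower[OF bdd that])
  have L_ge: "x \<le> L A" if "\<And>j. j \<in> J \<Longrightarrow> x \<le> glued_mass E m j A" for x A
    unfolding L_def by (rule cINF_greatest[OF J that])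
  have piece: "A \<inter> j -` {i} \<inter> space E \<in> sets E" if "j \<in> J" "A \<in> sets E" for i j A
    using that simple_functionD(2)[of E j "{i}"] by (auto simp: J_def Int_assoc)
  have gm_add: "glued_mass E m j (A \<union> B) = glued_mass E m j A + glued_mass E m j B"
    if j: "j \<in> J" and AB: "A \<in> sets E" "B \<in> sets E" "A \<inter> B = {}" for j A B
    unfolding glued_mass_def sum.distrib[symmetric]
  proof (rule sum.cong[OF refl])
    fix i assume "i \<in> j ` space E"
    then have i: "i \<in> T" using j by (auto simp: J_def)
    have "measure (m i) ((A \<union> B) \<inter> j -` {i} \<inter> space E)
        = measure (m i) ((A \<inter> j -` {i} \<inter> space E) \<union> (B \<inter> j -` {i} \<inter> space E))"
      by (rule arg_cong[where f = "measure (m i)"]) blast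
    also have "\<dots> = measure (m i) (A \<inter> j -` {i} \<inter> space E) + measure (m i) (B \<inter> j -` {i} \<inter> space E)"
      using AB piece[OF j] by (intro finite_measure.finite_measure_Union m(1)[OF i])
        (auto simp: m(2)[OF i])
    finally show "measure (m i) ((A \<union> B) \<inter> j -` {i} \<inter> space E) = \<dots>" .
  qed
  have gm_const: "glued_mass E m (\<lambda>_. i) A = measure (m i) A" if "A \<in> sets E" "i \<in> T" for i A
  proof (cases "space E = {}")
    case True
    then have "A = {}" using sets.sets_into_space[OF that(1)] by auto
    then show ?thesis by (simp add: glued_mass_def)
  next
    case False
    then show ?thesis using sets.sets_into_space[OF that(1)]
      by (simp add: glued_mass_def Int_absorb2 image_constant_conv)
  qed
  have "\<exists>N. sets N = sets E \<and> finite_measure N \<and> (\<forall>A\<in>sets E. measure N A = L A)"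
  proof (rule charge_continuous_at_empty_is_measure)
    show nonneg: "0 \<le> L A" for A using gm_nonneg by (intro L_ge)
    show "L (A \<union> B) = L A + L B" if AB: "A \<in> sets E" "B \<in> sets E" "A \<inter> B = {}" for A B
    proof (rule antisym)
      show "L A + L B \<le> L (A \<union> B)"
        by (rule L_ge) (simp add: gm_add[OF _ AB] add_mono L_le)
      have le: "L (A \<union> B) \<le> glued_mass E m j A + glued_mass E m j' B" if jj': "j \<in> J" "j' \<in> J" for j j'
      proof -
        define h where "h = (\<lambda>x. if x \<in> A then j x else j' x)"
        define F where "F = j ` space E \<union> j' ` space E"
        have "simple_function E h"
          unfolding h_def using jj' AB(1) by (intro simple_function_If_set) (auto simp: J_def)
        then have hJ: "h \<in> J" using jj' by (auto simp: J_def h_def)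
        have F: "finite F" using jj' by (auto simp: F_def J_def dest: simple_functionD(1))
        have "glued_mass E m h A = glued_mass E m j A"
        proof -
          have "A \<inter> h -` {i} \<inter> space E = A \<inter> j -` {i} \<inter> space E" for i by (auto simp: h_def)
          then show ?thesis
            by (subst (1 2) glued_mass_superset[OF F]) (auto simp: F_def h_def)
        qed
        moreover have "glued_mass E m h B = glued_mass E m j' B"
        proof -
          have "B \<inter> h -` {i} \<inter> space E = B \<inter> j' -` {i} \<inter> space E" for i
            using AB(3) by (auto simp: h_def)
          then show ?thesis
            by (subst (1 2) glued_mass_superset[OF F]) (auto simp: F_def h_def)
        qed
        ultimately show ?thesis using L_le[OF hJ, of "A \<union> B"] gm_add[OF hJ AB] by simp
      qed
      have "L (A \<union> B) - glued_mass E m j' B \<le> L A" if "j' \<in> J" for j'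
        using le[OF _ that] by (intro L_ge) (simp add: algebra_simps)
      then have "L (A \<union> B) - L A \<le> glued_mass E m j' B" if "j' \<in> J" for j'
        using that by (simp add: algebra_simps)
      then have "L (A \<union> B) - L A \<le> L B" by (intro L_ge)
      then show "L (A \<union> B) \<le> L A + L B" by simp
    qed
    obtain i where i: "i \<in> T" using T by auto
    fix A :: "nat \<Rightarrow> 'b set"
    assume A: "range A \<subseteq> sets E" "decseq A" "(\<Inter>i. A i) = {}"
    have lim: "(\<lambda>k. measure (m i) (A k)) \<longlonglongrightarrow> 0"
      using A by (intro finite_measure_decseq_empty m(1)[OF i]) (auto simp: m(2)[OF i])
    have "L (A k) \<le> measure (m i) (A k)" for k
      using L_le[OF const[OF i], of "A k"] A(1) by (simp add: gm_const[OF _ i] range_subsetD)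
    then show "(\<lambda>k. L (A k)) \<longlonglongrightarrow> 0"
      by (intro tendsto_sandwich[OF _ _ tendsto_const lim]) (auto simp: nonneg)
  qed
  then obtain N where N: "sets N = sets E" "finite_measure N" "\<And>A. A \<in> sets E \<Longrightarrow> measure N A = L A"
    by blast
  have "c \<le> L (space E)" using glued by (intro L_ge) (auto simp: J_def)
  moreover have "L A \<le> measure (m i) A" if "i \<in> T" "A \<in> sets E" for i A
    using L_le[OF const[OF that(1)], of A] by (simp add: gm_const that)
  ultimately show ?thesis using N by (intro exI[of _ N]) auto
qed

lemma scaled_integral_mono_measure:
  fixes f :: "'a \<Rightarrow> real"
  assumes m: "finite_measure m" "sets m = sets E" and l: "finite_measure l" "sets l = sets E"
    and c: "0 \<le> c" and le: "\<And>A. A \<in> sets E \<Longrightarrow> c * measure l A \<le> measure m A"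
    and f: "f \<in> borel_measurable E" "\<And>x. x \<in> space E \<Longrightarrow> 0 \<le> f x" "\<And>x. x \<in> space E \<Longrightarrow> f x \<le> b"
  shows "c * (\<integral>x. f x \<partial>l) \<le> (\<integral>x. f x \<partial>m)"
proof -
  have sp: "space m = space E" "space l = space E"
    by (rule sets_eq_imp_space_eq, fact)+
  have fm: "f \<in> borel_measurable m" "f \<in> borel_measurable l"
    using f(1) measurable_cong_sets[OF m(2) refl] measurable_cong_sets[OF l(2) refl] by blast+
  have int: "integrable m f" "integrable l f"
    using f by (auto intro!: integrable_bounded[OF m f(1), of b] integrable_bounded[OF l f(1), of b])
  have "scale_measure (ennreal c) l \<le> m"
  proof (rule le_measure[THEN iffD2])
    show "\<forall>A\<in>sets (scale_measure (ennreal c) l). emeasure (scale_measure (ennreal c) l) A \<le> emeasure m A"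
    proof
      fix A assume "A \<in> sets (scale_measure (ennreal c) l)"
      then have A: "A \<in> sets E" using l by simp
      show "emeasure (scale_measure (ennreal c) l) A \<le> emeasure m A"
        using le[OF A] c
        by (simp add: finite_measure.emeasure_eq_measure[OF m(1)]
          finite_measure.emeasure_eq_measure[OF l(1)] ennreal_mult[symmetric])
    qed
  qed (simp add: m l)
  then have "(\<integral>\<^sup>+x. ennreal (f x) \<partial>scale_measure (ennreal c) l) \<le> (\<integral>\<^sup>+x. ennreal (f x) \<partial>m)"
    by (intro nn_integral_mono_measure) (simp_all add: m l)
  moreover have "(\<integral>\<^sup>+x. ennreal (f x) \<partial>scale_measure (ennreal c) l) = ennreal (c * (\<integral>x. f x \<partial>l))"
  proof -
    have "(\<integral>\<^sup>+x. ennreal (f x) \<partial>scale_measure (ennreal c) l) = ennreal c * (\<integral>\<^sup>+x. ennreal (f x) \<partial>l)"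
      using fm by (intro nn_integral_scale_measure) auto
    also have "(\<integral>\<^sup>+x. ennreal (f x) \<partial>l) = ennreal (\<integral>x. f x \<partial>l)"
      using f int sp by (intro nn_integral_eq_integral) auto
    finally show ?thesis using c by (simp add: ennreal_mult')
  qed
  moreover have "(\<integral>\<^sup>+x. ennreal (f x) \<partial>m) = ennreal (\<integral>x. f x \<partial>m)"
    using f int sp by (intro nn_integral_eq_integral) auto
  moreover have "0 \<le> (\<integral>x. f x \<partial>m)" using f sp by (intro integral_nonneg_AE) auto
  ultimately show ?thesis by simp
qed

text \<open>
  A discrete layer-cake decomposition: up to \<open>1/k\<close>, a function with values in \<open>[0,1]\<close> is the
  average of the indicators of its superlevel sets at heights \<open>1/k, \<dots>, k/k\<close>.
\<close>

lemma integral_unit_interval_diff_le_setwise: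
  fixes f :: "'a \<Rightarrow> real"
  assumes m: "prob_space m" "sets m = sets E" and l: "prob_space l" "sets l = sets E"
    and le: "\<And>A. A \<in> sets E \<Longrightarrow> measure m A - measure l A \<le> d"
    and f: "f \<in> borel_measurable E" "\<And>x. x \<in> space E \<Longrightarrow> 0 \<le> f x" "\<And>x. x \<in> space E \<Longrightarrow> f x \<le> 1"
  shows "(\<integral>x. f x \<partial>m) - (\<integral>x. f x \<partial>l) \<le> d"
proof -
  have sp: "space m = space E" "space l = space E"
    by (rule sets_eq_imp_space_eq, fact)+
  have fin: "finite_measure m" "finite_measure l" using m l by (auto intro: prob_space.finite_measure)
  have int: "integrable m f" "integrable l f"
    using f by (auto intro!: integrable_bounded[OF fin(1) m(2) f(1), of 1]
      integrable_bounded[OF fin(2) l(2) f(1), of 1])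
  have step: "(\<integral>x. f x \<partial>m) - (\<integral>x. f x \<partial>l) \<le> d + 1 / k" if k: "k > 0" for k :: nat
  proof -
    define H where "H = (\<lambda>i::nat. {x \<in> space E. real i / k \<le> f x})"
    define g where "g = (\<lambda>x. (\<Sum>i=1..k. indicator (H i) x) / k :: real)"
    have H: "H i \<in> sets E" for i unfolding H_def using f(1) by measurable
    have g_eq: "g x = real (nat \<lfloor>k * f x\<rfloor>) / k" if x: "x \<in> space E" for x
    proof -
      have fx: "0 \<le> k * f x" "k * f x \<le> k" using f(2,3)[OF x] k by (auto simp: mult_left_le)
      have "(\<Sum>i=1..k. indicator (H i) x :: real) = (\<Sum>i\<in>{1..k} \<inter> {i. x \<in> H i}. 1)"
        by (simp add: indicator_def sum.If_cases)
      also have "{1..k} \<inter> {i. x \<in> H i} = {1..nat \<lfloor>k * f x\<rfloor>}"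
      proof -
        define q where "q = nat \<lfloor>k * f x\<rfloor>"
        have "real i \<le> k * f x \<longleftrightarrow> i \<le> q" for i
          unfolding q_def using fx by linarith
        then have H_iff: "x \<in> H i \<longleftrightarrow> i \<le> q" for i
          using x k by (simp add: H_def divide_le_eq mult.commute)
        have "q \<le> k" unfolding q_def using fx by linarith
        then have "{1..k} \<inter> {i. x \<in> H i} = {1..q}" unfolding H_iff by auto
        then show ?thesis by (simp only: q_def)
      qed
      finally show ?thesis by (simp add: g_def)
    qed
    have gf: "g x \<le> f x" "f x \<le> g x + 1 / k" if x: "x \<in> space E" for x
    proof -
      have "0 \<le> k * f x" using f(2)[OF x] by simp
      then have "real (nat \<lfloor>k * f x\<rfloor>) \<le> k * f x" "k * f x \<le> real (nat \<lfloor>k * f x\<rfloor>) + 1"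
        by linarith+
      then show "g x \<le> f x" "f x \<le> g x + 1 / k"
        using k by (auto simp: g_eq[OF x] field_simps)
    qed
    have gint: "(\<integral>x. g x \<partial>N) = (\<Sum>i=1..k. measure N (H i)) / k" "integrable N g"
      if N: "finite_measure N" "sets N = sets E" for N
    proof -
      have i: "integrable N (indicator (H i) :: _ \<Rightarrow> real)" for i
        using N H by (intro integrable_bounded[OF N, of _ 1]) auto
      show "integrable N g" unfolding g_def using i by simp
      have "H i \<inter> space N = H i" for i
        using sets.sets_into_space[OF H[of i]] sets_eq_imp_space_eq[OF N(2)] by auto
      then show "(\<integral>x. g x \<partial>N) = (\<Sum>i=1..k. measure N (H i)) / k"
        unfolding g_def using i by (simp add: Bochner_Integration.integral_sum)
    qed
    have "(\<integral>x. f x \<partial>m) \<le> (\<integral>x. g x + 1 / k \<partial>m)"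
      using gint[OF fin(1) m(2)] gf int sp finite_measure.integrable_const[OF fin(1)]
      by (intro integral_mono Bochner_Integration.integrable_add) auto
    also have "\<dots> = (\<integral>x. g x \<partial>m) + 1 / k"
      using gint[OF fin(1) m(2)] finite_measure.integrable_const[OF fin(1)] prob_space.prob_space[OF m(1)]
      by (subst Bochner_Integration.integral_add) auto
    also have "(\<integral>x. g x \<partial>m) \<le> (\<integral>x. g x \<partial>l) + d"
    proof -
      have "(\<Sum>i=1..k. measure m (H i)) \<le> (\<Sum>i=1..k. measure l (H i) + d)"
        using le[OF H] by (intro sum_mono) (simp add: algebra_simps)
      then show ?thesis
        using k by (simp add: gint fin m l sum.distrib field_simps)
    qed
    also have "(\<integral>x. g x \<partial>l) \<le> (\<integral>x. f x \<partial>l)"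
      using gint[OF fin(2) l(2)] gf int sp by (intro integral_mono) auto
    finally show ?thesis by simp
  qed
  have "(\<lambda>n. d + 1 / real (Suc n)) \<longlonglongrightarrow> d + 0"
    by (intro tendsto_intros LIMSEQ_Suc lim_1_over_n)
  then have "(\<integral>x. f x \<partial>m) - (\<integral>x. f x \<partial>l) \<le> d + 0"
    by (rule LIMSEQ_le_const) (use step in \<open>auto simp del: of_nat_Suc\<close>)
  then show ?thesis by simp
qed

lemma tv_dist_le_of_setwise:
  assumes m: "m \<in> space (prob_algebra E)" and l: "l \<in> space (prob_algebra E)"
    and le: "\<And>A. A \<in> sets E \<Longrightarrow> \<bar>measure m A - measure l A\<bar> \<le> d"
  shows "tv_dist E m l \<le> 2 * d"
  unfolding tv_dist_def
proof (rule cSUP_least)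
  have "(\<lambda>_. 0 :: real) \<in> {f \<in> borel_measurable E. \<forall>x\<in>space E. \<bar>f x\<bar> \<le> (1::real)}" by simp
  then show "{f \<in> borel_measurable E. \<forall>x\<in>space E. \<bar>f x\<bar> \<le> (1::real)} \<noteq> {}" by blast
  have mm: "prob_space m" "sets m = sets E" and ll: "prob_space l" "sets l = sets E"
    using m l by (auto simp: space_prob_algebra)
  fix f :: "'a \<Rightarrow> real" assume "f \<in> {f \<in> borel_measurable E. \<forall>x\<in>space E. \<bar>f x\<bar> \<le> 1}"
  then have f: "f \<in> borel_measurable E" "\<And>x. x \<in> space E \<Longrightarrow> \<bar>f x\<bar> \<le> 1" by auto
  define g where "g = (\<lambda>x. (f x + 1) / 2)"
  have g: "g \<in> borel_measurable E" "\<And>x. x \<in> space E \<Longrightarrow> 0 \<le> g x" "\<And>x. x \<in> space E \<Longrightarrow> g x \<le> 1"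
    using f(1) f(2)[unfolded abs_le_iff] by (auto simp: g_def) (fastforce simp: field_simps)+
  have *: "(\<integral>x. g x \<partial>N) = ((\<integral>x. f x \<partial>N) + 1) / 2" if N: "prob_space N" "sets N = sets E" for N
  proof -
    interpret prob_space N by fact
    have "integrable N f"
      by (rule integrable_bounded[OF finite_measure_axioms N(2) f])
    then show ?thesis by (simp add: g_def prob_space)
  qed
  have "measure m A - measure l A \<le> d" "measure l A - measure m A \<le> d" if "A \<in> sets E" for A
    using le[OF that] by auto
  then have "(\<integral>x. g x \<partial>m) - (\<integral>x. g x \<partial>l) \<le> d" "(\<integral>x. g x \<partial>l) - (\<integral>x. g x \<partial>m) \<le> d"
    by (intro integral_unit_interval_diff_le_setwise[OF _ _ _ _ _ g] mm ll; simp)+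
  then show "\<bar>(\<integral>x. f x \<partial>m) - (\<integral>x. f x \<partial>l)\<bar> \<le> 2 * d"
    by (simp add: *[OF mm] *[OF ll] field_simps abs_le_iff)
qed

lemma integral_diff_le_tv_dist:
  assumes m: "m \<in> space (prob_algebra E)" and l: "l \<in> space (prob_algebra E)"
    and f: "f \<in> borel_measurable E" "\<And>x. x \<in> space E \<Longrightarrow> \<bar>f x\<bar> \<le> b"
    and b: "0 \<le> b"
  shows "\<bar>(\<integral>x. f x \<partial>m) - (\<integral>x. f x \<partial>l)\<bar> \<le> b * tv_dist E m l"
proof -
  have mm: "prob_space m" "sets m = sets E" and ll: "prob_space l" "sets l = sets E"
    using m l by (auto simp: space_prob_algebra)
  have sp: "space m = space E" "space l = space E"
    by (rule sets_eq_imp_space_eq, fact)+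
  show ?thesis
  proof (cases "b = 0")
    case True
    then have "(\<integral>x. f x \<partial>m) = (\<integral>x. 0 \<partial>m)" "(\<integral>x. f x \<partial>l) = (\<integral>x. 0 \<partial>l)"
      using f(2) sp by (intro Bochner_Integration.integral_cong; force)+
    then show ?thesis using True by simp
  next
    case False
    then have b0: "b > 0" using b by simp
    let ?D = "{f \<in> borel_measurable E. \<forall>x\<in>space E. \<bar>f x\<bar> \<le> (1::real)}"
    have bound: "\<bar>\<integral>x. g x \<partial>N\<bar> \<le> 1" if "g \<in> ?D" and N: "prob_space N" "sets N = sets E" for g N
    proof -
      interpret prob_space N by fact
      have i: "integrable N g"
        using that by (intro integrable_bounded[OF finite_measure_axioms N(2)]) auto
      have "space N = space E" by (rule sets_eq_imp_space_eq) fact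
      then have "(\<integral>x. \<bar>g x\<bar> \<partial>N) \<le> (\<integral>x. 1 \<partial>N)"
        using that i by (intro integral_mono) auto
      then show ?thesis by (intro order_trans[OF integral_abs_bound]) (simp add: prob_space)
    qed
    have "bdd_above ((\<lambda>f. \<bar>(\<integral>x. f x \<partial>m) - (\<integral>x. f x \<partial>l)\<bar>) ` ?D)"
    proof (rule bdd_aboveI2)
      show "\<bar>(\<integral>x. g x \<partial>m) - (\<integral>x. g x \<partial>l)\<bar> \<le> 2" if "g \<in> ?D" for g
        using bound[OF that mm] bound[OF that ll] by linarith
    qed
    moreover have "(\<lambda>x. f x / b) \<in> ?D"
      using f b0 by auto
    ultimately have "\<bar>(\<integral>x. f x / b \<partial>m) - (\<integral>x. f x / b \<partial>l)\<bar> \<le> tv_dist E m l"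
      unfolding tv_dist_def by (rule cSUP_upper[rotated])
    then show ?thesis using b0
      by (simp add: diff_divide_distrib[symmetric] abs_divide divide_le_eq mult.commute)
  qed
qed

section \<open>Killed semigroups and conditioned laws\<close>

text \<open>
  Both sides of the equivalence depend on the process only through the laws of \<open>X\<^sub>n\<close> restricted to
  \<open>E\<close> at integer times \<open>n\<close>. These form a semigroup of substochastic kernels, and the missing mass is
  the probability of having been absorbed.
\<close>

locale killed_semigroup =
  fixes E :: "'a measure" and Q :: "nat \<Rightarrow> 'a \<Rightarrow> 'a measure"
  assumes kernel: "Q n \<in> E \<rightarrow>\<^sub>M subprob_algebra E"
    and initial: "x \<in> space E \<Longrightarrow> A \<in> sets E \<Longrightarrow> measure (Q 0 x) A = indicator A x"
    and chapman_kolmogorov: "x \<in> space E \<Longrightarrow> A \<in> sets E \<Longrightarrow>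
      measure (Q (m + n) x) A = (\<integral>y. measure (Q n y) A \<partial>Q m x)"
    and survival_pos: "x \<in> space E \<Longrightarrow> 0 < measure (Q n x) (space E)"
begin

abbreviation survival :: "nat \<Rightarrow> 'a \<Rightarrow> real" where
  "survival n x \<equiv> measure (Q n x) (space E)"

text \<open>
  Conditioning on survival is normalisation of the substochastic law \<open>\<mu> Q\<^sub>n\<close>, which is what
  \<^const>\<open>uniform_measure\<close> on the whole space does.
\<close>

definition conditional :: "'a measure \<Rightarrow> nat \<Rightarrow> 'a measure" where
  "conditional \<mu> n = uniform_measure (\<mu> \<bind> Q n) (space E)"

lemma subprob_Q: "x \<in> space E \<Longrightarrow> subprob_space (Q n x)"
  and sets_Q: "x \<in> space E \<Longrightarrow> sets (Q n x) = sets E"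
  using measurable_space[OF kernel, of x n] by (auto simp: space_subprob_algebra)

lemma space_Q: "x \<in> space E \<Longrightarrow> space (Q n x) = space E"
  using sets_eq_imp_space_eq[OF sets_Q] .

lemma finite_Q: "x \<in> space E \<Longrightarrow> finite_measure (Q n x)"
  using subprob_Q subprob_space_def by blast

lemma measurable_Q [measurable]:
  "A \<in> sets E \<Longrightarrow> (\<lambda>x. measure (Q n x) A) \<in> borel_measurable E"
  unfolding measure_def
  by (intro borel_measurable_enn2real measurable_compose[OF kernel measurable_emeasure_subprob_algebra])

lemma Q_le_survival: "x \<in> space E \<Longrightarrow> measure (Q n x) A \<le> survival n x"
  using finite_measure.bounded_measure[OF finite_Q] by (simp add: space_Q)

lemma survival_le_1: "x \<in> space E \<Longrightarrow> survival n x \<le> 1"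
  using subprob_space.subprob_measure_le_1[OF subprob_Q] .

lemma Q_le_1: "x \<in> space E \<Longrightarrow> measure (Q n x) A \<le> 1"
  using Q_le_survival survival_le_1 order_trans by blast

lemma abs_Q_le_1: "x \<in> space E \<Longrightarrow> \<bar>measure (Q n x) A\<bar> \<le> 1"
  using Q_le_1 by simp

lemma survival_0: "x \<in> space E \<Longrightarrow> survival 0 x = 1"
  using initial[of x "space E"] by simp

lemma integrable_Q:
  fixes f :: "'a \<Rightarrow> real"
  assumes "x \<in> space E" "f \<in> borel_measurable E" "\<And>y. y \<in> space E \<Longrightarrow> \<bar>f y\<bar> \<le> b"
  shows "integrable (Q n x) f"
  using integrable_bounded[OF finite_Q[OF assms(1)] sets_Q[OF assms(1)] assms(2,3)] by blast

lemma integrable_measure_Q: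
  assumes "x \<in> space E" "A \<in> sets E"
  shows "integrable (Q n x) (\<lambda>y. measure (Q m y) A)"
  using assms by (intro integrable_Q[OF _ _ abs_Q_le_1]) auto

lemma survival_add: "x \<in> space E \<Longrightarrow> survival (m + n) x = (\<integral>y. survival n y \<partial>Q m x)"
  by (simp add: chapman_kolmogorov)

lemma survival_add_le:
  assumes x: "x \<in> space E"
  shows "survival (m + n) x \<le> survival m x"
proof -
  have "(\<integral>y. survival n y \<partial>Q m x) \<le> (\<integral>y. 1 \<partial>Q m x)"
    using x survival_le_1 finite_measure.integrable_const[OF finite_Q]
    by (intro integral_mono integrable_measure_Q) (auto simp: space_Q)
  then show ?thesis by (simp add: survival_add x space_Q)
qed

lemma survival_antimono: "x \<in> space E \<Longrightarrow> m \<le> n \<Longrightarrow> survival n x \<le> survival m x"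
  using survival_add_le[of x m "n - m"] by simp

text \<open>Initial laws enter only through the numbers \<open>\<integral> Q\<^sub>n(x, A) \<mu>(dx)\<close>.\<close>

lemma
  assumes \<mu>: "\<mu> \<in> space (prob_algebra E)"
  shows integrable_initial: "A \<in> sets E \<Longrightarrow> integrable \<mu> (\<lambda>x. measure (Q n x) A)"
    and survival_initial_pos: "0 < (\<integral>x. survival n x \<partial>\<mu>)"
    and conditional_in_prob_algebra: "conditional \<mu> n \<in> space (prob_algebra E)"
    and measure_conditional: "A \<in> sets E \<Longrightarrow>
      measure (conditional \<mu> n) A = (\<integral>x. measure (Q n x) A \<partial>\<mu>) / (\<integral>x. survival n x \<partial>\<mu>)"
proof -
  have p: "prob_space \<mu>" and s: "sets \<mu> = sets E" using \<mu> by (auto simp: space_prob_algebra)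
  interpret prob_space \<mu> by fact
  have sp: "space \<mu> = space E" by (rule sets_eq_imp_space_eq) fact
  have kern: "Q n \<in> \<mu> \<rightarrow>\<^sub>M subprob_algebra E"
    using kernel measurable_cong_sets[OF s refl] by blast
  show int: "integrable \<mu> (\<lambda>x. measure (Q n x) A)" if "A \<in> sets E" for A
    using that by (intro integrable_bounded[OF finite_measure_axioms s _ abs_Q_le_1]) auto
  have em: "emeasure (\<mu> \<bind> Q n) A = ennreal (\<integral>x. measure (Q n x) A \<partial>\<mu>)" if A: "A \<in> sets E" for A
  proof -
    have "emeasure (\<mu> \<bind> Q n) A = (\<integral>\<^sup>+x. emeasure (Q n x) A \<partial>\<mu>)"
      by (rule emeasure_bind[OF not_empty kern A])
    also have "\<dots> = (\<integral>\<^sup>+x. ennreal (measure (Q n x) A) \<partial>\<mu>)"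
      by (rule nn_integral_cong) (simp add: sp finite_measure.emeasure_eq_measure[OF finite_Q])
    also have "\<dots> = ennreal (\<integral>x. measure (Q n x) A \<partial>\<mu>)"
      using int[OF A] by (intro nn_integral_eq_integral) auto
    finally show ?thesis .
  qed
  show pos: "0 < (\<integral>x. survival n x \<partial>\<mu>)"
  proof -
    have "(\<integral>x. survival n x \<partial>\<mu>) \<noteq> 0"
    proof
      assume "(\<integral>x. survival n x \<partial>\<mu>) = 0"
      then have "AE x in \<mu>. survival n x = 0"
        using integral_nonneg_eq_0_iff_AE[OF int[of "space E"]] by simp
      then have "AE x in \<mu>. False"
      proof (rule AE_mp, intro AE_I2 impI)
        fix x assume "x \<in> space \<mu>" "survival n x = 0"
        then show False using survival_pos[of x n] sp by simp
      qed
      then show False by simp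
    qed
    moreover have "0 \<le> (\<integral>x. survival n x \<partial>\<mu>)" by (intro integral_nonneg_AE) simp
    ultimately show ?thesis by (simp add: less_le)
  qed
  have sets_bind: "sets (\<mu> \<bind> Q n) = sets E"
    by (rule sets_bind[OF _ not_empty]) (simp add: sp sets_Q)
  then have space_bind: "space (\<mu> \<bind> Q n) = space E" by (rule sets_eq_imp_space_eq)
  have nonneg: "0 \<le> (\<integral>x. measure (Q n x) A \<partial>\<mu>)" for A by (intro integral_nonneg_AE) simp
  have emc: "emeasure (conditional \<mu> n) A
      = ennreal ((\<integral>x. measure (Q n x) A \<partial>\<mu>) / (\<integral>x. survival n x \<partial>\<mu>))" if A: "A \<in> sets E" for A
  proof -
    have "space E \<inter> A = A" using sets.sets_into_space[OF A] by auto
    then show ?thesis unfolding conditional_def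
      by (subst emeasure_uniform_measure) (use A pos nonneg in \<open>auto simp: sets_bind em divide_ennreal\<close>)
  qed
  then show "A \<in> sets E \<Longrightarrow>
      measure (conditional \<mu> n) A = (\<integral>x. measure (Q n x) A \<partial>\<mu>) / (\<integral>x. survival n x \<partial>\<mu>)"
    using nonneg pos by (simp add: measure_def)
  have "sets (conditional \<mu> n) = sets E" by (simp add: conditional_def sets_bind)
  moreover have "space (conditional \<mu> n) = space E"
    using sets_eq_imp_space_eq[OF calculation] .
  ultimately show "conditional \<mu> n \<in> space (prob_algebra E)"
    using emc[of "space E"] pos by (auto simp: space_prob_algebra intro!: prob_spaceI)
qed

lemma return_in_prob_algebra: "x \<in> space E \<Longrightarrow> return E x \<in> space (prob_algebra E)"
  by (simp add: space_prob_algebra prob_space_return)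

lemma measure_conditional_return:
  assumes "x \<in> space E" "A \<in> sets E"
  shows "measure (conditional (return E x) n) A = measure (Q n x) A / survival n x"
  using assms by (simp add: measure_conditional[OF return_in_prob_algebra] integral_return)

lemma integral_conditional_return:
  fixes f :: "'a \<Rightarrow> real"
  assumes x: "x \<in> space E" and f: "f \<in> borel_measurable E"
  shows "(\<integral>y. f y \<partial>conditional (return E x) n) = (\<integral>y. f y \<partial>Q n x) / survival n x"
proof -
  have s: "sets (Q n x) = sets E" "space (Q n x) = space E" by (rule sets_Q space_Q x)+
  have b: "return E x \<bind> Q n = Q n x" by (rule bind_return[OF kernel x])
  have f': "f \<in> borel_measurable (Q n x)" using f measurable_cong_sets[OF s(1) refl] by blast
  have [measurable]: "space E \<in> sets (Q n x)" by (simp add: s)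
  have "uniform_measure (Q n x) (space E) = density (Q n x) (\<lambda>_. ennreal (1 / survival n x))"
    unfolding uniform_measure_def
  proof (rule density_cong)
    show "AE y in Q n x. indicator (space E) y / emeasure (Q n x) (space E) = ennreal (1 / survival n x)"
      using survival_pos[OF x, of n]
      by (intro AE_I2) (simp add: s finite_measure.emeasure_eq_measure[OF finite_Q[OF x]]
          divide_ennreal flip: ennreal_1)
  qed measurable
  then have "(\<integral>y. f y \<partial>conditional (return E x) n)
      = (\<integral>y. f y \<partial>density (Q n x) (\<lambda>_. ennreal (1 / survival n x)))"
    by (simp add: conditional_def b)
  also have "\<dots> = (\<integral>y. (1 / survival n x) * f y \<partial>Q n x)"
    using f' by (subst integral_density) auto
  finally show ?thesis by simp
qed

section \<open>A Doeblin condition for the conditioned process gives convergence\<close>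

text \<open>
  The one-step contraction. The kernel \<open>f \<mapsto> Q\<^sub>l (f S\<^sub>n) / S\<^bsub>l+n\<^esub>\<close>, where \<open>S\<close> is the survival
  probability, is Markov, and the two hypotheses together say that it charges the probability
  \<open>f \<mapsto> \<nu> (f S\<^sub>n) / \<nu> (S\<^sub>n)\<close> with mass at least \<open>c e\<close>; such a kernel shrinks oscillations by
  \<open>1 - c e\<close>. It is applied to \<open>f = Q\<^sub>n(\<cdot>, A) / S\<^sub>n\<close>; the inequalities are stated with the
  denominators cleared.
\<close>

lemma oscillation_contraction:
  assumes \<nu>: "\<nu> \<in> space (prob_algebra E)" and c: "0 < c" and e: "0 < e"
    and minorization: "\<And>x A. x \<in> space E \<Longrightarrow> A \<in> sets E \<Longrightarrow>
      c * survival l x * measure \<nu> A \<le> measure (Q l x) A"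
    and comparison: "\<And>x n. x \<in> space E \<Longrightarrow> e * survival n x \<le> (\<integral>y. survival n y \<partial>\<nu>)"
    and A: "A \<in> sets E"
    and bounds: "\<And>x. x \<in> space E \<Longrightarrow> a * survival n x \<le> measure (Q n x) A"
      "\<And>x. x \<in> space E \<Longrightarrow> measure (Q n x) A \<le> (a + d) * survival n x"
  shows "\<exists>a'. \<forall>x\<in>space E. a' * survival (l + n) x \<le> measure (Q (l + n) x) A \<and>
    measure (Q (l + n) x) A \<le> (a' + (1 - c * e) * d) * survival (l + n) x"
proof -
  have p\<nu>: "prob_space \<nu>" and s\<nu>: "sets \<nu> = sets E" using \<nu> by (auto simp: space_prob_algebra)
  have fin\<nu>: "finite_measure \<nu>" using p\<nu> by (rule prob_space.finite_measure)
  define v where "v = (\<integral>y. survival n y \<partial>\<nu>)"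
  have v: "0 < v" unfolding v_def by (rule survival_initial_pos[OF \<nu>])
  define h where "h = (\<lambda>y. measure (Q n y) A - a * survival n y)"
  define k where "k = (\<lambda>y. d * survival n y - h y)"
  have h_nonneg: "0 \<le> h y" and k_nonneg: "0 \<le> k y" if "y \<in> space E" for y
    using bounds[OF that] by (simp_all add: h_def k_def algebra_simps)
  have d: "0 \<le> d"
  proof -
    obtain x where x: "x \<in> space E"
      using prob_space.not_empty[OF p\<nu>] sets_eq_imp_space_eq[OF s\<nu>] by auto
    have "0 \<le> d * survival n x" using bounds[OF x] by (simp add: algebra_simps)
    then show ?thesis using survival_pos[OF x, of n] by (simp add: zero_le_mult_iff)
  qed
  have "d * survival n y \<le> d" if "y \<in> space E" for y
    using mult_left_mono[OF survival_le_1[OF that] d] by simp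
  then have h_le: "h y \<le> d" and k_le: "k y \<le> d" if "y \<in> space E" for y
    using h_nonneg[OF that] k_nonneg[OF that] that by (force simp: k_def)+
  have meas: "h \<in> borel_measurable E" "k \<in> borel_measurable E"
    using A unfolding h_def k_def by measurable
  define m where "m = (\<integral>y. h y \<partial>\<nu>) / v"
  have int\<nu>: "(\<integral>y. k y \<partial>\<nu>) = (d - m) * v"
  proof -
    have "integrable \<nu> h"
      using h_nonneg h_le by (intro integrable_bounded[OF fin\<nu> s\<nu> meas(1), of d]) (simp add: abs_le_iff order_trans[OF _ h_nonneg])
    then have "(\<integral>y. k y \<partial>\<nu>) = d * v - (\<integral>y. h y \<partial>\<nu>)"
      using integrable_initial[OF \<nu>, of "space E" n] by (simp add: k_def v_def)
    then show ?thesis using v by (simp add: m_def algebra_simps)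
  qed
  have bounds': "(a + c * e * m) * survival (l + n) x \<le> measure (Q (l + n) x) A \<and>
      measure (Q (l + n) x) A \<le> ((a + c * e * m) + (1 - c * e) * d) * survival (l + n) x"
    if x: "x \<in> space E" for x
  proof -
    let ?S = "survival (l + n) x"
    have iS: "integrable (Q l x) (survival n)" and "integrable (Q l x) (\<lambda>y. measure (Q n y) A)"
      using A by (auto intro!: integrable_measure_Q x)
    then have intQ: "(\<integral>y. h y \<partial>Q l x) = measure (Q (l + n) x) A - a * ?S"
      "(\<integral>y. k y \<partial>Q l x) = d * ?S - (measure (Q (l + n) x) A - a * ?S)"
      unfolding k_def h_def using x A by (simp_all add: chapman_kolmogorov)
    have "e * ?S = (\<integral>y. e * survival n y \<partial>Q l x)" using x by (simp add: survival_add)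
    also have "\<dots> \<le> (\<integral>y. v \<partial>Q l x)"
      using iS x comparison finite_measure.integrable_const[OF finite_Q]
      by (intro integral_mono) (auto simp: v_def space_Q)
    finally have eS: "e * ?S \<le> v * survival l x" using x by (simp add: space_Q mult.commute)
    have key: "c * e * (r / v) * ?S \<le> (\<integral>y. f y \<partial>Q l x)"
      if f: "f \<in> borel_measurable E" "\<And>y. y \<in> space E \<Longrightarrow> 0 \<le> f y" "\<And>y. y \<in> space E \<Longrightarrow> f y \<le> d"
        and r: "r = (\<integral>y. f y \<partial>\<nu>)" for f r
    proof -
      have r0: "0 \<le> r" unfolding r using f(2) sets_eq_imp_space_eq[OF s\<nu>]
        by (intro integral_nonneg_AE AE_I2) auto
      have "c * e * (r / v) * ?S = c * (r / v) * (e * ?S)" by simp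
      also have "\<dots> \<le> c * (r / v) * (v * survival l x)"
        using eS r0 c v by (intro mult_left_mono) auto
      also have "\<dots> = c * survival l x * (\<integral>y. f y \<partial>\<nu>)" using v by (simp add: r)
      also have "\<dots> \<le> (\<integral>y. f y \<partial>Q l x)"
        by (rule scaled_integral_mono_measure[OF finite_Q sets_Q fin\<nu> s\<nu> _ _ f])
          (use c x minorization in auto)
      finally show ?thesis .
    qed
    have "c * e * m * ?S \<le> measure (Q (l + n) x) A - a * ?S"
      using key[OF meas(1) h_nonneg h_le refl] by (simp add: m_def intQ)
    moreover have "c * e * (d - m) * ?S \<le> d * ?S - (measure (Q (l + n) x) A - a * ?S)"
      using key[OF meas(2) k_nonneg k_le refl] v by (simp add: int\<nu> intQ)
    ultimately show ?thesis by (simp add: algebra_simps)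
  qed
  then show ?thesis by blast
qed

text \<open>
  The contraction is used on blocks of length \<open>l\<close>. At times below \<open>l\<close> the ratio
  \<open>Q\<^sub>n(\<cdot>, A) / S\<^sub>n\<close> lies in \<open>[0, 1]\<close>, which starts the induction.
\<close>

lemma oscillation_decay:
  assumes \<nu>: "\<nu> \<in> space (prob_algebra E)" and c: "0 < c" and e: "0 < e" and l: "0 < l"
    and minorization: "\<And>x A. x \<in> space E \<Longrightarrow> A \<in> sets E \<Longrightarrow>
      c * survival l x * measure \<nu> A \<le> measure (Q l x) A"
    and comparison: "\<And>x n. x \<in> space E \<Longrightarrow> e * survival n x \<le> (\<integral>y. survival n y \<partial>\<nu>)"
    and A: "A \<in> sets E"
  shows "\<exists>a. \<forall>x\<in>space E. a * survival n x \<le> measure (Q n x) A \<and>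
    measure (Q n x) A \<le> (a + (1 - c * e) ^ (n div l)) * survival n x"
proof (induction n rule: less_induct)
  case (less n)
  show ?case
  proof (cases "n < l")
    case True
    then show ?thesis by (intro exI[of _ 0]) (auto simp: Q_le_survival)
  next
    case False
    define n' where "n' = n - l"
    have n: "n = l + n'" "n' < n" using False l by (auto simp: n'_def)
    obtain a where a: "\<And>x. x \<in> space E \<Longrightarrow> a * survival n' x \<le> measure (Q n' x) A"
      "\<And>x. x \<in> space E \<Longrightarrow> measure (Q n' x) A \<le> (a + (1 - c * e) ^ (n' div l)) * survival n' x"
      using less[OF n(2)] by blast
    have power: "(1 - c * e) * (1 - c * e) ^ (n' div l) = (1 - c * e) ^ ((l + n') div l)"
      using l by simp
    show ?thesis
      unfolding n(1) power[symmetric]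
      by (rule oscillation_contraction[OF \<nu> c e minorization comparison A a])
  qed
qed

text \<open>
  An interval containing the values of \<open>Q\<^sub>n(x, A) / S\<^sub>n(x)\<close> for all \<open>x\<close> also contains the conditioned
  probability of \<open>A\<close> at time \<open>n\<close> for every initial law, and at every later time, since conditioning
  at time \<open>n + k\<close> amounts to starting at time \<open>n\<close> before the end from another initial law. Hence the
  conditioned laws are Cauchy uniformly in the set, and the limit does not depend on the initial
  law.
\<close>

theorem doeblin_imp_exponential_convergence:
  assumes \<nu>: "\<nu> \<in> space (prob_algebra E)" and c: "0 < c" and e: "0 < e" and l: "0 < l"
    and minorization: "\<And>x A. x \<in> space E \<Longrightarrow> A \<in> sets E \<Longrightarrow>
      c * survival l x * measure \<nu> A \<le> measure (Q l x) A"
    and comparison: "\<And>x n. x \<in> space E \<Longrightarrow> e * survival n x \<le> (\<integral>y. survival n y \<partial>\<nu>)"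
  shows "\<exists>\<pi>\<in>space (prob_algebra E). \<exists>C \<alpha>::real. 0 < C \<and> 0 < \<alpha> \<and> \<alpha> < 1 \<and>
    (\<forall>\<mu>\<in>space (prob_algebra E). \<forall>n. tv_dist E (conditional \<mu> n) \<pi> \<le> C * \<alpha> ^ n)"
proof -
  have p\<nu>: "prob_space \<nu>" and s\<nu>: "sets \<nu> = sets E" using \<nu> by (auto simp: space_prob_algebra)
  have sp\<nu>: "space \<nu> = space E" by (rule sets_eq_imp_space_eq) fact
  obtain x\<^sub>0 where x\<^sub>0: "x\<^sub>0 \<in> space E" using prob_space.not_empty[OF p\<nu>] sp\<nu> by auto
  \<comment> \<open>Halving \<open>c\<close> keeps the contraction factor positive, so that its \<open>l\<close>-th root can be the rate.\<close>
  define \<gamma> where "\<gamma> = 1 - c / 2 * e"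
  have "c * survival l x\<^sub>0 * 1 \<le> survival l x\<^sub>0"
    using minorization[OF x\<^sub>0, of "space E"] prob_space.prob_space[OF p\<nu>] sp\<nu> by simp
  then have c1: "c \<le> 1" using survival_pos[OF x\<^sub>0, of l] by simp
  have "(\<integral>y. survival 0 y \<partial>\<nu>) = (\<integral>y. 1 \<partial>\<nu>)"
    by (rule Bochner_Integration.integral_cong) (auto simp: sp\<nu> survival_0)
  then have e1: "e \<le> 1"
    using comparison[OF x\<^sub>0, of 0] prob_space.prob_space[OF p\<nu>] x\<^sub>0 by (simp add: survival_0)
  have "c / 2 * e \<le> 1 / 2" using c e c1 e1 mult_mono[of c 1 e 1] by simp
  moreover have "0 < c / 2 * e" using c e by simp
  ultimately have \<gamma>: "0 < \<gamma>" "\<gamma> < 1" unfolding \<gamma>_def by linarith+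
  have minorization': "c / 2 * survival l x * measure \<nu> A \<le> measure (Q l x) A"
    if "x \<in> space E" "A \<in> sets E" for x A
  proof -
    have "0 \<le> c * survival l x * measure \<nu> A" using c by simp
    then show ?thesis using minorization[OF that] by simp
  qed
  have close: "\<bar>measure (conditional \<mu> n) A - measure (conditional (return E x\<^sub>0) (n + k)) A\<bar> \<le> \<gamma> ^ (n div l)"
    if \<mu>: "\<mu> \<in> space (prob_algebra E)" and A: "A \<in> sets E" for \<mu> n k A
  proof -
    have "\<exists>a. \<forall>x\<in>space E. a * survival n x \<le> measure (Q n x) A \<and>
        measure (Q n x) A \<le> (a + \<gamma> ^ (n div l)) * survival n x"
      unfolding \<gamma>_def using c by (intro oscillation_decay[OF \<nu> _ e l minorization' comparison A]) auto
    then obtain a where a: "\<And>x. x \<in> space E \<Longrightarrow> a * survival n x \<le> measure (Q n x) A"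
      "\<And>x. x \<in> space E \<Longrightarrow> measure (Q n x) A \<le> (a + \<gamma> ^ (n div l)) * survival n x"
      by blast
    have between: "a * (\<integral>x. survival n x \<partial>m) \<le> (\<integral>x. measure (Q n x) A \<partial>m)"
      "(\<integral>x. measure (Q n x) A \<partial>m) \<le> (a + \<gamma> ^ (n div l)) * (\<integral>x. survival n x \<partial>m)"
      if m: "finite_measure m" "sets m = sets E" for m
    proof -
      have sp: "space m = space E" by (rule sets_eq_imp_space_eq) fact
      have i: "integrable m (\<lambda>x. measure (Q n x) B)" if "B \<in> sets E" for B
        using that by (intro integrable_bounded[OF m _ abs_Q_le_1]) auto
      have "(\<integral>x. a * survival n x \<partial>m) \<le> (\<integral>x. measure (Q n x) A \<partial>m)"
        using a A sp by (intro integral_mono integrable_mult_right i) auto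
      then show "a * (\<integral>x. survival n x \<partial>m) \<le> (\<integral>x. measure (Q n x) A \<partial>m)" by simp
      have "(\<integral>x. measure (Q n x) A \<partial>m) \<le> (\<integral>x. (a + \<gamma> ^ (n div l)) * survival n x \<partial>m)"
        using a A sp by (intro integral_mono integrable_mult_right i) auto
      then show "(\<integral>x. measure (Q n x) A \<partial>m) \<le> (a + \<gamma> ^ (n div l)) * (\<integral>x. survival n x \<partial>m)" by simp
    qed
    have "a \<le> measure (conditional \<mu> n) A \<and> measure (conditional \<mu> n) A \<le> a + \<gamma> ^ (n div l)"
      using between[of \<mu>] \<mu> survival_initial_pos[OF \<mu>, of n]
      by (auto simp: measure_conditional[OF \<mu> A] space_prob_algebra prob_space.finite_measure
          le_divide_eq divide_le_eq)
    moreover have "a \<le> measure (conditional (return E x\<^sub>0) (n + k)) A \<and>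
        measure (conditional (return E x\<^sub>0) (n + k)) A \<le> a + \<gamma> ^ (n div l)"
      using between[OF finite_Q sets_Q, OF x\<^sub>0 x\<^sub>0, of k] survival_pos[OF x\<^sub>0, of "k + n"]
      by (simp add: measure_conditional_return x\<^sub>0 A le_divide_eq divide_le_eq add.commute[of n k]
          chapman_kolmogorov[OF x\<^sub>0])
    ultimately show ?thesis by linarith
  qed
  define \<alpha> where "\<alpha> = root l \<gamma>"
  have \<alpha>: "0 < \<alpha>" "\<alpha> < 1" "\<alpha> ^ l = \<gamma>"
    using \<gamma> l by (auto simp: \<alpha>_def real_root_gt_zero real_root_lt_1_iff real_root_pow_pos)
  have rate: "\<gamma> ^ (n div l) \<le> 1 / \<gamma> * \<alpha> ^ n" for n
  proof -
    have "n \<le> l * (n div l) + l"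
      using mod_less_divisor[OF l, of n] mult_div_mod_eq[of l n] by linarith
    then have "\<alpha> ^ (l * (n div l) + l) \<le> \<alpha> ^ n"
      using \<alpha> by (intro power_decreasing) auto
    then have "\<gamma> ^ (n div l) * \<gamma> \<le> \<alpha> ^ n" by (simp add: power_add power_mult \<alpha>(3))
    then show ?thesis using \<gamma> by (simp add: field_simps)
  qed
  have "\<exists>\<pi>\<in>space (prob_algebra E). \<forall>A\<in>sets E. \<forall>n.
      \<bar>measure (conditional (return E x\<^sub>0) n) A - measure \<pi> A\<bar> \<le> \<gamma> ^ (n div l)"
  proof (rule uniform_setwise_limit_is_prob)
    show "conditional (return E x\<^sub>0) n \<in> space (prob_algebra E)" for n
      by (rule conditional_in_prob_algebra[OF return_in_prob_algebra[OF x\<^sub>0]])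
    show "\<bar>measure (conditional (return E x\<^sub>0) n) A - measure (conditional (return E x\<^sub>0) (n + k)) A\<bar>
        \<le> \<gamma> ^ (n div l)" if "A \<in> sets E" for n k A
      by (rule close[OF return_in_prob_algebra[OF x\<^sub>0] that])
    have lim: "(\<lambda>n. 1 / \<gamma> * \<alpha> ^ n) \<longlonglongrightarrow> 0"
      using \<alpha> by (intro tendsto_mult_right_zero LIMSEQ_power_zero) auto
    show "(\<lambda>n. \<gamma> ^ (n div l)) \<longlonglongrightarrow> 0"
    proof (rule tendsto_sandwich[OF _ _ tendsto_const lim])
      show "\<forall>\<^sub>F n in sequentially. 0 \<le> \<gamma> ^ (n div l)"
        using \<gamma>(1) by simp
      show "\<forall>\<^sub>F n in sequentially. \<gamma> ^ (n div l) \<le> 1 / \<gamma> * \<alpha> ^ n"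
        by (intro always_eventually allI rate)
    qed
  qed
  then obtain \<pi> where \<pi>: "\<pi> \<in> space (prob_algebra E)"
    and lim: "\<And>A n. A \<in> sets E \<Longrightarrow>
      \<bar>measure (conditional (return E x\<^sub>0) n) A - measure \<pi> A\<bar> \<le> \<gamma> ^ (n div l)" by blast
  have "tv_dist E (conditional \<mu> n) \<pi> \<le> 4 / \<gamma> * \<alpha> ^ n" if \<mu>: "\<mu> \<in> space (prob_algebra E)" for \<mu> n
  proof -
    have "tv_dist E (conditional \<mu> n) \<pi> \<le> 2 * (2 * \<gamma> ^ (n div l))"
    proof (rule tv_dist_le_of_setwise[OF conditional_in_prob_algebra[OF \<mu>] \<pi>])
      show "\<bar>measure (conditional \<mu> n) A - measure \<pi> A\<bar> \<le> 2 * \<gamma> ^ (n div l)" if "A \<in> sets E" for A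
        using close[OF \<mu> that, of n 0] lim[OF that, of n] by simp
    qed
    then show ?thesis using rate[of n] by simp
  qed
  then show ?thesis using \<pi> \<alpha> \<gamma>
    by (intro bexI[of _ \<pi>] exI[of _ "4 / \<gamma>"] exI[of _ \<alpha>]) auto
qed

end

section \<open>Drift conditions give a Doeblin condition\<close>

context killed_semigroup
begin

text \<open>
  Condition (E) with a bounded \<open>\<phi>\<^sub>1\<close>, read off the semigroup. Boundedness makes all integrals finite,
  so that the drift inequalities can be stated in the reals, and the Harnack-type quotient bound is
  stated without the quotient.
\<close>

definition drift_criterion ::
  "nat \<Rightarrow> real \<Rightarrow> real \<Rightarrow> real \<Rightarrow> real \<Rightarrow> real \<Rightarrow> ('a \<Rightarrow> real) \<Rightarrow> ('a \<Rightarrow> real) \<Rightarrow> 'a set \<Rightarrow> 'a measure \<Rightarrow> bool"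
where
  "drift_criterion n\<^sub>1 \<theta>\<^sub>1 \<theta>\<^sub>2 c\<^sub>1 c\<^sub>2 c\<^sub>3 \<phi>\<^sub>1 \<phi>\<^sub>2 K \<nu> \<longleftrightarrow>
     n\<^sub>1 > 0 \<and> \<theta>\<^sub>1 > 0 \<and> \<theta>\<^sub>2 > 0 \<and> c\<^sub>1 > 0 \<and> c\<^sub>2 > 0 \<and> c\<^sub>3 > 0 \<and>
     \<phi>\<^sub>1 \<in> borel_measurable E \<and> \<phi>\<^sub>2 \<in> borel_measurable E \<and>
     K \<in> sets E \<and> \<nu> \<in> space (prob_algebra (restrict_space E K)) \<and>
     (\<forall>x\<in>K. \<forall>A\<in>sets E. c\<^sub>1 * measure \<nu> (A \<inter> K) \<le> measure (Q n\<^sub>1 x) A) \<and>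
     \<theta>\<^sub>1 < \<theta>\<^sub>2 \<and>
     (\<forall>x\<in>space E. 1 \<le> \<phi>\<^sub>1 x) \<and> (\<exists>b. \<forall>x\<in>space E. \<phi>\<^sub>1 x \<le> b) \<and>
     (\<forall>x\<in>space E. 0 \<le> \<phi>\<^sub>2 x) \<and> (\<forall>x\<in>space E. \<phi>\<^sub>2 x \<le> 1) \<and> (\<exists>b>0. \<forall>x\<in>K. b \<le> \<phi>\<^sub>2 x) \<and>
     (\<forall>x\<in>space E. (\<integral>y. \<phi>\<^sub>1 y \<partial>Q 1 x) \<le> \<theta>\<^sub>1 * \<phi>\<^sub>1 x + c\<^sub>2 * indicator K x) \<and>
     (\<forall>x\<in>space E. \<theta>\<^sub>2 * \<phi>\<^sub>2 x \<le> (\<integral>y. \<phi>\<^sub>2 y \<partial>Q 1 x)) \<and>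
     (\<forall>n. \<forall>x\<in>K. \<forall>y\<in>K. survival n x \<le> c\<^sub>3 * survival n y) \<and>
     (\<forall>x\<in>K. \<exists>n\<^sub>4. \<forall>n\<ge>n\<^sub>4. 0 < measure (Q n x) K)"

lemma integral_ge_on_subset:
  fixes f :: "'a \<Rightarrow> real"
  assumes x: "x \<in> space E" and K: "K \<in> sets E"
    and f: "f \<in> borel_measurable E" "\<And>y. y \<in> space E \<Longrightarrow> 0 \<le> f y" "\<And>y. y \<in> space E \<Longrightarrow> f y \<le> b"
    and r: "\<And>y. y \<in> K \<Longrightarrow> r \<le> f y"
  shows "r * measure (Q n x) K \<le> (\<integral>y. f y \<partial>Q n x)"
proof -
  have KE: "K \<inter> space (Q n x) = K" using sets.sets_into_space[OF K] by (auto simp: space_Q x)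
  have "integrable (Q n x) (\<lambda>y. r * indicator K y)"
    by (rule integrable_Q[OF x, of _ "\<bar>r\<bar>"]) (use K in \<open>auto simp: indicator_def\<close>)
  moreover have "integrable (Q n x) f"
    using f by (intro integrable_Q[OF x, of _ b]) auto
  moreover have "r * indicator K y \<le> f y" if "y \<in> space (Q n x)" for y
    using that f(2) r by (auto simp: indicator_def space_Q x)
  ultimately have "(\<integral>y. r * indicator K y \<partial>Q n x) \<le> (\<integral>y. f y \<partial>Q n x)"
    by (rule integral_mono)
  then show ?thesis by (simp add: KE)
qed

text \<open>
  The Lyapunov function \<open>\<phi>\<^sub>2\<close> bounds the survival probability from below by \<open>\<theta>\<^sub>2\<^sup>n\<close>, and the
  uniform return to \<open>K\<close> turns this into a lower bound of \<open>S\<^bsub>k+j\<^esub>\<close> by a multiple of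
  \<open>\<theta>\<^sub>2\<^sup>k S\<^sub>j\<close> on \<open>K\<close>: surviving \<open>k\<close> more steps costs at most a factor of order \<open>\<theta>\<^sub>2\<^sup>k\<close>. The
  return is only controlled at times \<open>m\<close> and later, so the path is required to be in \<open>K\<close> at time
  \<open>k + m\<close> instead of \<open>k\<close>; this costs a constant factor.
\<close>

lemma survival_growth_on_small_set:
  assumes K: "K \<in> sets E" and y\<^sub>0: "y\<^sub>0 \<in> K"
    and \<phi>\<^sub>2: "\<phi>\<^sub>2 \<in> borel_measurable E" "\<And>x. x \<in> space E \<Longrightarrow> 0 \<le> \<phi>\<^sub>2 x" "\<And>x. x \<in> space E \<Longrightarrow> \<phi>\<^sub>2 x \<le> 1"
    and b: "0 < b" "\<And>x. x \<in> K \<Longrightarrow> b \<le> \<phi>\<^sub>2 x"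
    and \<theta>\<^sub>2: "0 < \<theta>\<^sub>2"
    and drift: "\<And>x. x \<in> space E \<Longrightarrow> \<theta>\<^sub>2 * \<phi>\<^sub>2 x \<le> (\<integral>y. \<phi>\<^sub>2 y \<partial>Q 1 x)"
    and c\<^sub>3: "0 < c\<^sub>3"
    and harnack: "\<And>n x y. x \<in> K \<Longrightarrow> y \<in> K \<Longrightarrow> survival n x \<le> c\<^sub>3 * survival n y"
    and \<delta>: "0 < \<delta>" and return: "\<And>x. x \<in> space E \<Longrightarrow> \<delta> * survival m x \<le> measure (Q m x) K"
  shows "\<exists>\<kappa>>0. \<forall>k j. \<kappa> * \<theta>\<^sub>2 ^ k * survival j y\<^sub>0 \<le> survival (k + j) y\<^sub>0"
proof (intro exI conjI allI)
  have KE: "x \<in> space E" if "x \<in> K" for x using sets.sets_into_space[OF K] that by auto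
  note y\<^sub>0E = KE[OF y\<^sub>0]
  show "0 < \<delta> * b * \<theta>\<^sub>2 ^ m / c\<^sub>3" using \<delta> b \<theta>\<^sub>2 c\<^sub>3 by simp
  have lower: "\<theta>\<^sub>2 ^ n * \<phi>\<^sub>2 x \<le> survival n x" if "x \<in> space E" for n x
    using that
  proof (induction n arbitrary: x)
    case 0
    then show ?case using \<phi>\<^sub>2(3) by (simp add: survival_0)
  next
    case (Suc n)
    have "\<theta>\<^sub>2 ^ n * (\<theta>\<^sub>2 * \<phi>\<^sub>2 x) \<le> \<theta>\<^sub>2 ^ n * (\<integral>y. \<phi>\<^sub>2 y \<partial>Q 1 x)"
      using drift[OF Suc.prems] \<theta>\<^sub>2 by (intro mult_left_mono) auto
    also have "\<dots> = (\<integral>y. \<theta>\<^sub>2 ^ n * \<phi>\<^sub>2 y \<partial>Q 1 x)" by simp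
    also have "\<dots> \<le> (\<integral>y. survival n y \<partial>Q 1 x)"
      using Suc \<phi>\<^sub>2 by (intro integral_mono integrable_measure_Q integrable_mult_right
        integrable_Q[OF _ \<phi>\<^sub>2(1), of _ 1]) (auto simp: space_Q)
    also have "\<dots> = survival (Suc n) x" using survival_add[OF Suc.prems, of 1 n] by simp
    finally show ?case by (simp add: ac_simps)
  qed
  fix k j
  have "\<delta> * survival (k + m) y\<^sub>0 = (\<integral>z. \<delta> * survival m z \<partial>Q k y\<^sub>0)"
    by (simp add: survival_add y\<^sub>0E)
  also have "\<dots> \<le> (\<integral>z. measure (Q m z) K \<partial>Q k y\<^sub>0)"
    using return K y\<^sub>0E by (intro integral_mono integrable_mult_right integrable_measure_Q) (auto simp: space_Q)
  also have "\<dots> = measure (Q (k + m) y\<^sub>0) K" by (simp add: chapman_kolmogorov y\<^sub>0E K)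
  finally have return': "\<delta> * survival (k + m) y\<^sub>0 \<le> measure (Q (k + m) y\<^sub>0) K" .
  have "\<delta> * b * \<theta>\<^sub>2 ^ m / c\<^sub>3 * \<theta>\<^sub>2 ^ k * survival j y\<^sub>0
      = survival j y\<^sub>0 / c\<^sub>3 * (\<delta> * (\<theta>\<^sub>2 ^ (k + m) * b))"
    by (simp add: power_add)
  also have "\<dots> \<le> survival j y\<^sub>0 / c\<^sub>3 * (\<delta> * (\<theta>\<^sub>2 ^ (k + m) * \<phi>\<^sub>2 y\<^sub>0))"
    using b(2)[OF y\<^sub>0] \<delta> \<theta>\<^sub>2 c\<^sub>3 by (intro mult_left_mono) auto
  also have "\<dots> \<le> survival j y\<^sub>0 / c\<^sub>3 * (\<delta> * survival (k + m) y\<^sub>0)"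
    using lower[OF y\<^sub>0E] \<delta> c\<^sub>3 by (intro mult_left_mono) auto
  also have "\<dots> \<le> survival j y\<^sub>0 / c\<^sub>3 * measure (Q (k + m) y\<^sub>0) K"
    using return' c\<^sub>3 by (intro mult_left_mono) auto
  also have "\<dots> \<le> (\<integral>z. survival j z \<partial>Q (k + m) y\<^sub>0)"
    using harnack[OF y\<^sub>0] c\<^sub>3 survival_le_1
    by (intro integral_ge_on_subset[OF y\<^sub>0E K, where b = 1])
      (auto simp: divide_le_eq mult.commute)
  also have "\<dots> = survival (k + m + j) y\<^sub>0" by (simp add: survival_add y\<^sub>0E)
  also have "\<dots> \<le> survival (k + j) y\<^sub>0" by (rule survival_antimono[OF y\<^sub>0E]) simp
  finally show "\<delta> * b * \<theta>\<^sub>2 ^ m / c\<^sub>3 * \<theta>\<^sub>2 ^ k * survival j y\<^sub>0 \<le> survival (k + j) y\<^sub>0" .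
qed

text \<open>
  Survival from an arbitrary point is compared with survival from \<open>y\<^sub>0 \<in> K\<close>. Off \<open>K\<close> the function
  \<open>\<phi>\<^sub>1\<close> decays at rate \<open>\<theta>\<^sub>1\<close>, so the bound \<open>S\<^sub>n \<le> c\<^sub>3 t\<^sub>n \<phi>\<^sub>1\<close> propagates by induction as soon as
  \<open>t\<close> decays no faster than \<open>\<theta>\<^sub>1\<close>. The sequence \<open>S\<^sub>n(y\<^sub>0)\<close> need not have this property step by
  step, so \<open>t\<close> is the smallest sequence above it that has it for \<open>\<theta>\<^sub>2\<close>, namely
  \<open>max\<^sub>k \<theta>\<^sub>2\<^sup>k S\<^bsub>n-k\<^esub>(y\<^sub>0)\<close>, which is comparable to \<open>S\<^sub>n(y\<^sub>0)\<close>.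
\<close>

lemma survival_comparison:
  assumes K: "K \<in> sets E" and y\<^sub>0: "y\<^sub>0 \<in> K"
    and \<phi>\<^sub>1: "\<phi>\<^sub>1 \<in> borel_measurable E" "\<And>x. x \<in> space E \<Longrightarrow> 1 \<le> \<phi>\<^sub>1 x" "\<And>x. x \<in> space E \<Longrightarrow> \<phi>\<^sub>1 x \<le> b"
    and drift: "\<And>x. x \<in> space E - K \<Longrightarrow> (\<integral>y. \<phi>\<^sub>1 y \<partial>Q 1 x) \<le> \<theta>\<^sub>1 * \<phi>\<^sub>1 x"
    and \<theta>: "0 < \<theta>\<^sub>2" "\<theta>\<^sub>1 \<le> \<theta>\<^sub>2"
    and c\<^sub>3: "0 < c\<^sub>3"
    and harnack: "\<And>n x. x \<in> K \<Longrightarrow> survival n x \<le> c\<^sub>3 * survival n y\<^sub>0"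
    and \<kappa>: "0 < \<kappa>" "\<And>k j. \<kappa> * \<theta>\<^sub>2 ^ k * survival j y\<^sub>0 \<le> survival (k + j) y\<^sub>0"
    and x: "x \<in> space E"
  shows "\<kappa> * survival n x \<le> c\<^sub>3 * b * survival n y\<^sub>0"
proof -
  have y\<^sub>0E: "y\<^sub>0 \<in> space E" using sets.sets_into_space[OF K] y\<^sub>0 by auto
  have c\<^sub>3_ge: "1 \<le> c\<^sub>3" using harnack[OF y\<^sub>0, of 0] by (simp add: survival_0 y\<^sub>0E)
  define t where "t = rec_nat (1::real) (\<lambda>n r. max (survival (Suc n) y\<^sub>0) (\<theta>\<^sub>2 * r))"
  have t0: "t 0 = 1" and tS: "t (Suc n) = max (survival (Suc n) y\<^sub>0) (\<theta>\<^sub>2 * t n)" for n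
    by (simp_all add: t_def)
  have t_nonneg: "0 \<le> t n" for n by (induction n) (simp_all add: t0 tS le_max_iff_disj)
  have "\<exists>k j. n = k + j \<and> t n = \<theta>\<^sub>2 ^ k * survival j y\<^sub>0" for n
  proof (induction n)
    case 0
    show ?case by (rule exI[of _ 0], rule exI[of _ 0]) (simp add: t0 survival_0 y\<^sub>0E)
  next
    case (Suc n)
    then obtain k j where "n = k + j" "t n = \<theta>\<^sub>2 ^ k * survival j y\<^sub>0" by blast
    then have "Suc n = Suc k + j \<and> \<theta>\<^sub>2 * t n = \<theta>\<^sub>2 ^ Suc k * survival j y\<^sub>0" by simp
    moreover have "Suc n = 0 + Suc n \<and> survival (Suc n) y\<^sub>0 = \<theta>\<^sub>2 ^ 0 * survival (Suc n) y\<^sub>0" by simp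
    ultimately show ?case unfolding tS max_def by metis
  qed
  then have t_le: "\<kappa> * t n \<le> survival n y\<^sub>0" for n using \<kappa>(2) by (metis mult.assoc)
  have bound: "survival n x \<le> c\<^sub>3 * t n * \<phi>\<^sub>1 x" if "x \<in> space E" for n x
    using that
  proof (induction n arbitrary: x)
    case 0
    then show ?case
      using mult_mono[OF c\<^sub>3_ge \<phi>\<^sub>1(2)[OF 0]] c\<^sub>3 by (simp add: survival_0 t0)
  next
    case (Suc n)
    show ?case
    proof (cases "x \<in> K")
      case True
      have "survival (Suc n) x \<le> c\<^sub>3 * survival (Suc n) y\<^sub>0" by (rule harnack[OF True])
      also have "\<dots> \<le> c\<^sub>3 * t (Suc n)" using c\<^sub>3 by (simp add: tS)
      also have "\<dots> \<le> c\<^sub>3 * t (Suc n) * \<phi>\<^sub>1 x"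
        using mult_left_mono[OF \<phi>\<^sub>1(2)[OF Suc.prems], of "c\<^sub>3 * t (Suc n)"] c\<^sub>3 t_nonneg[of "Suc n"]
        by simp
      finally show ?thesis .
    next
      case False
      have "survival (Suc n) x = (\<integral>y. survival n y \<partial>Q 1 x)" using survival_add[OF Suc.prems, of 1 n] by simp
      also have "\<dots> \<le> (\<integral>y. c\<^sub>3 * t n * \<phi>\<^sub>1 y \<partial>Q 1 x)"
      proof (intro integral_mono integrable_measure_Q integrable_mult_right integrable_Q[OF _ \<phi>\<^sub>1(1), of _ b])
        show "\<bar>\<phi>\<^sub>1 y\<bar> \<le> b" if "y \<in> space E" for y
          using \<phi>\<^sub>1(2,3)[OF that] by simp
      qed (use Suc in \<open>auto simp: space_Q\<close>)
      also have "\<dots> = c\<^sub>3 * t n * (\<integral>y. \<phi>\<^sub>1 y \<partial>Q 1 x)" by simp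
      also have "\<dots> \<le> c\<^sub>3 * t n * (\<theta>\<^sub>2 * \<phi>\<^sub>1 x)"
      proof (rule mult_left_mono)
        have "\<theta>\<^sub>1 * \<phi>\<^sub>1 x \<le> \<theta>\<^sub>2 * \<phi>\<^sub>1 x"
          using \<theta>(2) \<phi>\<^sub>1(2)[OF Suc.prems] by (intro mult_right_mono) auto
        then show "(\<integral>y. \<phi>\<^sub>1 y \<partial>Q 1 x) \<le> \<theta>\<^sub>2 * \<phi>\<^sub>1 x"
          using drift[of x] Suc.prems False by simp
        show "0 \<le> c\<^sub>3 * t n" using c\<^sub>3 t_nonneg by simp
      qed
      also have "\<dots> = c\<^sub>3 * (\<theta>\<^sub>2 * t n) * \<phi>\<^sub>1 x" by simp
      also have "\<dots> \<le> c\<^sub>3 * t (Suc n) * \<phi>\<^sub>1 x"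
        using c\<^sub>3 \<phi>\<^sub>1(2)[OF Suc.prems] by (intro mult_right_mono mult_left_mono) (auto simp: tS)
      finally show ?thesis .
    qed
  qed
  have "\<kappa> * survival n x \<le> \<kappa> * (c\<^sub>3 * t n * \<phi>\<^sub>1 x)"
    using bound[OF x] \<kappa>(1) by (intro mult_left_mono) auto
  also have "\<dots> = c\<^sub>3 * (\<kappa> * t n) * \<phi>\<^sub>1 x" by simp
  also have "\<dots> \<le> c\<^sub>3 * survival n y\<^sub>0 * b"
    using t_le[of n] t_nonneg[of n] \<kappa>(1) \<phi>\<^sub>1(2,3)[OF x] c\<^sub>3 by (intro mult_mono) auto
  finally show ?thesis by (simp add: ac_simps)
qed

text \<open>
  The Doeblin minorization comes from returning to \<open>K\<close> at time \<open>m\<close> and spreading as \<open>\<nu>\<close> in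
  \<open>n\<^sub>1\<close> more steps; the comparison of survival probabilities is that of the preceding lemma, because
  \<open>\<nu>\<close> charges only \<open>K\<close>, where all survival probabilities are comparable.
\<close>

theorem drift_criterion_imp_exponential_convergence:
  assumes drift: "drift_criterion n\<^sub>1 \<theta>\<^sub>1 \<theta>\<^sub>2 c\<^sub>1 c\<^sub>2 c\<^sub>3 \<phi>\<^sub>1 \<phi>\<^sub>2 K \<nu>"
    and \<delta>: "0 < \<delta>" and return: "\<And>x. x \<in> space E \<Longrightarrow> \<delta> * survival m x \<le> measure (Q m x) K"
  shows "\<exists>\<pi>\<in>space (prob_algebra E). \<exists>C \<alpha>::real. 0 < C \<and> 0 < \<alpha> \<and> \<alpha> < 1 \<and>
    (\<forall>\<mu>\<in>space (prob_algebra E). \<forall>n. tv_dist E (conditional \<mu> n) \<pi> \<le> C * \<alpha> ^ n)"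
proof -
  note D = drift[unfolded drift_criterion_def]
  have pos: "n\<^sub>1 > 0" "\<theta>\<^sub>2 > 0" "c\<^sub>1 > 0" "c\<^sub>3 > 0" and K: "K \<in> sets E" using D by auto
  have \<nu>: "prob_space \<nu>" "sets \<nu> = sets (restrict_space E K)"
    using D by (auto simp: space_prob_algebra)
  have KE: "K \<subseteq> space E" using sets.sets_into_space[OF K] .
  have sp\<nu>: "space \<nu> = K"
    using sets_eq_imp_space_eq[OF \<nu>(2)] KE by (auto simp: space_restrict_space)
  obtain y\<^sub>0 where y\<^sub>0: "y\<^sub>0 \<in> K" using prob_space.not_empty[OF \<nu>(1)] sp\<nu> by auto
  have "\<exists>b>0. \<forall>x\<in>K. b \<le> \<phi>\<^sub>2 x" using D by simp
  then obtain b where b: "b > 0" "\<And>x. x \<in> K \<Longrightarrow> b \<le> \<phi>\<^sub>2 x" by blast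
  have "\<exists>b. \<forall>x\<in>space E. \<phi>\<^sub>1 x \<le> b" using D by simp
  then obtain b' where b': "\<And>x. x \<in> space E \<Longrightarrow> \<phi>\<^sub>1 x \<le> b'" by blast
  have harnack: "survival n x \<le> c\<^sub>3 * survival n y" if "x \<in> K" "y \<in> K" for n x y
    using D that by blast
  have "\<exists>\<kappa>>0. \<forall>k j. \<kappa> * \<theta>\<^sub>2 ^ k * survival j y\<^sub>0 \<le> survival (k + j) y\<^sub>0"
    by (rule survival_growth_on_small_set[OF K y\<^sub>0 _ _ _ b pos(2) _ pos(4) harnack \<delta> return])
      (use D in auto)
  then obtain \<kappa> where \<kappa>: "\<kappa> > 0" "\<And>k j. \<kappa> * \<theta>\<^sub>2 ^ k * survival j y\<^sub>0 \<le> survival (k + j) y\<^sub>0"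
    by blast
  have comparison: "\<kappa> * survival n x \<le> c\<^sub>3 * b' * survival n y\<^sub>0" if "x \<in> space E" for n x
  proof (rule survival_comparison[OF K y\<^sub>0 _ _ b' _ pos(2) _ pos(4) _ \<kappa> that])
    show "(\<integral>y. \<phi>\<^sub>1 y \<partial>Q 1 x) \<le> \<theta>\<^sub>1 * \<phi>\<^sub>1 x" if x: "x \<in> space E - K" for x
    proof -
      have "(\<integral>y. \<phi>\<^sub>1 y \<partial>Q 1 x) \<le> \<theta>\<^sub>1 * \<phi>\<^sub>1 x + c\<^sub>2 * indicator K x" using D x by blast
      then show ?thesis using x by simp
    qed
  qed (use D harnack y\<^sub>0 in auto)
  have b'1: "1 \<le> b'" using D b' y\<^sub>0 KE by (meson order_trans subsetD)
  \<comment> \<open>\<open>\<nu>\<close> lives on \<open>K\<close>; \<open>\<nu>'\<close> is the same measure seen on \<open>E\<close>.\<close>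
  define \<nu>' where "\<nu>' = distr \<nu> E (\<lambda>x. x)"
  have id: "(\<lambda>x. x) \<in> \<nu> \<rightarrow>\<^sub>M E"
    unfolding measurable_cong_sets[OF \<nu>(2) refl] by (rule measurable_restrict_space1) simp
  have \<nu>'_prob: "\<nu>' \<in> space (prob_algebra E)"
    using prob_space.prob_space_distr[OF \<nu>(1) id] by (simp add: space_prob_algebra \<nu>'_def)
  have \<nu>'_measure: "measure \<nu>' A = measure \<nu> (A \<inter> K)" if "A \<in> sets E" for A
    unfolding \<nu>'_def using measure_distr[OF id that] by (simp add: sp\<nu>)
  show ?thesis
  proof (rule doeblin_imp_exponential_convergence[OF \<nu>'_prob])
    show "0 < \<delta> * c\<^sub>1" "0 < \<kappa> / (c\<^sub>3 * c\<^sub>3 * b')" "0 < m + n\<^sub>1" using pos \<delta> \<kappa> b'1 by auto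
    show "\<delta> * c\<^sub>1 * survival (m + n\<^sub>1) x * measure \<nu>' A \<le> measure (Q (m + n\<^sub>1) x) A"
      if x: "x \<in> space E" and A: "A \<in> sets E" for x A
    proof -
      have "\<delta> * c\<^sub>1 * survival (m + n\<^sub>1) x * measure \<nu>' A
          = c\<^sub>1 * measure \<nu> (A \<inter> K) * (\<delta> * survival (m + n\<^sub>1) x)"
        by (simp add: \<nu>'_measure[OF A])
      also have "\<dots> \<le> c\<^sub>1 * measure \<nu> (A \<inter> K) * (\<delta> * survival m x)"
        using survival_add_le[OF x] \<delta> pos by (intro mult_left_mono) auto
      also have "\<dots> \<le> c\<^sub>1 * measure \<nu> (A \<inter> K) * measure (Q m x) K"
        using return[OF x] pos by (intro mult_left_mono) auto
      also have "\<dots> \<le> (\<integral>y. measure (Q n\<^sub>1 y) A \<partial>Q m x)"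
        using D A Q_le_1 by (intro integral_ge_on_subset[OF x K, where b = 1]) auto
      also have "\<dots> = measure (Q (m + n\<^sub>1) x) A" by (simp add: chapman_kolmogorov x A)
      finally show ?thesis .
    qed
    show "\<kappa> / (c\<^sub>3 * c\<^sub>3 * b') * survival n x \<le> (\<integral>y. survival n y \<partial>\<nu>')"
      if x: "x \<in> space E" for x n
    proof -
      have "\<kappa> / (c\<^sub>3 * c\<^sub>3 * b') * survival n x \<le> survival n y\<^sub>0 / c\<^sub>3"
        using comparison[OF x, of n] pos b'1 by (simp add: field_simps)
      also have "\<dots> = (\<integral>y. survival n y\<^sub>0 / c\<^sub>3 \<partial>\<nu>)" using prob_space.prob_space[OF \<nu>(1)] by simp
      also have "\<dots> \<le> (\<integral>y. survival n y \<partial>\<nu>)"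
      proof (rule integral_mono)
        have fin: "finite_measure \<nu>" by (rule prob_space.finite_measure[OF \<nu>(1)])
        show "integrable \<nu> (\<lambda>y. survival n y\<^sub>0 / c\<^sub>3)" by (rule finite_measure.integrable_const[OF fin])
        show "integrable \<nu> (survival n)"
          using KE by (intro integrable_bounded[OF fin \<nu>(2), of _ 1] measurable_restrict_space1)
            (auto simp: space_restrict_space survival_le_1)
        show "survival n y\<^sub>0 / c\<^sub>3 \<le> survival n y" if "y \<in> space \<nu>" for y
          using harnack[OF y\<^sub>0, of y n] that pos by (simp add: sp\<nu> divide_le_eq mult.commute)
      qed
      also have "\<dots> = (\<integral>y. survival n y \<partial>\<nu>')" unfolding \<nu>'_def by (rule integral_distr[OF id, symmetric]) simp
      finally show ?thesis .
    qed
  qed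
qed

end

section \<open>Convergence gives drift conditions\<close>

context killed_semigroup
begin

text \<open>
  Convergence of the conditioned laws, with the conditioning undone. It is needed for functions and
  not only for sets, with an error proportional to the bound \<open>b\<close>.
\<close>

lemma conditional_approx:
  fixes f :: "'a \<Rightarrow> real"
  assumes \<nu>: "\<nu> \<in> space (prob_algebra E)"
    and conv: "\<And>x n. x \<in> space E \<Longrightarrow> tv_dist E (conditional (return E x) n) \<nu> \<le> C * \<alpha> ^ n"
    and x: "x \<in> space E" and f: "f \<in> borel_measurable E" "\<And>y. y \<in> space E \<Longrightarrow> \<bar>f y\<bar> \<le> b" and b: "0 \<le> b"
  shows "\<bar>(\<integral>y. f y \<partial>Q n x) - survival n x * (\<integral>y. f y \<partial>\<nu>)\<bar> \<le> survival n x * (b * (C * \<alpha> ^ n))"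
proof -
  have S: "0 < survival n x" by (rule survival_pos[OF x])
  have "\<bar>(\<integral>y. f y \<partial>Q n x) / survival n x - (\<integral>y. f y \<partial>\<nu>)\<bar>
      \<le> b * tv_dist E (conditional (return E x) n) \<nu>"
    unfolding integral_conditional_return[OF x f(1), symmetric]
    by (rule integral_diff_le_tv_dist[OF conditional_in_prob_algebra[OF return_in_prob_algebra[OF x]] \<nu> f b])
  also have "\<dots> \<le> b * (C * \<alpha> ^ n)" by (rule mult_left_mono[OF conv[OF x] b])
  finally have "survival n x * \<bar>(\<integral>y. f y \<partial>Q n x) / survival n x - (\<integral>y. f y \<partial>\<nu>)\<bar>
      \<le> survival n x * (b * (C * \<alpha> ^ n))"
    using S by (intro mult_left_mono) auto
  also have "survival n x * \<bar>(\<integral>y. f y \<partial>Q n x) / survival n x - (\<integral>y. f y \<partial>\<nu>)\<bar>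
      = \<bar>survival n x * ((\<integral>y. f y \<partial>Q n x) / survival n x - (\<integral>y. f y \<partial>\<nu>))\<bar>"
    using S by (simp add: abs_mult)
  also have "survival n x * ((\<integral>y. f y \<partial>Q n x) / survival n x - (\<integral>y. f y \<partial>\<nu>))
      = (\<integral>y. f y \<partial>Q n x) - survival n x * (\<integral>y. f y \<partial>\<nu>)"
    using S by (simp add: right_diff_distrib)
  finally show ?thesis .
qed

text \<open>
  The limit is quasi-stationary: under it the absorption time is geometric. Indeed
  \<open>Q\<^sub>n S\<^bsub>m+1\<^esub> = Q\<^bsub>n+1\<^esub> S\<^sub>m\<close>, and conditioning both sides on survival up to time \<open>n\<close> and letting
  \<open>n\<close> grow gives \<open>\<nu>(S\<^bsub>m+1\<^esub>) = \<nu>(S\<^sub>1) \<nu>(S\<^sub>m)\<close>.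
\<close>

lemma limit_survival_geometric:
  assumes \<nu>: "\<nu> \<in> space (prob_algebra E)"
    and conv: "\<And>x n. x \<in> space E \<Longrightarrow> tv_dist E (conditional (return E x) n) \<nu> \<le> C * \<alpha> ^ n"
    and \<alpha>: "0 < \<alpha>" "\<alpha> < 1" and C: "0 < C"
  shows "(\<integral>x. survival n x \<partial>\<nu>) = (\<integral>x. survival 1 x \<partial>\<nu>) ^ n"
proof -
  have p\<nu>: "prob_space \<nu>" and s\<nu>: "sets \<nu> = sets E" using \<nu> by (auto simp: space_prob_algebra)
  have sp\<nu>: "space \<nu> = space E" by (rule sets_eq_imp_space_eq) fact
  obtain x where x: "x \<in> space E" using prob_space.not_empty[OF p\<nu>] sp\<nu> by auto
  define q where "q = (\<lambda>m. \<integral>x. survival m x \<partial>\<nu>)"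
  have q01: "0 \<le> q m" "q m \<le> 1" for m
  proof -
    show "0 \<le> q m" unfolding q_def by (intro integral_nonneg_AE) simp
    have "q m \<le> (\<integral>x. 1 \<partial>\<nu>)" unfolding q_def
      using survival_le_1 sp\<nu> finite_measure.integrable_const[OF prob_space.finite_measure[OF p\<nu>]]
      by (intro integral_mono integrable_initial[OF \<nu>]) auto
    then show "q m \<le> 1" using prob_space.prob_space[OF p\<nu>] by simp
  qed
  have approx: "\<bar>survival (n + m) x - survival n x * q m\<bar> \<le> survival n x * (C * \<alpha> ^ n)" for n m
    using conditional_approx[OF \<nu> conv x, of "survival m" 1 n] survival_le_1
    by (simp add: survival_add x q_def)
  have step: "q (Suc m) = q 1 * q m" for m
  proof -
    have bound: "\<bar>q (Suc m) - q 1 * q m\<bar> \<le> 3 * C * \<alpha> ^ n" for n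
    proof -
      let ?S = "survival n x" and ?S' = "survival (n + 1) x" and ?d = "C * \<alpha> ^ n"
      have S: "0 < ?S" by (rule survival_pos[OF x])
      have d: "0 \<le> ?d" using C \<alpha> by simp
      have "\<alpha> ^ (n + 1) \<le> \<alpha> ^ n" using \<alpha> by (intro power_decreasing) auto
      then have "?S' * (C * \<alpha> ^ (n + 1)) \<le> ?S * ?d"
        using survival_add_le[OF x, of n 1] C \<alpha> by (intro mult_mono) auto
      then have 1: "\<bar>survival (n + Suc m) x - ?S' * q m\<bar> \<le> ?S * ?d"
        using approx[of "n + 1" m] by simp
      have 2: "\<bar>survival (n + Suc m) x - ?S * q (Suc m)\<bar> \<le> ?S * ?d" by (rule approx)
      have "\<bar>?S' * q m - ?S * q 1 * q m\<bar> = \<bar>?S' - ?S * q 1\<bar> * q m"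
        using q01[of m] by (simp add: left_diff_distrib[symmetric] abs_mult)
      also have "\<dots> \<le> ?S * ?d * 1" using approx[of n 1] q01[of m] S d by (intro mult_mono) auto
      finally have 3: "\<bar>?S' * q m - ?S * q 1 * q m\<bar> \<le> ?S * ?d" by simp
      have "?S * \<bar>q (Suc m) - q 1 * q m\<bar> = \<bar>?S * q (Suc m) - ?S * q 1 * q m\<bar>"
        using S by (simp add: abs_mult right_diff_distrib[symmetric] mult.assoc)
      also have "\<dots> \<le> ?S * ?d + ?S * ?d + ?S * ?d" using 1 2 3 by linarith
      also have "\<dots> = ?S * (3 * C * \<alpha> ^ n)" by simp
      finally show ?thesis using S by simp
    qed
    have "(\<lambda>n. 3 * C * \<alpha> ^ n) \<longlonglongrightarrow> 0"
      using \<alpha> by (intro tendsto_mult_right_zero LIMSEQ_power_zero) auto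
    then have "\<bar>q (Suc m) - q 1 * q m\<bar> \<le> 0"
      by (rule LIMSEQ_le_const) (use bound in auto)
    then show ?thesis by simp
  qed
  have q0: "q 0 = 1"
  proof -
    have "q 0 = (\<integral>x. 1 \<partial>\<nu>)" unfolding q_def
      by (rule Bochner_Integration.integral_cong) (auto simp: sp\<nu> survival_0)
    then show ?thesis using prob_space.prob_space[OF p\<nu>] by simp
  qed
  have "q n = q 1 ^ n" for n
  proof (induction n)
    case (Suc n)
    have "q (Suc n) = q 1 * q 1 ^ n" unfolding step[of n] Suc ..
    then show ?case by simp
  qed (simp add: q0)
  then show ?thesis unfolding q_def .
qed

text \<open>
  One more step of the conditioned process survives with probability \<open>\<theta> + O(\<alpha>\<^sup>n)\<close>, so \<open>S\<^sub>n / \<theta>\<^sup>n\<close>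
  is dominated by a convergent infinite product.
\<close>

lemma survival_upper_bound:
  assumes \<nu>: "\<nu> \<in> space (prob_algebra E)"
    and conv: "\<And>x n. x \<in> space E \<Longrightarrow> tv_dist E (conditional (return E x) n) \<nu> \<le> C * \<alpha> ^ n"
    and \<alpha>: "0 < \<alpha>" "\<alpha> < 1" and C: "0 < C"
    and \<theta>: "\<theta> = (\<integral>x. survival 1 x \<partial>\<nu>)"
    and x: "x \<in> space E"
  shows "survival n x \<le> exp (C / \<theta> / (1 - \<alpha>)) * \<theta> ^ n"
proof -
  have \<theta>0: "0 < \<theta>" unfolding \<theta> by (rule survival_initial_pos[OF \<nu>])
  have "survival n x \<le> exp (\<Sum>k<n. C / \<theta> * \<alpha> ^ k) * \<theta> ^ n"
  proof (induction n)
    case 0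
    show ?case by (simp add: survival_0 x)
  next
    case (Suc n)
    have "\<bar>survival (n + 1) x - survival n x * \<theta>\<bar> \<le> survival n x * (C * \<alpha> ^ n)"
      using conditional_approx[OF \<nu> conv x, of "survival 1" 1 n] survival_le_1
      by (simp add: survival_add[OF x, of n 1] \<theta> del: One_nat_def)
    then have "survival (Suc n) x \<le> survival n x * (\<theta> * (1 + C / \<theta> * \<alpha> ^ n))"
      using \<theta>0 by (simp add: abs_le_iff algebra_simps)
    also have "\<dots> \<le> survival n x * (\<theta> * exp (C / \<theta> * \<alpha> ^ n))"
      using \<theta>0 by (intro mult_left_mono exp_ge_add_one_self) auto
    also have "\<dots> \<le> (exp (\<Sum>k<n. C / \<theta> * \<alpha> ^ k) * \<theta> ^ n) * (\<theta> * exp (C / \<theta> * \<alpha> ^ n))"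
      using Suc \<theta>0 by (intro mult_right_mono) auto
    also have "\<dots> = exp (\<Sum>k<Suc n. C / \<theta> * \<alpha> ^ k) * \<theta> ^ Suc n" by (simp add: exp_add)
    finally show ?case .
  qed
  also have "(\<Sum>k<n. C / \<theta> * \<alpha> ^ k) \<le> C / \<theta> / (1 - \<alpha>)"
  proof -
    have "(\<Sum>k<n. \<alpha> ^ k) = (1 - \<alpha> ^ n) / (1 - \<alpha>)"
      using \<alpha> by (simp add: sum_gp_strict)
    also have "\<dots> \<le> 1 / (1 - \<alpha>)" using \<alpha> by (intro divide_right_mono) auto
    finally have "C / \<theta> * (\<Sum>k<n. \<alpha> ^ k) \<le> C / \<theta> * (1 / (1 - \<alpha>))"
      using C \<theta>0 by (intro mult_left_mono) auto
    then show ?thesis by (simp add: sum_distrib_left)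
  qed
  finally show ?thesis using \<theta>0 by simp
qed

text \<open>
  Discounted occupation sums are the source of both Lyapunov functions: applying the semigroup
  telescopes, so whether the drift is above or below \<open>\<theta>\<close> at a point of \<open>A\<close> or off \<open>A\<close> is decided
  by comparing \<open>Q\<^sub>m(\<cdot>, A)\<close> with \<open>\<theta>\<^sup>m\<close> or with \<open>0\<close>.
\<close>

lemma discounted_occupation_step:
  assumes x: "x \<in> space E" and A: "A \<in> sets E" and \<theta>: "\<theta> \<noteq> 0"
  shows "(\<integral>y. (\<Sum>k<m. (1 / \<theta>) ^ k * measure (Q k y) A) \<partial>Q 1 x)
    = \<theta> * (\<Sum>k<m. (1 / \<theta>) ^ k * measure (Q k x) A) + \<theta> * ((1 / \<theta>) ^ m * measure (Q m x) A - indicator A x)"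
proof -
  define a where "a = (\<lambda>k. (1 / \<theta>) ^ k * measure (Q k x) A)"
  have "(\<integral>y. (\<Sum>k<m. (1 / \<theta>) ^ k * measure (Q k y) A) \<partial>Q 1 x)
      = (\<Sum>k<m. (1 / \<theta>) ^ k * (\<integral>y. measure (Q k y) A \<partial>Q 1 x))"
    using x A by (simp add: Bochner_Integration.integral_sum integrable_measure_Q)
  also have "\<dots> = (\<Sum>k<m. \<theta> * a (Suc k))"
    using chapman_kolmogorov[OF x A, of 1] \<theta> by (intro sum.cong refl) (simp add: a_def)
  also have "\<dots> = \<theta> * (\<Sum>k<m. a k) + \<theta> * (\<Sum>k<m. a (Suc k) - a k)"
    by (simp add: sum_distrib_left sum_subtractf right_diff_distrib)
  also have "(\<Sum>k<m. a (Suc k) - a k) = a m - a 0" by (rule sum_lessThan_telescope)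
  finally show ?thesis by (simp add: a_def initial x A)
qed

text \<open>
  The mass of the infimum of \<open>Q\<^bsub>2n\<^esub>(x, \<cdot>)\<close> over \<open>x \<in> K\<close>. Finite partitions
  take the place of transition densities, whose joint measurability would call for a countably
  generated sigma-algebra. For a finite partition \<open>A\<close> of \<open>K\<close> the function
  \<open>g\<^sub>i(y) = 1\<^sub>K(y) min (\<mu>\<^sub>y(A\<^sub>i)) (\<nu>(A\<^sub>i))\<close>, with \<open>\<mu>\<^sub>y\<close> the conditioned law at time \<open>n\<close>, is bounded by \<open>\<nu>(A\<^sub>i)\<close>.
  The error made when its integral at time \<open>n\<close> is replaced by the \<open>\<nu>\<close>-integral is therefore
  proportional to \<open>\<nu>(A\<^sub>i)\<close>, and the errors add up to a bound that does not depend on the partition.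
\<close>

lemma partition_mass_lower_bound:
  assumes \<nu>: "\<nu> \<in> space (prob_algebra E)"
    and conv: "\<And>x n. x \<in> space E \<Longrightarrow> tv_dist E (conditional (return E x) n) \<nu> \<le> C * \<alpha> ^ n"
    and \<alpha>: "0 < \<alpha>" and C: "0 < C"
    and K: "K \<in> sets E" and s: "0 < s" "\<And>x. x \<in> K \<Longrightarrow> s \<le> survival n x"
    and J: "finite J" "J \<subseteq> K"
    and A: "\<And>i. i \<in> J \<Longrightarrow> A i \<in> sets E" "disjoint_family_on A J" "(\<Union>i\<in>J. A i) = K"
  shows "s ^ 2 * (measure \<nu> K * (measure \<nu> K - 2 * (C * \<alpha> ^ n))) \<le> (\<Sum>i\<in>J. measure (Q (n + n) i) (A i))"
proof -
  have p\<nu>: "prob_space \<nu>" and s\<nu>: "sets \<nu> = sets E" using \<nu> by (auto simp: space_prob_algebra)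
  interpret \<nu>: prob_space \<nu> by fact
  have sp\<nu>: "space \<nu> = space E" by (rule sets_eq_imp_space_eq) fact
  have KE: "K \<subseteq> space E" using sets.sets_into_space[OF K] .
  define \<delta> where "\<delta> = C * \<alpha> ^ n"
  have \<delta>0: "0 \<le> \<delta>" using C \<alpha> by (simp add: \<delta>_def)
  define p where "p = measure \<nu> K"
  define g where "g = (\<lambda>i y. indicator K y * min (measure (Q n y) (A i) / survival n y) (measure \<nu> (A i)))"
  have g_meas: "g i \<in> borel_measurable E" if "i \<in> J" for i
    unfolding g_def using K A(1)[OF that] by measurable
  have g_bound: "0 \<le> g i y" "g i y \<le> measure \<nu> (A i)" for i y
    by (auto simp: g_def indicator_def)
  then have g_abs: "\<bar>g i y\<bar> \<le> measure \<nu> (A i)" for i y by simp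
  have g_int: "integrable \<nu> (g i)" if "i \<in> J" for i
    by (rule integrable_bounded[OF \<nu>.finite_measure_axioms s\<nu> g_meas[OF that] g_abs])
  have additive: "(\<Sum>i\<in>J'. measure m (A i)) = measure m (\<Union>i\<in>J'. A i)"
    if "J' \<subseteq> J" "finite_measure m" "sets m = sets E" for J' and m :: "'a measure"
    using that A finite_subset[OF that(1) J(1)]
    by (intro finite_measure.finite_measure_finite_Union[symmetric] disjoint_family_on_mono[OF _ A(2)]) auto
  have p: "(\<Sum>i\<in>J. measure \<nu> (A i)) = p"
    using additive[OF _ \<nu>.finite_measure_axioms s\<nu>, of J] A(3) by (simp add: p_def)
  have overlap: "indicator K y * (p - \<delta>) \<le> (\<Sum>i\<in>J. g i y)" if y: "y \<in> space E" for y
  proof (cases "y \<in> K")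
    case True
    define \<mu> where "\<mu> = conditional (return E y) n"
    have \<mu>: "\<mu> \<in> space (prob_algebra E)"
      unfolding \<mu>_def by (rule conditional_in_prob_algebra[OF return_in_prob_algebra[OF y]])
    then have p\<mu>: "prob_space \<mu>" and s\<mu>: "sets \<mu> = sets E" by (auto simp: space_prob_algebra)
    have sp\<mu>: "space \<mu> = space E" by (rule sets_eq_imp_space_eq) fact
    have m\<mu>: "measure \<mu> (A i) = measure (Q n y) (A i) / survival n y" if "i \<in> J" for i
      unfolding \<mu>_def by (rule measure_conditional_return[OF y A(1)[OF that]])
    define J' where "J' = {i \<in> J. measure \<mu> (A i) < measure \<nu> (A i)}"
    define B where "B = (\<Union>i\<in>J'. A i)"
    have B: "B \<in> sets E" unfolding B_def using J A(1) by (intro sets.finite_UN) (auto simp: J'_def)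
    have "\<bar>(\<integral>z. indicator B z \<partial>\<mu>) - (\<integral>z. indicator B z \<partial>\<nu>)\<bar> \<le> 1 * tv_dist E \<mu> \<nu>"
      using B by (intro integral_diff_le_tv_dist[OF \<mu> \<nu>]) auto
    moreover have "B \<inter> space E = B" using sets.sets_into_space[OF B] by auto
    moreover have "tv_dist E \<mu> \<nu> \<le> \<delta>" using conv[OF y, of n] by (simp add: \<mu>_def \<delta>_def)
    ultimately have deficit: "measure \<nu> B - measure \<mu> B \<le> \<delta>"
      by (simp add: sp\<mu> sp\<nu> abs_le_iff)
    have "(\<Sum>i\<in>J. g i y) = (\<Sum>i\<in>J. measure \<nu> (A i) - (if i \<in> J' then measure \<nu> (A i) - measure \<mu> (A i) else 0))"
      using True by (intro sum.cong refl) (auto simp: g_def J'_def m\<mu>)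
    also have "\<dots> = p - (\<Sum>i\<in>J'. measure \<nu> (A i) - measure \<mu> (A i))"
      using J(1) by (simp add: sum_subtractf p flip: sum.inter_filter) (simp add: J'_def sum.inter_filter)
    also have "(\<Sum>i\<in>J'. measure \<nu> (A i) - measure \<mu> (A i)) = measure \<nu> B - measure \<mu> B"
      unfolding B_def sum_subtractf
      using additive[of J' \<nu>] additive[of J' \<mu>] \<nu>.finite_measure_axioms s\<nu> s\<mu> prob_space.finite_measure[OF p\<mu>]
      by (simp add: J'_def)
    finally show ?thesis using True deficit by simp
  next
    case False
    then show ?thesis using g_bound by (simp add: sum_nonneg)
  qed
  have "p * (p - \<delta>) = (\<integral>y. indicator K y * (p - \<delta>) \<partial>\<nu>)"
    using K KE by (simp add: s\<nu> sp\<nu> p_def Int_absorb2)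
  also have "\<dots> \<le> (\<integral>y. (\<Sum>i\<in>J. g i y) \<partial>\<nu>)"
  proof (rule integral_mono)
    show "integrable \<nu> (\<lambda>y. indicator K y * (p - \<delta>))"
      by (rule integrable_bounded[OF \<nu>.finite_measure_axioms s\<nu>, of _ "\<bar>p - \<delta>\<bar>"])
        (use K in \<open>auto simp: indicator_def\<close>)
  qed (use g_int overlap sp\<nu> in auto)
  also have "\<dots> = (\<Sum>i\<in>J. \<integral>y. g i y \<partial>\<nu>)"
    using g_int by (rule Bochner_Integration.integral_sum)
  finally have total: "p * (p - \<delta>) \<le> (\<Sum>i\<in>J. \<integral>y. g i y \<partial>\<nu>)" .
  have each: "s ^ 2 * ((\<integral>y. g i y \<partial>\<nu>) - measure \<nu> (A i) * \<delta>) \<le> measure (Q (n + n) i) (A i)"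
    if i: "i \<in> J" for i
  proof (cases "(\<integral>y. g i y \<partial>\<nu>) - measure \<nu> (A i) * \<delta> \<le> 0")
    case True
    then have "s ^ 2 * ((\<integral>y. g i y \<partial>\<nu>) - measure \<nu> (A i) * \<delta>) \<le> 0"
      by (intro mult_nonneg_nonpos) auto
    then show ?thesis by (rule order_trans) simp
  next
    case False
    have iK: "i \<in> K" and iE: "i \<in> space E" using i J KE by auto
    have "s ^ 2 * ((\<integral>y. g i y \<partial>\<nu>) - measure \<nu> (A i) * \<delta>)
        \<le> s * (survival n i * ((\<integral>y. g i y \<partial>\<nu>) - measure \<nu> (A i) * \<delta>))"
      unfolding power2_eq_square mult.assoc
      using False s(1) s(2)[OF iK] by (intro mult_left_mono mult_right_mono) auto
    also have "\<dots> \<le> s * (\<integral>y. g i y \<partial>Q n i)"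
      using conditional_approx[OF \<nu> conv iE g_meas[OF i] g_abs measure_nonneg, of n] s(1)
      by (intro mult_left_mono) (auto simp: abs_le_iff \<delta>_def right_diff_distrib)
    also have "\<dots> = (\<integral>y. s * g i y \<partial>Q n i)" by simp
    also have "\<dots> \<le> (\<integral>y. measure (Q n y) (A i) \<partial>Q n i)"
    proof (rule integral_mono)
      show "integrable (Q n i) (\<lambda>y. s * g i y)"
        by (intro integrable_mult_right integrable_Q[OF iE g_meas[OF i] g_abs])
      show "integrable (Q n i) (\<lambda>y. measure (Q n y) (A i))"
        by (rule integrable_measure_Q[OF iE A(1)[OF i]])
      show "s * g i y \<le> measure (Q n y) (A i)" if "y \<in> space (Q n i)" for y
      proof (cases "y \<in> K")
        case True
        have "s * g i y \<le> survival n y * (measure (Q n y) (A i) / survival n y)"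
          using True s by (intro mult_mono) (auto simp: g_def)
        then show ?thesis using survival_pos[of y n] True KE by auto
      qed (simp add: g_def)
    qed
    also have "\<dots> = measure (Q (n + n) i) (A i)" by (simp add: chapman_kolmogorov iE A(1)[OF i])
    finally show ?thesis .
  qed
  have "s ^ 2 * (p * (p - 2 * \<delta>)) = s ^ 2 * (p * (p - \<delta>) - p * \<delta>)" by (simp add: algebra_simps)
  also have "\<dots> \<le> s ^ 2 * ((\<Sum>i\<in>J. \<integral>y. g i y \<partial>\<nu>) - (\<Sum>i\<in>J. measure \<nu> (A i)) * \<delta>)"
    using total by (intro mult_left_mono) (auto simp: p)
  also have "\<dots> = (\<Sum>i\<in>J. s ^ 2 * ((\<integral>y. g i y \<partial>\<nu>) - measure \<nu> (A i) * \<delta>))"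
    by (simp only: sum_distrib_right sum_subtractf[symmetric] sum_distrib_left)
  also have "\<dots> \<le> (\<Sum>i\<in>J. measure (Q (n + n) i) (A i))" by (rule sum_mono) (rule each)
  finally show ?thesis by (simp add: p_def \<delta>_def)
qed

text \<open>
  A common minorant on \<open>K\<close> is not immediate from convergence in total variation, which bounds each
  \<open>Q\<^sub>n(x, \<cdot>)\<close> from below only up to an additive error that is larger than \<open>\<nu>(A)\<close> on small sets \<open>A\<close>.
  Two rounds of \<open>n\<close> steps remove the error, and the minorant is the infimum measure.
\<close>

lemma small_set_minorization:
  assumes \<nu>: "\<nu> \<in> space (prob_algebra E)"
    and conv: "\<And>x n. x \<in> space E \<Longrightarrow> tv_dist E (conditional (return E x) n) \<nu> \<le> C * \<alpha> ^ n"
    and \<alpha>: "0 < \<alpha>" and C: "0 < C"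
    and K: "K \<in> sets E" "K \<noteq> {}" and s: "0 < s" "\<And>x. x \<in> K \<Longrightarrow> s \<le> survival n x"
    and n: "2 * (C * \<alpha> ^ n) < measure \<nu> K"
  shows "\<exists>c>0. \<exists>\<kappa>\<in>space (prob_algebra (restrict_space E K)). \<forall>x\<in>K. \<forall>A\<in>sets E.
    c * measure \<kappa> (A \<inter> K) \<le> measure (Q (n + n) x) A"
proof -
  have KE: "K \<subseteq> space E" using sets.sets_into_space[OF K(1)] .
  define R where "R = restrict_space E K"
  have spR: "space R = K" using KE by (auto simp: R_def space_restrict_space)
  have setsR: "B \<in> sets R \<longleftrightarrow> B \<in> sets E \<and> B \<subseteq> K" for B
    unfolding R_def using K(1) by (subst sets_restrict_space_iff) auto
  define c where "c = s ^ 2 * (measure \<nu> K * (measure \<nu> K - 2 * (C * \<alpha> ^ n)))"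
  have "0 \<le> 2 * (C * \<alpha> ^ n)" using C \<alpha> by simp
  then have "0 < measure \<nu> K" using n by linarith
  then have c: "0 < c" unfolding c_def using s n by simp
  define m where "m = (\<lambda>x. restrict_space (Q (n + n) x) K)"
  have m_fin: "finite_measure (m x)" and m_sets: "sets (m x) = sets R" if "x \<in> K" for x
  proof -
    have x: "x \<in> space E" using that KE by auto
    show "finite_measure (m x)"
      unfolding m_def using K(1) x by (intro finite_measure_restrict_space finite_Q) (auto simp: sets_Q)
    show "sets (m x) = sets R"
      unfolding m_def R_def using sets_Q[OF x] by (simp add: sets_restrict_space)
  qed
  have m_measure: "measure (m x) B = measure (Q (n + n) x) B" if "x \<in> K" "B \<subseteq> K" for x B
    unfolding m_def using K(1) that KE
    by (intro measure_restrict_space) (auto simp: space_Q sets_Q Int_absorb2 subset_iff)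
  have "\<exists>\<kappa>. sets \<kappa> = sets R \<and> finite_measure \<kappa> \<and> c \<le> measure \<kappa> (space R) \<and>
      (\<forall>x\<in>K. \<forall>A\<in>sets R. measure \<kappa> A \<le> measure (m x) A)"
  proof (rule infimum_measure[OF K(2) m_fin m_sets])
    fix j assume j: "simple_function R j" "j ` space R \<subseteq> K"
    define A where "A = (\<lambda>i. j -` {i} \<inter> K)"
    have A: "A i \<in> sets R" for i
      using simple_functionD(2)[OF j(1), of "{i}"] by (simp add: A_def spR)
    have "c \<le> (\<Sum>i\<in>j ` K. measure (Q (n + n) i) (A i))"
      unfolding c_def
    proof (rule partition_mass_lower_bound[OF \<nu> conv \<alpha> C K(1) s])
      show "finite (j ` K)" using simple_functionD(1)[OF j(1)] by (simp add: spR)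
    qed (use j(2) A in \<open>auto simp: spR setsR A_def disjoint_family_on_def\<close>)
    also have "\<dots> = glued_mass R m j (space R)"
      unfolding glued_mass_def spR
      using j(2) by (intro sum.cong refl) (auto simp: A_def spR m_measure Int_ac)
    finally show "c \<le> glued_mass R m j (space R)" .
  qed
  then obtain \<kappa> where \<kappa>: "sets \<kappa> = sets R" "finite_measure \<kappa>" "c \<le> measure \<kappa> (space R)"
    "\<And>x A. x \<in> K \<Longrightarrow> A \<in> sets R \<Longrightarrow> measure \<kappa> A \<le> measure (m x) A" by blast
  interpret \<kappa>: finite_measure \<kappa> by fact
  have sp\<kappa>: "space \<kappa> = K" using sets_eq_imp_space_eq[OF \<kappa>(1)] spR by simp
  have mass: "0 < measure \<kappa> K" using \<kappa>(3) c by (simp add: spR)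
  have em: "emeasure \<kappa> K \<noteq> 0" using mass by (simp add: \<kappa>.emeasure_eq_measure)
  define \<kappa>' where "\<kappa>' = uniform_measure \<kappa> K"
  have "prob_space \<kappa>'"
    unfolding \<kappa>'_def by (rule prob_space_uniform_measure[OF em]) (simp add: \<kappa>.emeasure_eq_measure)
  then have "\<kappa>' \<in> space (prob_algebra R)"
    using \<kappa>(1) by (simp add: space_prob_algebra \<kappa>'_def)
  moreover have "measure \<kappa> K * measure \<kappa>' (A \<inter> K) \<le> measure (Q (n + n) x) A"
    if x: "x \<in> K" and A: "A \<in> sets E" for x A
  proof -
    have AK: "A \<inter> K \<in> sets R" using A K(1) by (auto simp: setsR)
    have "measure \<kappa>' (A \<inter> K) = measure \<kappa> (K \<inter> (A \<inter> K)) / measure \<kappa> K"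
      unfolding \<kappa>'_def
      by (rule measure_uniform_measure[OF em]) (use AK \<kappa>(1) in \<open>auto simp: \<kappa>.emeasure_eq_measure\<close>)
    also have "K \<inter> (A \<inter> K) = A \<inter> K" by auto
    finally have "measure \<kappa> K * measure \<kappa>' (A \<inter> K) = measure \<kappa> (A \<inter> K)" using mass by simp
    also have "\<dots> \<le> measure (Q (n + n) x) (A \<inter> K)"
      using \<kappa>(4)[OF x AK] by (simp add: m_measure x)
    also have "\<dots> \<le> measure (Q (n + n) x) A"
      using x KE A by (intro finite_measure.finite_measure_mono finite_Q) (auto simp: sets_Q)
    finally show ?thesis .
  qed
  ultimately show ?thesis using mass unfolding R_def by blast
qed

text \<open>
  With \<open>\<theta>\<close> the survival rate of the limit, \<open>\<theta>\<^sub>1 = \<theta> / 2\<close> and \<open>\<theta>\<^sub>2 = 3 \<theta> / 4\<close>, take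
  \<open>K = {S\<^sub>N \<ge> \<theta>\<^sub>1\<^sup>N}\<close>. On the complement \<open>S\<^sub>N\<close> is below \<open>\<theta>\<^sub>1\<^sup>N\<close>, which makes the discounted
  occupation sum of \<open>E\<close> a function \<open>\<phi>\<^sub>1\<close> of drift \<open>\<theta>\<^sub>1\<close>. On \<open>K\<close> survival is of the exact order
  \<open>\<theta>\<^sup>n\<close>, so \<open>Q\<^sub>m(\<cdot>, K)\<close> exceeds \<open>\<theta>\<^sub>2\<^sup>m\<close> there for large \<open>m\<close> and the discounted occupation sum of
  \<open>K\<close> has drift \<open>\<theta>\<^sub>2\<close>.
\<close>

theorem exponential_convergence_imp_drift_criterion:
  assumes \<nu>: "\<nu> \<in> space (prob_algebra E)"
    and conv: "\<And>x n. x \<in> space E \<Longrightarrow> tv_dist E (conditional (return E x) n) \<nu> \<le> C * \<alpha> ^ n"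
    and \<alpha>: "0 < \<alpha>" "\<alpha> < 1" and C: "0 < C"
  shows "\<exists>n\<^sub>1 \<theta>\<^sub>1 \<theta>\<^sub>2 c\<^sub>1 c\<^sub>2 c\<^sub>3 \<phi>\<^sub>1 \<phi>\<^sub>2 K \<kappa>. drift_criterion n\<^sub>1 \<theta>\<^sub>1 \<theta>\<^sub>2 c\<^sub>1 c\<^sub>2 c\<^sub>3 \<phi>\<^sub>1 \<phi>\<^sub>2 K \<kappa> \<and>
    (\<exists>m>0. \<exists>\<delta>>0. \<forall>x\<in>space E. \<delta> * survival m x \<le> measure (Q m x) K)"
proof -
  have p\<nu>: "prob_space \<nu>" and s\<nu>: "sets \<nu> = sets E" using \<nu> by (auto simp: space_prob_algebra)
  interpret \<nu>: prob_space \<nu> by fact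
  have sp\<nu>: "space \<nu> = space E" by (rule sets_eq_imp_space_eq) fact
  define \<theta> where "\<theta> = (\<integral>x. survival 1 x \<partial>\<nu>)"
  have \<theta>0: "0 < \<theta>" unfolding \<theta>_def by (rule survival_initial_pos[OF \<nu>])
  have "\<theta> \<le> (\<integral>x. 1 \<partial>\<nu>)"
    unfolding \<theta>_def using survival_le_1 sp\<nu> by (intro integral_mono integrable_initial[OF \<nu>]) auto
  then have \<theta>1: "\<theta> \<le> 1" by (simp add: \<nu>.prob_space)
  have geometric: "(\<integral>x. survival n x \<partial>\<nu>) = \<theta> ^ n" for n
    unfolding \<theta>_def by (rule limit_survival_geometric[OF \<nu> conv \<alpha> C])
  define B where "B = exp (C / \<theta> / (1 - \<alpha>))"
  have B: "0 < B" by (simp add: B_def)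
  have upper: "survival n x \<le> B * \<theta> ^ n" if "x \<in> space E" for n x
    unfolding B_def by (rule survival_upper_bound[OF \<nu> conv \<alpha> C \<theta>_def that])
  have eventually_small: "\<exists>n0. \<forall>n\<ge>n0. C * \<alpha> ^ n \<le> r" if "0 < r" for r
  proof -
    have "(\<lambda>n. C * \<alpha> ^ n) \<longlonglongrightarrow> 0"
      using \<alpha> by (intro tendsto_mult_right_zero LIMSEQ_power_zero) auto
    from LIMSEQ_D[OF this that] show ?thesis by (auto simp: abs_less_iff intro: less_imp_le)
  qed
  \<comment> \<open>\<open>N\<close> is a time after which the survival probability is known up to a factor \<open>1/2\<close>, uniformly.\<close>
  obtain n0 where n0: "\<And>n. n \<ge> n0 \<Longrightarrow> C * \<alpha> ^ n \<le> 1 / (2 * B)"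
    using eventually_small[of "1 / (2 * B)"] B by auto
  define N where "N = Suc n0"
  have N: "C * \<alpha> ^ N * B \<le> 1 / 2"
    using n0[of N] B by (simp add: N_def field_simps)

  define \<theta>\<^sub>1 where "\<theta>\<^sub>1 = \<theta> / 2"
  define \<theta>\<^sub>2 where "\<theta>\<^sub>2 = 3 / 4 * \<theta>"
  have \<theta>\<^sub>1: "0 < \<theta>\<^sub>1" and \<theta>\<^sub>2: "0 < \<theta>\<^sub>2" and \<theta>12: "\<theta>\<^sub>1 < \<theta>\<^sub>2" using \<theta>0 by (simp_all add: \<theta>\<^sub>1_def \<theta>\<^sub>2_def)
  define K where "K = {x \<in> space E. \<theta>\<^sub>1 ^ N \<le> survival N x}"
  have K: "K \<in> sets E" unfolding K_def by measurable
  have KE: "K \<subseteq> space E" by (auto simp: K_def)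
  define p where "p = measure \<nu> K"
  have p: "0 < p"
  proof -
    have "\<theta> ^ N = (\<integral>x. survival N x \<partial>\<nu>)" by (simp add: geometric)
    also have "\<dots> \<le> (\<integral>x. \<theta>\<^sub>1 ^ N + indicator K x \<partial>\<nu>)"
    proof (rule integral_mono)
      show "integrable \<nu> (\<lambda>x. \<theta>\<^sub>1 ^ N + indicator K x)"
        using K by (intro Bochner_Integration.integrable_add) (auto simp: s\<nu> \<nu>.emeasure_eq_measure)
      show "survival N x \<le> \<theta>\<^sub>1 ^ N + indicator K x" if "x \<in> space \<nu>" for x
      proof -
        have "0 \<le> \<theta>\<^sub>1 ^ N" using \<theta>\<^sub>1 by simp
        then show ?thesis
          using that survival_le_1[of x N] by (cases "x \<in> K") (auto simp: K_def sp\<nu>)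
      qed
    qed (rule integrable_initial[OF \<nu>], simp)
    also have "\<dots> = \<theta>\<^sub>1 ^ N + p"
      using K KE by (subst Bochner_Integration.integral_add)
        (auto simp: s\<nu> sp\<nu> p_def \<nu>.prob_space[unfolded sp\<nu>] \<nu>.emeasure_eq_measure Int_absorb2)
    finally have "\<theta> ^ N - \<theta>\<^sub>1 ^ N \<le> p" by simp
    moreover have "\<theta>\<^sub>1 ^ N < \<theta> ^ N"
      using \<theta>0 by (intro power_strict_mono) (auto simp: \<theta>\<^sub>1_def N_def)
    ultimately show ?thesis by simp
  qed
  have K_ne: "K \<noteq> {}" using p by (auto simp: p_def)

  \<comment> \<open>The set \<open>K\<close> is defined by survival up to time \<open>N\<close> only; the choice of \<open>N\<close> extends the lower
     bound to all times.\<close>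
  define \<epsilon> where "\<epsilon> = \<theta>\<^sub>1 ^ N / 2"
  have \<epsilon>: "0 < \<epsilon>" and \<epsilon>_le: "\<epsilon> \<le> \<theta>\<^sub>1 ^ N" using \<theta>\<^sub>1 by (simp_all add: \<epsilon>_def)
  have lower: "\<epsilon> * \<theta> ^ n \<le> survival n x" if x: "x \<in> K" for n x
  proof -
    have xE: "x \<in> space E" and SN: "\<theta>\<^sub>1 ^ N \<le> survival N x" using x by (auto simp: K_def)
    show ?thesis
    proof (cases "N \<le> n")
      case True
      define m where "m = n - N"
      have n: "n = N + m" using True by (simp add: m_def)
      have "\<bar>survival n x - survival N x * \<theta> ^ m\<bar> \<le> survival N x * (B * \<theta> ^ m * (C * \<alpha> ^ N))"
        using conditional_approx[OF \<nu> conv xE, of "survival m" "B * \<theta> ^ m" N] upper B \<theta>0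
        by (simp add: n survival_add xE geometric)
      then have "survival N x * (\<theta> ^ m * (1 - C * \<alpha> ^ N * B)) \<le> survival n x"
        by (simp add: abs_le_iff algebra_simps)
      moreover have "\<theta>\<^sub>1 ^ N * (\<theta> ^ m * (1 / 2)) \<le> survival N x * (\<theta> ^ m * (1 - C * \<alpha> ^ N * B))"
        using SN N \<theta>0 by (intro mult_mono) auto
      moreover have "\<epsilon> * \<theta> ^ n \<le> \<epsilon> * \<theta> ^ m"
        using \<epsilon> \<theta>0 \<theta>1 by (intro mult_left_mono power_decreasing) (auto simp: n)
      ultimately show ?thesis by (simp add: \<epsilon>_def)
    next
      case False
      have "\<epsilon> * \<theta> ^ n \<le> \<epsilon> * 1"
        using \<epsilon> \<theta>0 \<theta>1 by (intro mult_left_mono power_le_one) auto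
      also have "\<dots> \<le> survival N x" using SN \<epsilon>_le by linarith
      also have "\<dots> \<le> survival n x" using False by (intro survival_antimono[OF xE]) auto
      finally show ?thesis .
    qed
  qed

  obtain n\<^sub>4 where n\<^sub>4: "\<And>n. n \<ge> n\<^sub>4 \<Longrightarrow> C * \<alpha> ^ n \<le> p / 4"
    using eventually_small[of "p / 4"] p by auto
  have return: "p / 2 * survival n x \<le> measure (Q n x) K" if x: "x \<in> space E" and n: "n \<ge> n\<^sub>4" for n x
  proof -
    have i: "(\<integral>y. indicator K y \<partial>Q n x) = measure (Q n x) K" "(\<integral>y. indicator K y \<partial>\<nu>) = p"
      using KE by (simp_all add: space_Q x sp\<nu> p_def Int_absorb2)
    have "\<bar>measure (Q n x) K - survival n x * p\<bar> \<le> survival n x * (1 * (C * \<alpha> ^ n))"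
      unfolding i[symmetric] using K by (intro conditional_approx[OF \<nu> conv x]) auto
    also have "\<dots> \<le> survival n x * (p / 4)" using n\<^sub>4[OF n] by (intro mult_left_mono) auto
    finally have "survival n x * p - survival n x * (p / 4) \<le> measure (Q n x) K" by linarith
    moreover have "0 \<le> survival n x * p" using p by simp
    ultimately show ?thesis by (simp add: field_simps)
  qed

  have "\<exists>c>0. \<exists>\<kappa>\<in>space (prob_algebra (restrict_space E K)). \<forall>x\<in>K. \<forall>A\<in>sets E.
      c * measure \<kappa> (A \<inter> K) \<le> measure (Q (Suc n\<^sub>4 + Suc n\<^sub>4) x) A"
  proof (rule small_set_minorization[OF \<nu> conv \<alpha>(1) C K K_ne _ lower])
    show "0 < \<epsilon> * \<theta> ^ Suc n\<^sub>4" using \<epsilon> \<theta>0 by simp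
    show "2 * (C * \<alpha> ^ Suc n\<^sub>4) < measure \<nu> K" using n\<^sub>4[of "Suc n\<^sub>4"] p by (simp add: p_def)
  qed
  then obtain c\<^sub>1 \<kappa> where c\<^sub>1: "0 < c\<^sub>1" and \<kappa>: "\<kappa> \<in> space (prob_algebra (restrict_space E K))"
    and E1: "\<And>x A. x \<in> K \<Longrightarrow> A \<in> sets E \<Longrightarrow>
      c\<^sub>1 * measure \<kappa> (A \<inter> K) \<le> measure (Q (Suc n\<^sub>4 + Suc n\<^sub>4) x) A"
    by blast

  define \<phi>\<^sub>1 where "\<phi>\<^sub>1 = (\<lambda>x. \<Sum>k<N. (1 / \<theta>\<^sub>1) ^ k * survival k x)"
  have \<phi>\<^sub>1_meas: "\<phi>\<^sub>1 \<in> borel_measurable E" unfolding \<phi>\<^sub>1_def by measurable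
  have \<phi>\<^sub>1_ge: "1 \<le> \<phi>\<^sub>1 x" if x: "x \<in> space E" for x
  proof -
    have "(1 / \<theta>\<^sub>1) ^ 0 * survival 0 x \<le> \<phi>\<^sub>1 x"
      unfolding \<phi>\<^sub>1_def using \<theta>\<^sub>1 by (intro member_le_sum) (auto simp: N_def)
    then show ?thesis by (simp add: survival_0 x)
  qed
  have \<phi>\<^sub>1_le: "\<phi>\<^sub>1 x \<le> (\<Sum>k<N. (1 / \<theta>\<^sub>1) ^ k)" if x: "x \<in> space E" for x
    unfolding \<phi>\<^sub>1_def using survival_le_1[OF x] \<theta>\<^sub>1 by (intro sum_mono) (simp add: mult_left_le)
  have \<phi>\<^sub>1_drift: "(\<integral>y. \<phi>\<^sub>1 y \<partial>Q 1 x) \<le> \<theta>\<^sub>1 * \<phi>\<^sub>1 x + \<theta>\<^sub>1 * (1 / \<theta>\<^sub>1) ^ N * indicator K x"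
    if x: "x \<in> space E" for x
  proof -
    have "(\<integral>y. \<phi>\<^sub>1 y \<partial>Q 1 x) = \<theta>\<^sub>1 * \<phi>\<^sub>1 x + \<theta>\<^sub>1 * ((1 / \<theta>\<^sub>1) ^ N * survival N x - 1)"
      unfolding \<phi>\<^sub>1_def using discounted_occupation_step[OF x sets.top, of \<theta>\<^sub>1 N] \<theta>\<^sub>1 x by simp
    moreover have "\<theta>\<^sub>1 * ((1 / \<theta>\<^sub>1) ^ N * survival N x - 1) \<le> \<theta>\<^sub>1 * ((1 / \<theta>\<^sub>1) ^ N * indicator K x)"
    proof (rule mult_left_mono)
      show "(1 / \<theta>\<^sub>1) ^ N * survival N x - 1 \<le> (1 / \<theta>\<^sub>1) ^ N * indicator K x"
      proof (cases "x \<in> K")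
        case True
        have "(1 / \<theta>\<^sub>1) ^ N * survival N x \<le> (1 / \<theta>\<^sub>1) ^ N * 1"
          using survival_le_1[OF x] \<theta>\<^sub>1 by (intro mult_left_mono) auto
        then show ?thesis using True by simp
      next
        case False
        then have "survival N x \<le> \<theta>\<^sub>1 ^ N" using x by (auto simp: K_def)
        then have "(1 / \<theta>\<^sub>1) ^ N * survival N x \<le> (1 / \<theta>\<^sub>1) ^ N * \<theta>\<^sub>1 ^ N"
          using \<theta>\<^sub>1 by (intro mult_left_mono) auto
        also have "\<dots> = 1" using \<theta>\<^sub>1 by (simp add: power_mult_distrib[symmetric])
        finally show ?thesis using False by simp
      qed
    qed (use \<theta>\<^sub>1 in simp)
    ultimately show ?thesis by simp
  qed

  \<comment> \<open>\<open>Q\<^sub>m(\<cdot>, K)\<close> is of order \<open>\<theta>\<^sup>m\<close> on \<open>K\<close>, so it beats \<open>\<theta>\<^sub>2\<^sup>m\<close> once \<open>(3/4)\<^sup>m\<close> is below the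
     implied constant.\<close>
  obtain k where k: "(3 / 4 :: real) ^ k < \<epsilon> * (p / 2)"
    using real_arch_pow_inv[of "\<epsilon> * (p / 2)" "3 / 4"] \<epsilon> p by auto
  define m where "m = Suc (max k n\<^sub>4)"
  have visit: "\<theta>\<^sub>2 ^ m \<le> measure (Q m x) K" if x: "x \<in> K" for x
  proof -
    have "(3 / 4 :: real) ^ m \<le> (3 / 4) ^ k" by (rule power_decreasing) (auto simp: m_def)
    then have "(3 / 4) ^ m \<le> \<epsilon> * (p / 2)" using k by linarith
    then have "\<theta>\<^sub>2 ^ m \<le> \<epsilon> * (p / 2) * \<theta> ^ m"
      unfolding \<theta>\<^sub>2_def power_mult_distrib by (rule mult_right_mono) (use \<theta>0 in simp)
    also have "\<dots> = p / 2 * (\<epsilon> * \<theta> ^ m)" by simp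
    also have "\<dots> \<le> p / 2 * survival m x" using lower[OF x] p by (intro mult_left_mono) auto
    also have "\<dots> \<le> measure (Q m x) K" using x KE by (intro return) (auto simp: m_def)
    finally show ?thesis .
  qed
  define G where "G = (\<Sum>k<m. (1 / \<theta>\<^sub>2) ^ k)"
  have G: "0 < G" unfolding G_def using \<theta>\<^sub>2 by (intro sum_pos) (auto simp: m_def)
  define \<psi> where "\<psi> = (\<lambda>x. \<Sum>k<m. (1 / \<theta>\<^sub>2) ^ k * measure (Q k x) K)"
  define \<phi>\<^sub>2 where "\<phi>\<^sub>2 = (\<lambda>x. \<psi> x / G)"
  have \<phi>\<^sub>2_meas: "\<phi>\<^sub>2 \<in> borel_measurable E" unfolding \<phi>\<^sub>2_def \<psi>_def using K by measurable
  have \<phi>\<^sub>2_nonneg: "0 \<le> \<phi>\<^sub>2 x" for x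
    unfolding \<phi>\<^sub>2_def \<psi>_def using G \<theta>\<^sub>2 by (intro divide_nonneg_pos sum_nonneg) auto
  have \<phi>\<^sub>2_le: "\<phi>\<^sub>2 x \<le> 1" if x: "x \<in> space E" for x
  proof -
    have "\<psi> x \<le> G"
      unfolding \<psi>_def G_def using Q_le_1[OF x] \<theta>\<^sub>2 by (intro sum_mono) (simp add: mult_left_le)
    then show ?thesis using G by (simp add: \<phi>\<^sub>2_def)
  qed
  have \<phi>\<^sub>2_K: "1 / G \<le> \<phi>\<^sub>2 x" if x: "x \<in> K" for x
  proof -
    have "(1 / \<theta>\<^sub>2) ^ 0 * measure (Q 0 x) K \<le> \<psi> x"
      unfolding \<psi>_def using \<theta>\<^sub>2 by (intro member_le_sum) (auto simp: m_def)
    moreover have "x \<in> space E" using x KE by auto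
    ultimately have "1 \<le> \<psi> x" using x K by (simp add: initial)
    then show ?thesis using G by (simp add: \<phi>\<^sub>2_def divide_right_mono)
  qed
  have \<phi>\<^sub>2_drift: "\<theta>\<^sub>2 * \<phi>\<^sub>2 x \<le> (\<integral>y. \<phi>\<^sub>2 y \<partial>Q 1 x)" if x: "x \<in> space E" for x
  proof -
    have "(\<integral>y. \<psi> y \<partial>Q 1 x) = \<theta>\<^sub>2 * \<psi> x + \<theta>\<^sub>2 * ((1 / \<theta>\<^sub>2) ^ m * measure (Q m x) K - indicator K x)"
      unfolding \<psi>_def using \<theta>\<^sub>2 by (intro discounted_occupation_step[OF x K]) simp
    moreover have "0 \<le> (1 / \<theta>\<^sub>2) ^ m * measure (Q m x) K - indicator K x"
    proof (cases "x \<in> K")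
      case True
      have "1 = (1 / \<theta>\<^sub>2) ^ m * \<theta>\<^sub>2 ^ m" using \<theta>\<^sub>2 by (simp add: power_mult_distrib[symmetric])
      also have "\<dots> \<le> (1 / \<theta>\<^sub>2) ^ m * measure (Q m x) K"
        using visit[OF True] \<theta>\<^sub>2 by (intro mult_left_mono) auto
      finally show ?thesis using True by simp
    qed (use \<theta>\<^sub>2 in simp)
    then have "0 \<le> \<theta>\<^sub>2 * ((1 / \<theta>\<^sub>2) ^ m * measure (Q m x) K - indicator K x)" using \<theta>\<^sub>2 by simp
    ultimately have "\<theta>\<^sub>2 * \<psi> x \<le> (\<integral>y. \<psi> y \<partial>Q 1 x)" by linarith
    then show ?thesis using G by (simp add: \<phi>\<^sub>2_def divide_right_mono)
  qed

  have harnack: "survival n x \<le> B / \<epsilon> * survival n y" if "x \<in> K" "y \<in> K" for n x y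
  proof -
    have "survival n x \<le> B / \<epsilon> * (\<epsilon> * \<theta> ^ n)" using upper[of x n] that KE \<epsilon> by auto
    also have "\<dots> \<le> B / \<epsilon> * survival n y"
      using lower[OF that(2)] B \<epsilon> by (intro mult_left_mono) auto
    finally show ?thesis .
  qed
  have E4: "0 < measure (Q n x) K" if x: "x \<in> K" and n: "n \<ge> n\<^sub>4" for n x
  proof -
    have xE: "x \<in> space E" using x KE by auto
    have "0 < p / 2 * survival n x" using survival_pos[OF xE] p by simp
    then show ?thesis using return[OF xE n] by linarith
  qed

  have "drift_criterion (Suc n\<^sub>4 + Suc n\<^sub>4) \<theta>\<^sub>1 \<theta>\<^sub>2 c\<^sub>1 (\<theta>\<^sub>1 * (1 / \<theta>\<^sub>1) ^ N) (B / \<epsilon>) \<phi>\<^sub>1 \<phi>\<^sub>2 K \<kappa>"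
    unfolding drift_criterion_def
  proof (intro conjI)
    show "\<exists>b>0. \<forall>x\<in>K. b \<le> \<phi>\<^sub>2 x" using G \<phi>\<^sub>2_K by (intro exI[of _ "1 / G"]) auto
    show "\<forall>x\<in>K. \<exists>n\<^sub>4. \<forall>n\<ge>n\<^sub>4. 0 < measure (Q n x) K" using E4 by blast
    show "\<exists>b. \<forall>x\<in>space E. \<phi>\<^sub>1 x \<le> b" using \<phi>\<^sub>1_le by blast
    show "\<forall>n. \<forall>x\<in>K. \<forall>y\<in>K. survival n x \<le> B / \<epsilon> * survival n y" using harnack by blast
    show "\<forall>x\<in>K. \<forall>A\<in>sets E. c\<^sub>1 * measure \<kappa> (A \<inter> K) \<le> measure (Q (Suc n\<^sub>4 + Suc n\<^sub>4) x) A"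
      using E1 by blast
  qed (use \<theta>\<^sub>1 \<theta>\<^sub>2 \<theta>12 c\<^sub>1 B \<epsilon> \<phi>\<^sub>1_meas \<phi>\<^sub>2_meas K \<kappa> \<phi>\<^sub>1_ge \<phi>\<^sub>2_nonneg \<phi>\<^sub>2_le \<phi>\<^sub>1_drift \<phi>\<^sub>2_drift in auto)
  moreover have "\<exists>m>0. \<exists>\<delta>>0. \<forall>x\<in>space E. \<delta> * survival m x \<le> measure (Q m x) K"
    using return p by (intro exI[of _ "Suc n\<^sub>4"] conjI exI[of _ "p / 2"] ballI) auto
  ultimately show ?thesis by blast
qed

end

section \<open>The semigroup of an absorbed Markov process\<close>

context absorbed_markov_process
begin

text \<open>
  The part in \<open>E\<close> of the law of \<open>X\<^sub>n\<close> under \<open>P (Some x)\<close>. It is composed from operations on measures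
  that preserve measurability in \<open>x\<close>; the restriction ensures that \<^const>\<open>the\<close> is only applied to
  points of \<open>E\<close>.
\<close>

definition transition :: "nat \<Rightarrow> 'a \<Rightarrow> 'a measure" where
  "transition n x = distr (restrict_space
     (distr (P (Some x)) (with_cemetery E) (X (real n))) (Some ` space E)) E the"

lemma Some_measurable: "Some \<in> E \<rightarrow>\<^sub>M with_cemetery E"
  unfolding with_cemetery_def
proof (rule measurable_measure_of)
  show "insert {None} ((`) Some ` sets E) \<subseteq> Pow (insert None (Some ` space E))"
    using sets.sets_into_space by blast
  fix B assume "B \<in> insert {None} ((`) Some ` sets E)"
  then consider "B = {None}" | A where "A \<in> sets E" "B = Some ` A" by blast
  then show "Some -` B \<inter> space E \<in> sets E"
  proof cases
    case 2
    then have "Some -` B \<inter> space E = A" using sets.sets_into_space by blast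
    with 2 show ?thesis by simp
  next
    case 1
    then have "Some -` B \<inter> space E = {}" by blast
    then show ?thesis by simp
  qed
qed auto

lemma the_measurable: "the \<in> restrict_space (with_cemetery E) (Some ` space E) \<rightarrow>\<^sub>M E"
proof (rule measurableI)
  have sp: "space (restrict_space (with_cemetery E) (Some ` space E)) = Some ` space E"
    by (auto simp: space_restrict_space space_with_cemetery)
  show "the o' \<in> space E" if "o' \<in> space (restrict_space (with_cemetery E) (Some ` space E))" for o'
    using that unfolding sp by auto
  fix A assume A: "A \<in> sets E"
  have "the -` A \<inter> space (restrict_space (with_cemetery E) (Some ` space E)) = Some ` space E \<inter> Some ` A"
    unfolding sp using sets.sets_into_space[OF A] by auto
  then show "the -` A \<inter> space (restrict_space (with_cemetery E) (Some ` space E))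
      \<in> sets (restrict_space (with_cemetery E) (Some ` space E))"
    using image_Some_sets[OF A] unfolding sets_restrict_space by auto
qed

lemma kernel_Some: "(\<lambda>x. P (Some x)) \<in> E \<rightarrow>\<^sub>M prob_algebra M"
  using measurable_compose[OF Some_measurable kernel] .

lemma
  assumes "x \<in> space (with_cemetery E)"
  shows prob_space_P: "prob_space (P x)" and sets_P: "sets (P x) = sets M"
    and space_P: "space (P x) = space M"
proof -
  show "prob_space (P x)" "sets (P x) = sets M"
    using measurable_space[OF kernel assms] by (auto simp: space_prob_algebra)
  then show "space (P x) = space M" by (intro sets_eq_imp_space_eq)
qed

lemma Some_space: "x \<in> space E \<Longrightarrow> Some x \<in> space (with_cemetery E)"
  by (simp add: space_with_cemetery)

lemma X_measurable: "X (real n) \<in> M \<rightarrow>\<^sub>M with_cemetery E"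
  by (rule process[OF nat_in_time_set])

lemma X_measurable_P: "x \<in> space (with_cemetery E) \<Longrightarrow> X (real n) \<in> P x \<rightarrow>\<^sub>M with_cemetery E"
  using X_measurable measurable_cong_sets[OF sets_P refl] by blast

lemma hitting_event: "A \<in> sets E \<Longrightarrow> {\<omega> \<in> space M. X (real n) \<omega> \<in> Some ` A} \<in> sets M"
  using measurable_sets[OF X_measurable image_Some_sets] by (simp add: vimage_def Int_def conj_commute)

lemma transition_kernel: "transition n \<in> E \<rightarrow>\<^sub>M subprob_algebra E"
proof (cases "space E = {}")
  case True
  show ?thesis unfolding measurable_def True by simp
next
  case False
  have 1: "(\<lambda>x. distr (P (Some x)) (with_cemetery E) (X (real n))) \<in> E \<rightarrow>\<^sub>M subprob_algebra (with_cemetery E)"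
    by (rule measurable_compose[OF measurable_prob_algebraD[OF kernel_Some] measurable_distr[OF X_measurable]])
  have "(\<lambda>x. restrict_space (distr (P (Some x)) (with_cemetery E) (X (real n))) (Some ` space E))
      \<in> E \<rightarrow>\<^sub>M subprob_algebra (restrict_space (with_cemetery E) (Some ` space E))"
    using False by (intro restrict_space_measurable 1 image_Some_sets) auto
  from measurable_compose[OF this measurable_distr[OF the_measurable]] show ?thesis
    by (simp add: transition_def[abs_def])
qed

lemma nn_integral_transition:
  assumes x: "x \<in> space E" and f: "f \<in> borel_measurable E"
  shows "(\<integral>\<^sup>+y. f y \<partial>transition n x)
    = (\<integral>\<^sup>+\<omega>. f (the (X (real n) \<omega>)) * indicator (Some ` space E) (X (real n) \<omega>) \<partial>P (Some x))"
proof -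
  let ?W = "with_cemetery E" and ?F = "Some ` space E"
  let ?D = "distr (P (Some x)) ?W (X (real n))"
  have F: "?F \<in> sets ?W" by (intro image_Some_sets) simp
  have th: "the \<in> restrict_space ?D ?F \<rightarrow>\<^sub>M E"
    using the_measurable by (simp add: measurable_def sets_restrict_space space_restrict_space)
  have fthe: "(\<lambda>o'. f (the o')) \<in> borel_measurable (restrict_space ?W ?F)"
    by (rule measurable_compose[OF the_measurable f])
  have "(\<integral>\<^sup>+y. f y \<partial>transition n x) = (\<integral>\<^sup>+o'. f (the o') \<partial>restrict_space ?D ?F)"
    unfolding transition_def by (rule nn_integral_distr[OF th]) (simp add: f)
  also have "\<dots> = (\<integral>\<^sup>+o'. f (the o') * indicator ?F o' \<partial>?D)"
    using F sets.sets_into_space[OF F] by (intro nn_integral_restrict_space) (simp add: Int_absorb2)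
  also have "\<dots> = (\<integral>\<^sup>+\<omega>. f (the (X (real n) \<omega>)) * indicator ?F (X (real n) \<omega>) \<partial>P (Some x))"
    using fthe F sets.sets_into_space[OF F]
    by (intro nn_integral_distr X_measurable_P Some_space x)
      (simp add: borel_measurable_restrict_space_iff_ennreal Int_absorb2)
  finally show ?thesis .
qed

lemma sets_transition: "sets (transition n x) = sets E"
  by (simp add: transition_def)

lemma measure_transition:
  assumes x: "x \<in> space E" and A: "A \<in> sets E"
  shows "measure (transition n x) A = \<P>(\<omega> in P (Some x). X (real n) \<omega> \<in> Some ` A)"
proof -
  note S = Some_space[OF x]
  have "emeasure (transition n x) A = (\<integral>\<^sup>+y. indicator A y \<partial>transition n x)"
    using A by (simp add: sets_transition)
  also have "\<dots> = (\<integral>\<^sup>+\<omega>. indicator A (the (X (real n) \<omega>)) * indicator (Some ` space E) (X (real n) \<omega>) \<partial>P (Some x))"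
    using A by (intro nn_integral_transition x) simp
  also have "\<dots> = (\<integral>\<^sup>+\<omega>. indicator {\<omega> \<in> space M. X (real n) \<omega> \<in> Some ` A} \<omega> \<partial>P (Some x))"
    using sets.sets_into_space[OF A]
    by (intro nn_integral_cong) (auto simp: indicator_def space_P[OF S])
  also have "\<dots> = emeasure (P (Some x)) {\<omega> \<in> space M. X (real n) \<omega> \<in> Some ` A}"
    using hitting_event[OF A] by (simp add: sets_P[OF S])
  finally show ?thesis by (simp add: measure_def space_P[OF S])
qed

text \<open>
  The cemetery absorbs the process, so being alive at time \<open>n\<close> can be read off from \<open>X\<^sub>n\<close> alone. This
  is what reduces survival, an event that may involve uncountably many times, to the law of \<open>X\<^sub>n\<close>.
\<close>

lemma survival_event_AE:
  assumes x: "x \<in> space (with_cemetery E)"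
  shows "AE \<omega> in P x. ereal (real n) < absorption_time I X \<omega> \<longleftrightarrow> X (real n) \<omega> \<in> Some ` space E"
  using absorbing[OF x] AE_space
proof eventually_elim
  case (elim \<omega>)
  have "X (real n) \<omega> \<in> space (with_cemetery E)"
    using measurable_space[OF X_measurable] elim(2) by (simp add: space_P[OF x])
  then have *: "X (real n) \<omega> = None \<or> X (real n) \<omega> \<in> Some ` space E" by (auto simp: space_with_cemetery)
  show ?case
  proof
    assume less: "ereal (real n) < absorption_time I X \<omega>"
    have "X (real n) \<omega> \<noteq> None"
    proof
      assume "X (real n) \<omega> = None"
      then have "absorption_time I X \<omega> \<le> ereal (real n)"
        unfolding absorption_time_def by (intro INF_lower) (simp add: nat_in_time_set)
      with less show False by simp
    qed
    with * show "X (real n) \<omega> \<in> Some ` space E" by simp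
  next
    assume "X (real n) \<omega> \<in> Some ` space E"
    then have "X (real n) \<omega> \<noteq> None" by auto
    with bspec[OF elim(1) nat_in_time_set[of n]]
    have "\<not> absorption_time I X \<omega> \<le> ereal (real n)" by blast
    then show "ereal (real n) < absorption_time I X \<omega>" by (simp only: not_le)
  qed
qed

lemma prob_hitting_alive:
  assumes x: "x \<in> space E" and A: "A \<in> sets E"
  shows "\<P>(\<omega> in P (Some x). X (real n) \<omega> \<in> Some ` A \<and> ereal (real n) < absorption_time I X \<omega>)
    = measure (transition n x) A"
proof -
  note S = Some_space[OF x]
  interpret prob_space "P (Some x)" by (rule prob_space_P[OF S])
  have "{\<omega> \<in> space M. X (real n) \<omega> \<in> Some ` A \<and> ereal (real n) < absorption_time I X \<omega>} \<in> sets M"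
    using sets.Int[OF hitting_event[OF A, of n] survival_sets[of n]] by (simp add: Int_def conj_ac cong: conj_cong)
  moreover have "AE \<omega> in P (Some x). \<omega> \<in> {\<omega> \<in> space M. X (real n) \<omega> \<in> Some ` A \<and> ereal (real n) < absorption_time I X \<omega>}
      \<longleftrightarrow> \<omega> \<in> {\<omega> \<in> space M. X (real n) \<omega> \<in> Some ` A}"
    using survival_event_AE[OF S, of n]
    by eventually_elim (use sets.sets_into_space[OF A] in auto)
  ultimately show ?thesis
    unfolding measure_transition[OF x A] space_P[OF S]
    using hitting_event[OF A] by (intro finite_measure_eq_AE) (auto simp: sets_P[OF S])
qed

lemma prob_alive:
  assumes x: "x \<in> space E"
  shows "\<P>(\<omega> in P (Some x). ereal (real n) < absorption_time I X \<omega>) = measure (transition n x) (space E)"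
proof -
  note S = Some_space[OF x]
  interpret prob_space "P (Some x)" by (rule prob_space_P[OF S])
  have "AE \<omega> in P (Some x). \<omega> \<in> {\<omega> \<in> space M. ereal (real n) < absorption_time I X \<omega>}
      \<longleftrightarrow> \<omega> \<in> {\<omega> \<in> space M. X (real n) \<omega> \<in> Some ` space E}"
    using survival_event_AE[OF S, of n] by eventually_elim auto
  then show ?thesis
    unfolding measure_transition[OF x sets.top] space_P[OF S]
    using hitting_event[OF sets.top] survival_sets
    by (intro finite_measure_eq_AE) (auto simp: sets_P[OF S])
qed

lemma killed_from_cemetery:
  assumes A: "A \<in> sets E"
  shows "measure (P None) {\<omega> \<in> space M. X (real n) \<omega> \<in> Some ` A} = 0"
proof -
  have S: "None \<in> space (with_cemetery E)" by (simp add: space_with_cemetery)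
  interpret prob_space "P None" by (rule prob_space_P[OF S])
  have None_set: "{None} \<in> sets (with_cemetery E)"
    unfolding with_cemetery_def by (subst sets_measure_of) (use sets.sets_into_space in \<open>blast+\<close>)
  have X0: "X 0 \<in> P None \<rightarrow>\<^sub>M with_cemetery E" using X_measurable_P[OF S, of 0] by simp
  have "AE o' in distr (P None) (with_cemetery E) (X 0). o' \<in> {None}"
    unfolding start[OF S] using None_set S by (subst AE_return) auto
  then have "AE \<omega> in P None. X 0 \<omega> \<in> {None}"
    by (rule AE_distrD[OF X0])
  then have "AE \<omega> in P None. X (real n) \<omega> = None"
    using absorbing[OF S]
  proof eventually_elim
    case (elim \<omega>)
    have "absorption_time I X \<omega> \<le> ereal 0"
      unfolding absorption_time_def using elim(1) nat_in_time_set[of 0] by (intro INF_lower) simp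
    also have "\<dots> \<le> ereal (real n)" by simp
    finally show ?case using elim(2) nat_in_time_set by blast
  qed
  then have "AE \<omega> in P None. \<omega> \<notin> {\<omega> \<in> space M. X (real n) \<omega> \<in> Some ` A}"
    by eventually_elim auto
  then show ?thesis
    using hitting_event[OF A] by (intro prob_eq_0[THEN iffD2]) (auto simp: sets_P[OF S])
qed

text \<open>
  The Chapman-Kolmogorov equation is the Markov property at time \<open>m\<close> after taking expectations. Paths
  that sit in the cemetery at time \<open>m\<close> do not contribute, since they never come back to \<open>E\<close>.
\<close>

lemma transition_add:
  assumes x: "x \<in> space E" and A: "A \<in> sets E"
  shows "measure (transition (m + n) x) A = (\<integral>y. measure (transition n y) A \<partial>transition m x)"
proof -
  note S = Some_space[OF x]
  interpret prob_space "P (Some x)" by (rule prob_space_P[OF S])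
  let ?W = "with_cemetery E" and ?F = "Some ` space E"
  let ?D = "distr (P (Some x)) ?W (X (real m))"
  define H where "H = (\<lambda>o'. measure (P o') {\<omega> \<in> space M. X (real n) \<omega> \<in> Some ` A})"
  have H_meas: "H \<in> borel_measurable ?W"
    unfolding H_def measure_def
    by (intro borel_measurable_enn2real measurable_compose[OF measurable_prob_algebraD[OF kernel]
      measurable_emeasure_subprob_algebra] hitting_event A)
  have F: "?F \<in> sets ?W" by (intro image_Some_sets) simp
  let ?B = "{\<omega> \<in> space M. X (real m + real n) \<omega> \<in> Some ` A}"
  have B: "?B \<in> sets (P (Some x))"
    using hitting_event[OF A, of "m + n"] by (simp add: sets_P[OF S])
  have sub: "subalgebra (P (Some x)) (past E I M X (real m))"
    unfolding subalgebra_def past_def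
  proof
    let ?G = "{X s -` A \<inter> space M |s A. s \<in> I \<and> s \<le> real m \<and> A \<in> sets (with_cemetery E)}"
    have G: "?G \<subseteq> sets M" using process by (auto intro: measurable_sets)
    then have "?G \<subseteq> Pow (space M)" using sets.sets_into_space by blast
    then show "space (sigma (space M) ?G) = space (P (Some x))"
      "sets (sigma (space M) ?G) \<subseteq> sets (P (Some x))"
      using sets.sigma_sets_subset[OF G] by (simp_all add: space_P[OF S] sets_P[OF S])
  qed
  interpret finite_measure_subalgebra "P (Some x)" "past E I M X (real m)"
    using sub by unfold_locales
  have int: "integrable (P (Some x)) (indicator ?B :: _ \<Rightarrow> real)"
    using B by (simp add: emeasure_eq_measure)
  have "measure (transition (m + n) x) A = measure (P (Some x)) ?B"
    by (simp add: measure_transition x A space_P[OF S])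
  also have "\<dots> = (\<integral>\<omega>. indicator ?B \<omega> \<partial>P (Some x))"
    using B by (simp add: sets.Int_space_eq2)
  also have "\<dots> = (\<integral>\<omega>. real_cond_exp (P (Some x)) (past E I M X (real m)) (indicator ?B) \<omega> \<partial>P (Some x))"
    by (rule real_cond_exp_int(2)[OF int, symmetric])
  also have "\<dots> = (\<integral>\<omega>. H (X (real m) \<omega>) \<partial>P (Some x))"
  proof (rule integral_cong_AE)
    show "(\<lambda>\<omega>. H (X (real m) \<omega>)) \<in> borel_measurable (P (Some x))"
      by (rule measurable_compose[OF X_measurable_P[OF S] H_meas])
    show "AE \<omega> in P (Some x). real_cond_exp (P (Some x)) (past E I M X (real m)) (indicator ?B) \<omega>
        = H (X (real m) \<omega>)"
      unfolding H_def by (rule markov[OF S nat_in_time_set nat_in_time_set image_Some_sets[OF A]])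
  qed simp
  also have "\<dots> = (\<integral>o'. H o' \<partial>?D)"
    by (rule integral_distr[OF X_measurable_P[OF S] H_meas, symmetric])
  also have "\<dots> = (\<integral>o'. indicator ?F o' *\<^sub>R H o' \<partial>?D)"
    using killed_from_cemetery[OF A]
    by (intro Bochner_Integration.integral_cong) (auto simp: H_def space_with_cemetery indicator_def)
  also have "\<dots> = (\<integral>o'. H o' \<partial>restrict_space ?D ?F)"
    using F sets.sets_into_space[OF F] by (intro integral_restrict_space[symmetric]) (simp add: Int_absorb2)
  also have "\<dots> = (\<integral>o'. measure (transition n (the o')) A \<partial>restrict_space ?D ?F)"
    by (intro Bochner_Integration.integral_cong)
      (auto simp: H_def space_restrict_space measure_transition A space_P[OF Some_space])
  also have "\<dots> = (\<integral>y. measure (transition n y) A \<partial>transition m x)"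
    unfolding transition_def[of m]
  proof (rule integral_distr[symmetric])
    show "the \<in> restrict_space ?D ?F \<rightarrow>\<^sub>M E"
      using the_measurable by (simp add: measurable_def sets_restrict_space space_restrict_space)
    show "(\<lambda>y. measure (transition n y) A) \<in> borel_measurable E"
      unfolding measure_def
      by (intro borel_measurable_enn2real measurable_compose[OF transition_kernel
        measurable_emeasure_subprob_algebra] A)
  qed
  finally show ?thesis .
qed

lemma killed_semigroup_transition: "killed_semigroup E transition"
proof
  show "transition n \<in> E \<rightarrow>\<^sub>M subprob_algebra E" for n by (rule transition_kernel)
  show "measure (transition 0 x) A = indicator A x" if x: "x \<in> space E" and A: "A \<in> sets E" for x A
  proof -
    note S = Some_space[OF x]
    have X0: "X 0 \<in> P (Some x) \<rightarrow>\<^sub>M with_cemetery E" using X_measurable_P[OF S, of 0] by simp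
    have "measure (transition 0 x) A = measure (distr (P (Some x)) (with_cemetery E) (X 0)) (Some ` A)"
      by (subst measure_distr[OF X0 image_Some_sets[OF A]])
        (auto simp: measure_transition x A intro!: arg_cong[where f = "measure _"])
    also have "\<dots> = indicator A x"
      unfolding start[OF S] using image_Some_sets[OF A] by (simp add: measure_return indicator_def image_iff)
    finally show ?thesis .
  qed
  show "measure (transition (m + n) x) A = (\<integral>y. measure (transition n y) A \<partial>transition m x)"
    if "x \<in> space E" "A \<in> sets E" for x A m n by (rule transition_add[OF that])
  show "0 < measure (transition n x) (space E)" if "x \<in> space E" for x n
    using survival_pos[OF that, of n] by (simp add: prob_alive that)
qed

sublocale semigroup: killed_semigroup E transition
  by (rule killed_semigroup_transition)

lemma conditioned_law_eq:
  assumes \<mu>: "\<mu> \<in> space (prob_algebra E)"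
  shows "conditioned_law E I X (law_from P \<mu>) n = semigroup.conditional \<mu> n"
proof -
  have p\<mu>: "prob_space \<mu>" and s\<mu>: "sets \<mu> = sets E" using \<mu> by (auto simp: space_prob_algebra)
  have sp\<mu>: "space \<mu> = space E" by (rule sets_eq_imp_space_eq) fact
  have law: "law_from P \<mu> \<in> space (prob_algebra M)"
    unfolding law_from_def
    using measurable_space[OF measurable_bind_prob_space[OF measurable_const[OF \<mu>] kernel_Some], of undefined "count_space UNIV"]
    by simp
  then have pL: "prob_space (law_from P \<mu>)" and sL: "sets (law_from P \<mu>) = sets M"
    by (auto simp: space_prob_algebra)
  have spL: "space (law_from P \<mu>) = space M" by (rule sets_eq_imp_space_eq) fact
  have mL: "measure (law_from P \<mu>) B = (\<integral>x. measure (P (Some x)) B \<partial>\<mu>)" if B: "B \<in> sets M" for B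
  proof -
    have kern: "(\<lambda>x. P (Some x)) \<in> \<mu> \<rightarrow>\<^sub>M subprob_algebra M"
      using measurable_prob_algebraD[OF kernel_Some] measurable_cong_sets[OF s\<mu> refl] by blast
    have meas: "(\<lambda>x. measure (P (Some x)) B) \<in> borel_measurable \<mu>"
      unfolding measure_def
      by (intro borel_measurable_enn2real measurable_compose[OF kern measurable_emeasure_subprob_algebra] B)
    have "emeasure (law_from P \<mu>) B = (\<integral>\<^sup>+x. emeasure (P (Some x)) B \<partial>\<mu>)"
      unfolding law_from_def by (rule emeasure_bind[OF prob_space.not_empty[OF p\<mu>] kern B])
    also have "\<dots> = (\<integral>\<^sup>+x. ennreal (measure (P (Some x)) B) \<partial>\<mu>)"
      by (rule nn_integral_cong) (simp add: sp\<mu> prob_space_P[OF Some_space] prob_space.finite_measure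
          finite_measure.emeasure_eq_measure)
    finally show ?thesis
      using meas by (simp add: measure_def integral_eq_nn_integral)
  qed
  have measure_eq: "measure (conditioned_law E I X (law_from P \<mu>) n) A = measure (semigroup.conditional \<mu> n) A"
    if A: "A \<in> sets E" for A
  proof -
    have "measure (conditioned_law E I X (law_from P \<mu>) n) A =
        measure (law_from P \<mu>) {\<omega> \<in> space M. X (real n) \<omega> \<in> Some ` A \<and> ereal (real n) < absorption_time I X \<omega>}
        / measure (law_from P \<mu>) {\<omega> \<in> space M. ereal (real n) < absorption_time I X \<omega>}"
      by (simp add: measure_conditioned_law[OF pL sL A] cond_prob_def spL)
    also have "measure (law_from P \<mu>) {\<omega> \<in> space M. X (real n) \<omega> \<in> Some ` A \<and> ereal (real n) < absorption_time I X \<omega>}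
        = (\<integral>x. measure (transition n x) A \<partial>\<mu>)"
    proof (subst mL)
      show "{\<omega> \<in> space M. X (real n) \<omega> \<in> Some ` A \<and> ereal (real n) < absorption_time I X \<omega>} \<in> sets M"
        using sets.Int[OF hitting_event[OF A, of n] survival_sets[of n]] by (simp add: Int_def conj_ac cong: conj_cong)
    qed (intro Bochner_Integration.integral_cong refl,
        simp add: sp\<mu> prob_hitting_alive[OF _ A, symmetric] space_P[OF Some_space])
    also have "measure (law_from P \<mu>) {\<omega> \<in> space M. ereal (real n) < absorption_time I X \<omega>}
        = (\<integral>x. measure (transition n x) (space E) \<partial>\<mu>)"
      by (subst mL[OF survival_sets], intro Bochner_Integration.integral_cong refl)
        (simp add: sp\<mu> prob_alive[symmetric] space_P[OF Some_space])
    finally show ?thesis by (simp add: semigroup.measure_conditional[OF \<mu> A])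
  qed
  have c: "prob_space (semigroup.conditional \<mu> n)" "sets (semigroup.conditional \<mu> n) = sets E"
    using semigroup.conditional_in_prob_algebra[OF \<mu>, of n] by (auto simp: space_prob_algebra)
  have spc: "space (semigroup.conditional \<mu> n) = space E" by (rule sets_eq_imp_space_eq) fact
  let ?N = "conditioned_law E I X (law_from P \<mu>) n"
  have sN: "sets ?N = sets E" by (simp add: conditioned_law_def Let_def)
  have spN: "space ?N = space E" by (rule sets_eq_imp_space_eq) fact
  \<comment> \<open>A measure whose real-valued total mass is not \<open>0\<close> is finite, since \<open>measure\<close> sends \<open>\<infinity>\<close> to \<open>0\<close>.\<close>
  have "measure ?N (space E) = 1"
    using measure_eq[of "space E"] prob_space.prob_space[OF c(1)] by (simp add: spc)
  then have "finite_measure ?N"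
    by (intro finite_measureI) (auto simp: spN measure_def)
  then have "emeasure ?N A = emeasure (semigroup.conditional \<mu> n) A" if "A \<in> sets E" for A
    using measure_eq[OF that] prob_space.finite_measure[OF c(1)]
    by (simp only: finite_measure.emeasure_eq_measure)
  then show ?thesis by (intro measure_eqI) (simp_all only: sN c(2))
qed

lemma semigroup_op_eq:
  assumes x: "x \<in> space E" and f: "f \<in> borel_measurable E"
    "\<And>y. y \<in> space E \<Longrightarrow> 0 \<le> f y" "\<And>y. y \<in> space E \<Longrightarrow> f y \<le> b"
  shows "semigroup_op I X P n f x = ennreal (\<integral>y. f y \<partial>transition n x)"
proof -
  note S = Some_space[OF x]
  have "semigroup_op I X P n f x
      = (\<integral>\<^sup>+\<omega>. ennreal (f (the (X (real n) \<omega>))) * indicator (Some ` space E) (X (real n) \<omega>) \<partial>P (Some x))"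
    unfolding semigroup_op_def
  proof (rule nn_integral_cong_AE)
    show "AE \<omega> in P (Some x). ennreal (f (the (X (real n) \<omega>)))
          * indicator {\<omega>. ereal (real n) < absorption_time I X \<omega>} \<omega>
        = ennreal (f (the (X (real n) \<omega>))) * indicator (Some ` space E) (X (real n) \<omega>)"
      using survival_event_AE[OF S, of n]
      by eventually_elim (simp only: indicator_def mem_Collect_eq)
  qed
  also have "\<dots> = (\<integral>\<^sup>+y. ennreal (f y) \<partial>transition n x)"
    using f(1) by (intro nn_integral_transition[OF x, symmetric]) simp
  also have "\<dots> = ennreal (\<integral>y. f y \<partial>transition n x)"
    using f semigroup.integrable_Q[OF x f(1), of b n]
    by (intro nn_integral_eq_integral AE_I2) (auto simp: semigroup.space_Q x)
  finally show ?thesis .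
qed

end

section \<open>Quasi-stationary convergence and Condition (E)\<close>

lemma INF_pos_iff_bounded_away:
  fixes f :: "'b \<Rightarrow> real"
  assumes "S \<noteq> {}" "\<And>x. x \<in> S \<Longrightarrow> 0 \<le> f x"
  shows "0 < (INF x\<in>S. f x) \<longleftrightarrow> (\<exists>b>0. \<forall>x\<in>S. b \<le> f x)"
proof
  assume "0 < (INF x\<in>S. f x)"
  moreover have "bdd_below (f ` S)" using assms(2) by (intro bdd_belowI[of _ 0]) auto
  ultimately show "\<exists>b>0. \<forall>x\<in>S. b \<le> f x" by (intro exI[of _ "INF x\<in>S. f x"]) (auto intro: cINF_lower)
next
  assume "\<exists>b>0. \<forall>x\<in>S. b \<le> f x"
  then obtain b where "0 < b" "\<And>x. x \<in> S \<Longrightarrow> b \<le> f x" by blast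
  moreover have "b \<le> (INF x\<in>S. f x)" using assms(1) calculation(2) by (rule cINF_greatest)
  ultimately show "0 < (INF x\<in>S. f x)" by simp
qed

text \<open>
  In the extended nonnegative reals a quotient with denominator \<open>0\<close> and positive numerator is
  infinite, so the bound on the left forces the infimum to be positive.
\<close>

lemma SUP_div_INF_le_iff:
  fixes f :: "'b \<Rightarrow> real"
  assumes S: "S \<noteq> {}" and f: "\<And>x. x \<in> S \<Longrightarrow> 0 < f x" "\<And>x. x \<in> S \<Longrightarrow> f x \<le> 1" and c: "0 < c"
  shows "(SUP x\<in>S. ennreal (f x)) / (INF x\<in>S. ennreal (f x)) \<le> ennreal c
    \<longleftrightarrow> (\<forall>x\<in>S. \<forall>y\<in>S. f x \<le> c * f y)"
proof
  let ?s = "SUP x\<in>S. ennreal (f x)" and ?i = "INF x\<in>S. ennreal (f x)"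
  assume le: "?s / ?i \<le> ennreal c"
  obtain x\<^sub>0 where x\<^sub>0: "x\<^sub>0 \<in> S" using S by auto
  have "0 < ennreal (f x\<^sub>0)" using f(1)[OF x\<^sub>0] by simp
  then have s_pos: "0 < ?s" using SUP_upper[OF x\<^sub>0] by (rule less_le_trans)
  have s_le: "?s \<le> 1" using f(2) by (intro SUP_least) (simp add: ennreal_le_1)
  have i_le: "?i \<le> 1"
    using INF_lower[OF x\<^sub>0, of "\<lambda>x. ennreal (f x)"] f(2)[OF x\<^sub>0] by (meson ennreal_le_1 order_trans)
  have i_ne: "?i \<noteq> 0"
  proof
    assume "?i = 0"
    then have "?s / ?i = \<top>" using s_pos by (simp add: ennreal_divide_zero)
    with le show False by (simp add: top_unique)
  qed
  have "?i < \<top>" using i_le by (rule le_less_trans) simp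
  then have "?s = ?s / ?i * ?i"
    by (simp only: ennreal_divide_times ennreal_divide_self[OF i_ne] mult_1_right)
  also have "\<dots> \<le> ennreal c * ?i" by (rule mult_right_mono[OF le]) simp
  finally have si: "?s \<le> ennreal c * ?i" .
  show "\<forall>x\<in>S. \<forall>y\<in>S. f x \<le> c * f y"
  proof (intro ballI)
    fix x y assume xy: "x \<in> S" "y \<in> S"
    have "ennreal (f x) \<le> ?s" by (rule SUP_upper[OF xy(1)])
    also note si
    also have "ennreal c * ?i \<le> ennreal c * ennreal (f y)"
      by (intro mult_left_mono INF_lower xy(2)) simp
    also have "\<dots> = ennreal (c * f y)" using c f(1)[OF xy(2)] by (simp add: ennreal_mult less_imp_le)
    finally show "f x \<le> c * f y" using c f(1)[OF xy(2)] by simp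
  qed
next
  let ?s = "SUP x\<in>S. ennreal (f x)" and ?i = "INF x\<in>S. ennreal (f x)"
  assume le: "\<forall>x\<in>S. \<forall>y\<in>S. f x \<le> c * f y"
  have bound: "ennreal (f x / c) \<le> ?i" if "x \<in> S" for x
    using le that c by (intro INF_greatest ennreal_leI) (simp add: divide_le_eq mult.commute)
  obtain x\<^sub>0 where x\<^sub>0: "x\<^sub>0 \<in> S" using S by auto
  have "0 < ennreal (f x\<^sub>0 / c)" using f(1)[OF x\<^sub>0] c by simp
  then have i_pos: "0 < ?i" using bound[OF x\<^sub>0] by (rule less_le_trans)
  have "?s \<le> ennreal c * ?i"
  proof (rule SUP_least)
    fix x assume x: "x \<in> S"
    have "ennreal (f x) = ennreal c * ennreal (f x / c)"
      using c f(1)[OF x] by (simp add: ennreal_mult[symmetric])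
    also have "\<dots> \<le> ennreal c * ?i" by (intro mult_left_mono bound x) simp
    finally show "ennreal (f x) \<le> ennreal c * ?i" .
  qed
  then show "?s / ?i \<le> ennreal c" using i_pos by (intro divide_le_posI_ennreal) (simp_all add: mult.commute)
qed

context absorbed_markov_process
begin

text \<open>
  The two conditions agree conjunct by conjunct once the measurability, boundedness and sign
  conditions common to both are granted; these are therefore extracted from either side first.
\<close>

lemma condition_E_iff_drift_criterion:
  "condition_E E I X P n\<^sub>1 \<theta>\<^sub>1 \<theta>\<^sub>2 c\<^sub>1 c\<^sub>2 c\<^sub>3 \<phi>\<^sub>1 \<phi>\<^sub>2 K \<nu> \<and> bounded (\<phi>\<^sub>1 ` space E)
    \<longleftrightarrow> semigroup.drift_criterion n\<^sub>1 \<theta>\<^sub>1 \<theta>\<^sub>2 c\<^sub>1 c\<^sub>2 c\<^sub>3 \<phi>\<^sub>1 \<phi>\<^sub>2 K \<nu>"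
  (is "?E \<longleftrightarrow> ?D")
proof -
  let ?T = "K \<in> sets E \<and> \<nu> \<in> space (prob_algebra (restrict_space E K)) \<and>
    \<phi>\<^sub>1 \<in> borel_measurable E \<and> \<phi>\<^sub>2 \<in> borel_measurable E \<and>
    (\<forall>x\<in>space E. 1 \<le> \<phi>\<^sub>1 x) \<and> bounded (\<phi>\<^sub>1 ` space E) \<and>
    (\<forall>x\<in>space E. 0 \<le> \<phi>\<^sub>2 x) \<and> (\<forall>x\<in>space E. \<phi>\<^sub>2 x \<le> 1) \<and> \<theta>\<^sub>1 > 0 \<and> \<theta>\<^sub>2 > 0 \<and> c\<^sub>2 > 0 \<and> c\<^sub>3 > 0"
  have "?E \<longleftrightarrow> ?D" if ?T
  proof -
    from that
    have K: "K \<in> sets E" and \<nu>: "\<nu> \<in> space (prob_algebra (restrict_space E K))"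
      and \<phi>\<^sub>1: "\<phi>\<^sub>1 \<in> borel_measurable E" "\<And>x. x \<in> space E \<Longrightarrow> 1 \<le> \<phi>\<^sub>1 x" "bounded (\<phi>\<^sub>1 ` space E)"
      and \<phi>\<^sub>2: "\<phi>\<^sub>2 \<in> borel_measurable E" "\<And>x. x \<in> space E \<Longrightarrow> 0 \<le> \<phi>\<^sub>2 x" "\<And>x. x \<in> space E \<Longrightarrow> \<phi>\<^sub>2 x \<le> 1"
      and pos: "\<theta>\<^sub>1 > 0" "\<theta>\<^sub>2 > 0" "c\<^sub>2 > 0" "c\<^sub>3 > 0"
      by blast+
    have KE: "x \<in> space E" if "x \<in> K" for x using sets.sets_into_space[OF K] that by auto
    have K_ne: "K \<noteq> {}"
      using prob_space.not_empty[of \<nu>] \<nu> KE sets_eq_imp_space_eq[of \<nu> "restrict_space E K"]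
      by (auto simp: space_prob_algebra space_restrict_space)
    obtain b where b: "\<And>x. x \<in> space E \<Longrightarrow> \<phi>\<^sub>1 x \<le> b"
      using \<phi>\<^sub>1(3) unfolding bounded_real by (auto simp: abs_le_iff)
    have bdd: "bdd_above (\<phi>\<^sub>1 ` K)" using b KE by (intro bdd_aboveI2[of _ _ b]) blast
    have \<phi>\<^sub>1_0: "0 \<le> \<phi>\<^sub>1 x" if "x \<in> space E" for x using \<phi>\<^sub>1(2)[OF that] by simp
    have E1: "(\<forall>x\<in>K. \<forall>A\<in>sets E. \<P>(\<omega> in P (Some x). X (real n\<^sub>1) \<omega> \<in> Some ` A) \<ge> c\<^sub>1 * measure \<nu> (A \<inter> K))
        \<longleftrightarrow> (\<forall>x\<in>K. \<forall>A\<in>sets E. c\<^sub>1 * measure \<nu> (A \<inter> K) \<le> measure (transition n\<^sub>1 x) A)"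
      by (intro ball_cong refl) (simp add: measure_transition KE)
    have inf\<phi>\<^sub>2: "0 < (INF x\<in>K. \<phi>\<^sub>2 x) \<longleftrightarrow> (\<exists>b>0. \<forall>x\<in>K. b \<le> \<phi>\<^sub>2 x)"
      using K_ne \<phi>\<^sub>2(2) KE by (intro INF_pos_iff_bounded_away) auto
    have drift\<^sub>1: "(\<forall>x\<in>space E. semigroup_op I X P 1 \<phi>\<^sub>1 x \<le> ennreal (\<theta>\<^sub>1 * \<phi>\<^sub>1 x + c\<^sub>2 * indicator K x))
        \<longleftrightarrow> (\<forall>x\<in>space E. (\<integral>y. \<phi>\<^sub>1 y \<partial>transition 1 x) \<le> \<theta>\<^sub>1 * \<phi>\<^sub>1 x + c\<^sub>2 * indicator K x)"
    proof (intro ball_cong refl)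
      fix x assume x: "x \<in> space E"
      have "0 \<le> \<theta>\<^sub>1 * \<phi>\<^sub>1 x + c\<^sub>2 * indicator K x" using \<phi>\<^sub>1_0[OF x] pos by (auto intro!: add_nonneg_nonneg)
      then show "semigroup_op I X P 1 \<phi>\<^sub>1 x \<le> ennreal (\<theta>\<^sub>1 * \<phi>\<^sub>1 x + c\<^sub>2 * indicator K x)
          \<longleftrightarrow> (\<integral>y. \<phi>\<^sub>1 y \<partial>transition 1 x) \<le> \<theta>\<^sub>1 * \<phi>\<^sub>1 x + c\<^sub>2 * indicator K x"
        by (simp only: semigroup_op_eq[OF x \<phi>\<^sub>1(1) \<phi>\<^sub>1_0 b] ennreal_le_iff)
    qed
    have drift\<^sub>2: "(\<forall>x\<in>space E. semigroup_op I X P 1 \<phi>\<^sub>2 x \<ge> ennreal (\<theta>\<^sub>2 * \<phi>\<^sub>2 x))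
        \<longleftrightarrow> (\<forall>x\<in>space E. \<theta>\<^sub>2 * \<phi>\<^sub>2 x \<le> (\<integral>y. \<phi>\<^sub>2 y \<partial>transition 1 x))"
    proof (intro ball_cong refl)
      fix x assume x: "x \<in> space E"
      have "0 \<le> (\<integral>y. \<phi>\<^sub>2 y \<partial>transition 1 x)"
        using \<phi>\<^sub>2(2) by (intro integral_nonneg_AE AE_I2) (auto simp: semigroup.space_Q x)
      then show "semigroup_op I X P 1 \<phi>\<^sub>2 x \<ge> ennreal (\<theta>\<^sub>2 * \<phi>\<^sub>2 x)
          \<longleftrightarrow> \<theta>\<^sub>2 * \<phi>\<^sub>2 x \<le> (\<integral>y. \<phi>\<^sub>2 y \<partial>transition 1 x)"
        by (simp only: semigroup_op_eq[OF x \<phi>\<^sub>2] ennreal_le_iff)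
    qed
    have E3: "(SUP n::nat. (SUP y\<in>K. ennreal \<P>(\<omega> in P (Some y). ereal (real n) < absorption_time I X \<omega>)) /
          (INF y\<in>K. ennreal \<P>(\<omega> in P (Some y). ereal (real n) < absorption_time I X \<omega>))) \<le> ennreal c\<^sub>3
        \<longleftrightarrow> (\<forall>n. \<forall>x\<in>K. \<forall>y\<in>K. semigroup.survival n x \<le> c\<^sub>3 * semigroup.survival n y)"
    proof -
      have "(SUP y\<in>K. ennreal \<P>(\<omega> in P (Some y). ereal (real n) < absorption_time I X \<omega>)) /
          (INF y\<in>K. ennreal \<P>(\<omega> in P (Some y). ereal (real n) < absorption_time I X \<omega>)) \<le> ennreal c\<^sub>3
        \<longleftrightarrow> (\<forall>x\<in>K. \<forall>y\<in>K. semigroup.survival n x \<le> c\<^sub>3 * semigroup.survival n y)" for n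
      proof -
        have "(SUP y\<in>K. ennreal (semigroup.survival n y)) / (INF y\<in>K. ennreal (semigroup.survival n y)) \<le> ennreal c\<^sub>3
          \<longleftrightarrow> (\<forall>x\<in>K. \<forall>y\<in>K. semigroup.survival n x \<le> c\<^sub>3 * semigroup.survival n y)"
          using KE semigroup.survival_pos semigroup.survival_le_1 by (intro SUP_div_INF_le_iff K_ne pos(4)) auto
        moreover have "\<P>(\<omega> in P (Some y). ereal (real n) < absorption_time I X \<omega>) = semigroup.survival n y"
          if "y \<in> K" for y by (rule prob_alive[OF KE[OF that]])
        ultimately show ?thesis by (simp only: cong: SUP_cong INF_cong)
      qed
      note each = this
      show ?thesis by (simp only: SUP_le_iff each ball_UNIV)
    qed
    have E4: "(\<forall>x\<in>K. \<exists>n\<^sub>4::nat. \<forall>n\<ge>n\<^sub>4. \<P>(\<omega> in P (Some x). X (real n) \<omega> \<in> Some ` K) > 0)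
        \<longleftrightarrow> (\<forall>x\<in>K. \<exists>n\<^sub>4. \<forall>n\<ge>n\<^sub>4. 0 < measure (transition n x) K)"
      by (intro ball_cong refl) (simp add: measure_transition KE K)
    have bounds: "\<forall>x\<in>space E. 0 \<le> \<phi>\<^sub>1 x" "\<forall>x\<in>space E. 1 \<le> \<phi>\<^sub>1 x" "\<exists>b. \<forall>x\<in>space E. \<phi>\<^sub>1 x \<le> b"
      "\<forall>x\<in>space E. 0 \<le> \<phi>\<^sub>2 x" "\<forall>x\<in>space E. \<phi>\<^sub>2 x \<le> 1"
      using \<phi>\<^sub>1_0 \<phi>\<^sub>1(2) \<phi>\<^sub>2(2,3) b by blast+
    show ?thesis
      unfolding condition_E_def semigroup.drift_criterion_def E1 inf\<phi>\<^sub>2 drift\<^sub>1 drift\<^sub>2 E3 E4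
      by (simp only: bounds[THEN eqTrueI] K \<nu> \<phi>\<^sub>1(1,3) \<phi>\<^sub>2(1) bdd pos simp_thms conj_assoc)
  qed
  moreover have ?T if ?E using that unfolding condition_E_def by simp
  moreover have ?T if ?D
  proof -
    note D = that[unfolded semigroup.drift_criterion_def]
    have "\<exists>b. \<forall>x\<in>space E. \<phi>\<^sub>1 x \<le> b" "\<forall>x\<in>space E. 1 \<le> \<phi>\<^sub>1 x" using D by simp_all
    then obtain b where b: "\<And>x. x \<in> space E \<Longrightarrow> 1 \<le> \<phi>\<^sub>1 x \<and> \<phi>\<^sub>1 x \<le> b" by blast
    have "\<bar>\<phi>\<^sub>1 x\<bar> \<le> b" if "x \<in> space E" for x using b[OF that] by simp
    then have "bounded (\<phi>\<^sub>1 ` space E)" unfolding bounded_real by blast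
    then show ?T using D by simp
  qed
  ultimately show ?thesis by blast
qed

lemma uniform_return_iff:
  assumes K: "K \<in> sets E" and ne: "space E \<noteq> {}"
  shows "0 < (INF x\<in>space E. \<P>(\<omega> in P (Some x). X (real m) \<omega> \<in> Some ` K
        \<bar> ereal (real m) < absorption_time I X \<omega>))
    \<longleftrightarrow> (\<exists>\<delta>>0. \<forall>x\<in>space E. \<delta> * semigroup.survival m x \<le> measure (transition m x) K)"
proof -
  have eq: "\<P>(\<omega> in P (Some x). X (real m) \<omega> \<in> Some ` K \<bar> ereal (real m) < absorption_time I X \<omega>)
      = measure (transition m x) K / semigroup.survival m x" if "x \<in> space E" for x
    by (simp add: cond_prob_def prob_hitting_alive[OF that K] prob_alive[OF that])
  have "0 < (INF x\<in>space E. \<P>(\<omega> in P (Some x). X (real m) \<omega> \<in> Some ` K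
        \<bar> ereal (real m) < absorption_time I X \<omega>))
      \<longleftrightarrow> (\<exists>\<delta>>0. \<forall>x\<in>space E. \<delta> \<le> measure (transition m x) K / semigroup.survival m x)"
    by (subst INF_pos_iff_bounded_away[OF ne]) (auto simp: eq)
  also have "\<dots> \<longleftrightarrow> (\<exists>\<delta>>0. \<forall>x\<in>space E. \<delta> * semigroup.survival m x \<le> measure (transition m x) K)"
    by (intro ex_cong conj_cong ball_cong refl) (simp add: le_divide_eq semigroup.survival_pos)
  finally show ?thesis .
qed

end

theorem proposition3p7:
  fixes E :: "'a measure" and I :: "real set" and M :: "'w measure"
    and X :: "real \<Rightarrow> 'w \<Rightarrow> 'a option" and P :: "'a option \<Rightarrow> 'w measure"
  assumes "absorbed_markov_process E I M X P"
  shows "(\<exists>\<nu>\<^sub>Q\<^sub>S\<^sub>D \<in> space (prob_algebra E). \<exists>C \<alpha> :: real. C > 0 \<and> 0 < \<alpha> \<and> \<alpha> < 1 \<and>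
            (\<forall>\<mu> \<in> space (prob_algebra E). \<forall>n::nat.
               tv_dist E (conditioned_law E I X (law_from P \<mu>) n) \<nu>\<^sub>Q\<^sub>S\<^sub>D \<le> C * \<alpha> ^ n))
     \<longleftrightarrow>
         (\<exists>n\<^sub>1 \<theta>\<^sub>1 \<theta>\<^sub>2 c\<^sub>1 c\<^sub>2 c\<^sub>3 \<phi>\<^sub>1 \<phi>\<^sub>2 K \<nu>.
            condition_E E I X P n\<^sub>1 \<theta>\<^sub>1 \<theta>\<^sub>2 c\<^sub>1 c\<^sub>2 c\<^sub>3 \<phi>\<^sub>1 \<phi>\<^sub>2 K \<nu> \<and>
            bounded (\<phi>\<^sub>1 ` space E) \<and>
            (\<exists>n\<^sub>4'::nat. n\<^sub>4' > 0 \<and>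
               (INF x\<in>space E.
                  \<P>(\<omega> in P (Some x). X (real n\<^sub>4') \<omega> \<in> Some ` K
                     \<bar> ereal (real n\<^sub>4') < absorption_time I X \<omega>)) > 0))"
    (is "?convergence \<longleftrightarrow> ?criterion")
proof -
  interpret absorbed_markov_process E I M X P by fact
  have nonempty: "space E \<noteq> {}" if "\<nu> \<in> space (prob_algebra E)" for \<nu>
    using that prob_space.not_empty[of \<nu>] sets_eq_imp_space_eq[of \<nu> E] by (auto simp: space_prob_algebra)
  show ?thesis
  proof
    assume ?convergence
    then obtain \<pi> C \<alpha> where \<pi>: "\<pi> \<in> space (prob_algebra E)" and C: "0 < C" and \<alpha>: "0 < \<alpha>" "\<alpha> < 1"
      and conv: "\<And>\<mu> n. \<mu> \<in> space (prob_algebra E) \<Longrightarrow>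
        tv_dist E (conditioned_law E I X (law_from P \<mu>) n) \<pi> \<le> C * \<alpha> ^ n" by blast
    have "tv_dist E (semigroup.conditional (return E x) n) \<pi> \<le> C * \<alpha> ^ n" if "x \<in> space E" for x n
      using conv[OF semigroup.return_in_prob_algebra[OF that], of n]
      by (simp add: conditioned_law_eq semigroup.return_in_prob_algebra[OF that])
    from semigroup.exponential_convergence_imp_drift_criterion[OF \<pi> this \<alpha> C]
    obtain n\<^sub>1 \<theta>\<^sub>1 \<theta>\<^sub>2 c\<^sub>1 c\<^sub>2 c\<^sub>3 \<phi>\<^sub>1 \<phi>\<^sub>2 K \<kappa> m where
      drift: "semigroup.drift_criterion n\<^sub>1 \<theta>\<^sub>1 \<theta>\<^sub>2 c\<^sub>1 c\<^sub>2 c\<^sub>3 \<phi>\<^sub>1 \<phi>\<^sub>2 K \<kappa>" and "0 < m" and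
      return: "\<exists>\<delta>>0. \<forall>x\<in>space E. \<delta> * semigroup.survival m x \<le> measure (transition m x) K"
      by blast
    have "K \<in> sets E" using drift by (simp add: semigroup.drift_criterion_def)
    with return have "0 < (INF x\<in>space E. \<P>(\<omega> in P (Some x). X (real m) \<omega> \<in> Some ` K
        \<bar> ereal (real m) < absorption_time I X \<omega>))"
      using uniform_return_iff[OF _ nonempty[OF \<pi>]] by blast
    with \<open>0 < m\<close> drift[folded condition_E_iff_drift_criterion] show ?criterion by blast
  next
    assume ?criterion
    then obtain n\<^sub>1 \<theta>\<^sub>1 \<theta>\<^sub>2 c\<^sub>1 c\<^sub>2 c\<^sub>3 \<phi>\<^sub>1 \<phi>\<^sub>2 K \<kappa> m where
      "condition_E E I X P n\<^sub>1 \<theta>\<^sub>1 \<theta>\<^sub>2 c\<^sub>1 c\<^sub>2 c\<^sub>3 \<phi>\<^sub>1 \<phi>\<^sub>2 K \<kappa> \<and> bounded (\<phi>\<^sub>1 ` space E)" and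
      return: "0 < (INF x\<in>space E. \<P>(\<omega> in P (Some x). X (real m) \<omega> \<in> Some ` K
        \<bar> ereal (real m) < absorption_time I X \<omega>))"
      by blast
    then have drift: "semigroup.drift_criterion n\<^sub>1 \<theta>\<^sub>1 \<theta>\<^sub>2 c\<^sub>1 c\<^sub>2 c\<^sub>3 \<phi>\<^sub>1 \<phi>\<^sub>2 K \<kappa>"
      by (simp only: condition_E_iff_drift_criterion)
    then have K: "K \<in> sets E" and \<kappa>: "\<kappa> \<in> space (prob_algebra (restrict_space E K))"
      by (simp_all add: semigroup.drift_criterion_def)
    have "space E \<noteq> {}"
      using prob_space.not_empty[of \<kappa>] \<kappa> sets_eq_imp_space_eq[of \<kappa> "restrict_space E K"]
      by (auto simp: space_prob_algebra space_restrict_space)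
    then obtain \<delta> where "0 < \<delta>"
      "\<And>x. x \<in> space E \<Longrightarrow> \<delta> * semigroup.survival m x \<le> measure (transition m x) K"
      using return uniform_return_iff[OF K] by blast
    from semigroup.drift_criterion_imp_exponential_convergence[OF drift this]
    obtain \<pi> C \<alpha> where "\<pi> \<in> space (prob_algebra E)" "0 < (C :: real)" "0 < \<alpha>" "\<alpha> < 1"
      "\<And>\<mu> n. \<mu> \<in> space (prob_algebra E) \<Longrightarrow> tv_dist E (semigroup.conditional \<mu> n) \<pi> \<le> C * \<alpha> ^ n"
      by blast
    then show ?convergence
      by (intro bexI[of _ \<pi>] exI[of _ C] exI[of _ \<alpha>]) (simp_all add: conditioned_law_eq)
  qed
qed

end
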